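(* Let $1\le p<\infty$. For every measurable subset $\Omega\subset\mathbb{R}^2$ of finite measure and every $f\in M^p(\mathbb{R})\setminus\{0\}$, $$\frac{\int_\Omega|\mathcal{V}f(x,\omega)|^p\,dx\,d\omega}{\int_{\mathbb{R}^2}|\mathcal{V}f(x,\omega)|^p\,dx\,d\omega}\le1-e^{-p|\Omega|/2}.$$ Moreover, equality occurs (for some $f$ and for some $\Omega$ such that $0<|\Omega|<\infty$) if and only if $\Omega$ is equivalent, up to a set of measure zero, to a ball centered at some $(x_0,\omega_0)\in\mathbb{R}^2$, and $$f(x)=c\,e^{2\pi ix\omega_0}\varphi(x-x_0)$$ for some $c\in\mathbb{C}\setminus\{0\}$.
   Context: The Gaussian window is $\varphi(x)=2^{1/4}e^{-\pi x^2}$, $x\in\mathbb{R}$. The Short-time Fourier transform (STFT) of $f\in L^2(\mathbb{R})$ is $$\mathcal{V}f(x,\omega)=\int_{\mathbb{R}}e^{-2\pi iy\omega}f(y)\varphi(x-y)\,dy,\qquad x,\omega\in\mathbb{R},$$ and it is extended to tempered distributions $f\in\mathcal{S}'(\mathbb{R})$ by interpreting the integral as the (bilinear) duality pairing of $f$ with the Schwartz function $y\mapsto e^{-2\pi iy\omega}\varphi(x-y)$. For $p\ge1$ the modulation space is $$M^p(\mathbb{R}):=\{f\in\mathcal{S}'(\mathbb{R}):\ \|f\|_{M^p}:=\|\mathcal{V}f\|_{L^p(\mathbb{R}^2)}<\infty\}.$$ $|\Omega|$ is the Lebesgue measure of $\Omega$. *)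

theory Defs
  imports "HOL-Analysis.Analysis"
begin

definition iter_deriv :: "nat \<Rightarrow> (real \<Rightarrow> complex) \<Rightarrow> real \<Rightarrow> complex" where
  "iter_deriv k g = ((\<lambda>h x. vector_derivative h (at x)) ^^ k) g"

definition schwartz_space :: "(real \<Rightarrow> complex) set" where
  "schwartz_space = {g.
     (\<forall>k x. iter_deriv k g differentiable (at x)) \<and>
     (\<forall>j k. bounded (range (\<lambda>x. x ^ j *\<^sub>R iter_deriv k g x)))}"

definition schwartz_seminorm :: "nat \<Rightarrow> nat \<Rightarrow> (real \<Rightarrow> complex) \<Rightarrow> real" where
  "schwartz_seminorm j k g = (SUP x. \<bar>x\<bar> ^ j * norm (iter_deriv k g x))"

definition schwartz_topology :: "(real \<Rightarrow> complex) topology" where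
  "schwartz_topology = topology_generated_by
     {{h \<in> schwartz_space. schwartz_seminorm j k (\<lambda>x. h x - g x) < e} | j k g e.
        g \<in> schwartz_space \<and> 0 < e}"

text \<open>Only the values of a distribution on \<^const>\<open>schwartz_space\<close> are meaningful; accordingly,
  distributions are compared with \<open>distr_eq\<close> below and not with HOL equality.\<close>

definition tempered_distributions :: "((real \<Rightarrow> complex) \<Rightarrow> complex) set" where
  "tempered_distributions = {T.
     (\<forall>g\<in>schwartz_space. \<forall>h\<in>schwartz_space. \<forall>a b.
        T (\<lambda>x. a * g x + b * h x) = a * T g + b * T h) \<and>
     continuous_map schwartz_topology euclidean T}"

definition distr_eq ::
    "((real \<Rightarrow> complex) \<Rightarrow> complex) \<Rightarrow> ((real \<Rightarrow> complex) \<Rightarrow> complex) \<Rightarrow> bool" where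
  "distr_eq S T \<longleftrightarrow> (\<forall>g\<in>schwartz_space. S g = T g)"

text \<open>The embedding of functions into distributions by the bilinear pairing (no conjugation).\<close>

definition distr_of_fun :: "(real \<Rightarrow> complex) \<Rightarrow> (real \<Rightarrow> complex) \<Rightarrow> complex" where
  "distr_of_fun f g = (LINT y|lborel. f y * g y)"

definition gauss_window :: "real \<Rightarrow> complex" where
  "gauss_window x = of_real (2 powr (1/4) * exp (- pi * x\<^sup>2))"

definition stft :: "((real \<Rightarrow> complex) \<Rightarrow> complex) \<Rightarrow> real \<times> real \<Rightarrow> complex" where
  "stft T = (\<lambda>(x, \<omega>). T (\<lambda>y. exp (- 2 * of_real pi * \<i> * of_real y * of_real \<omega>) * gauss_window (x - y)))"

text \<open>On functions this is the usual integral formula.\<close>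

lemma stft_distr_of_fun:
  "stft (distr_of_fun f) (x, \<omega>) =
     (LINT y|lborel. exp (- 2 * of_real pi * \<i> * of_real y * of_real \<omega>) * f y * gauss_window (x - y))"
  by (simp add: stft_def distr_of_fun_def mult_ac)

definition Lp_norm :: "real \<Rightarrow> 'a measure \<Rightarrow> ('a \<Rightarrow> complex) \<Rightarrow> ennreal" where
  "Lp_norm p M F =
     (let I = (\<integral>\<^sup>+ z. ennreal (norm (F z) powr p) \<partial>M)
      in if I = \<infinity> then \<infinity> else ennreal (enn2real I powr (1 / p)))"

text \<open>No measurability condition is needed: the STFT of a tempered distribution is continuous.\<close>

definition modulation_norm :: "real \<Rightarrow> ((real \<Rightarrow> complex) \<Rightarrow> complex) \<Rightarrow> ennreal" where
  "modulation_norm p T = Lp_norm p lebesgue (stft T)"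

definition modulation_space :: "real \<Rightarrow> ((real \<Rightarrow> complex) \<Rightarrow> complex) set" where
  "modulation_space p = {T \<in> tempered_distributions. modulation_norm p T < \<infinity>}"

definition stft_concentration ::
    "real \<Rightarrow> (real \<times> real) set \<Rightarrow> ((real \<Rightarrow> complex) \<Rightarrow> complex) \<Rightarrow> real" where
  "stft_concentration p \<Omega> T =
     (LINT z:\<Omega>|lebesgue. norm (stft T z) powr p) / (LINT z|lebesgue. norm (stft T z) powr p)"

end

theory Submission
  imports Defs "HOL-Complex_Analysis.Complex_Analysis" "HOL-Probability.Probability"
    "HOL-Real_Asymp.Real_Asymp"
begin

text \<open>
  The modulus of the STFT is \<open>|F(z)| exp (- pi |z|^2 / 2)\<close> with \<open>F\<close> entire, so for
  \<open>u = |STFT|^p\<close> the function \<open>v = ln u\<close> satisfies \<open>\<Delta>v = - 2 pi p\<close> off the zeros of \<open>F\<close>.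
  For a ramp \<open>\<psi>\<close> that increases from the level \<open>a\<close> to the level \<open>b\<close>, Green's formula evaluates the
      Dirichlet
  integral of \<open>\<psi>(v)\<close>, and the sharp Sobolev inequality \<open>2 sqrt (pi \<integral>g^2) \<le> \<integral>|\<nabla>g|\<close> (proved
  with the Knothe transport map, in place of the coarea formula and the isoperimetric inequality)
  bounds it from below. In the limit of fine subdivisions the measure \<open>m(t)\<close> of
  \<open>{u > t}\<close> satisfies \<open>m(s) - m(t) \<ge> (2/p) (ln t - ln s)\<close>. Comparison with the Gaussian, for which
  equality holds, gives the bound. Equality for one set forces \<open>\<integral>u = (2/p) max u\<close>; recentring at a
  maximum and comparing \<open>|G|^p\<close> with its tangent line \<open>1 + p (Re G
      - 1)\<close>, whose Gaussian mean is known
  from the mean value property, shows that \<open>F\<close> is an exponential. A tempered distribution is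
      determined by
  its values on Gaussians, so \<open>f\<close> itself is the Gaussian.
\<close>

section \<open>The sharp Sobolev inequality in the plane\<close>

text \<open>The bound is isoperimetric in nature: for a Gaussian the superlevel sets are discs and
  the decay of \<open>m\<close> holds with equality. The classical derivation differentiates
  \<open>m\<close> and needs regular level curves of finite length. Here two levels are compared at
  a time instead. A ramp that vanishes below the lower level turns \<open>ln u\<close> into a
  \<open>C^1\<close> function of compact support on the whole plane, so the singularities of
  \<open>ln u\<close> at the zeros of \<open>F\<close> are never met. The price is that each
  comparison of two levels is lossy, and the loss disappears only in a limit of subdivisions.
  Because of that limit, equality cannot be traced back through the Sobolev inequality; a single
  numerical identity survives, and rigidity has to be proved from it by a separate argument. A
  second obstacle is that the STFT tests a distribution only on Gaussians of one width, whereas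
  \<open>distr_eq\<close> demands agreement on every Schwartz function: the heat equation reaches
  the other widths, and narrow Gaussians act as an approximate identity.\<close>

text \<open>The distribution function of the first coordinate of a uniformly distributed point of the unit
    disc.\<close>
definition semicircle_cdf :: "real \<Rightarrow> real" where
  "semicircle_cdf t = (arcsin t + t * sqrt (1 - t\<^sup>2)) / pi + 1 / 2"

lemma semicircle_cdf_deriv:
  assumes "-1 < t" "t < 1"
  shows "(semicircle_cdf has_real_derivative (2 / pi * sqrt (1 - t\<^sup>2))) (at t)"
proof -
  have "t\<^sup>2 < 1" using assms by (simp add: abs_square_less_1)
  then have pos: "0 < 1 - t\<^sup>2" by simp
  have "(semicircle_cdf has_real_derivative
      ((inverse (sqrt (1 - t\<^sup>2)) + (1 * sqrt (1 - t\<^sup>2) +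
         (- (2 * t)) * (inverse (sqrt (1 - t\<^sup>2)) / 2) * t)) / pi)) (at t)"
    unfolding semicircle_cdf_def[abs_def] using assms pos
    by (auto intro!: derivative_eq_intros simp: power2_eq_square)
  also have "(inverse (sqrt (1 - t\<^sup>2)) + (1 * sqrt (1 - t\<^sup>2) +
         (- (2 * t)) * (inverse (sqrt (1 - t\<^sup>2)) / 2) * t)) / pi = 2 / pi * sqrt (1 - t\<^sup>2)"
    using pos by (simp add: field_simps power2_eq_square)
  finally show ?thesis .
qed

lemma semicircle_cdf_continuous: "continuous_on {-1..1} semicircle_cdf"
  unfolding semicircle_cdf_def[abs_def] by (intro continuous_intros) auto

lemma semicircle_cdf_strict_mono:
  assumes "-1 \<le> a" "a < b" "b \<le> 1"
  shows "semicircle_cdf a < semicircle_cdf b"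
proof (rule DERIV_pos_imp_increasing_open[OF \<open>a < b\<close>])
  fix t assume t: "a < t" "t < b"
  then have "t\<^sup>2 < 1" using assms by (simp add: abs_square_less_1)
  then show "\<exists>y. (semicircle_cdf has_real_derivative y) (at t) \<and> 0 < y"
    using semicircle_cdf_deriv[of t] t assms by (intro exI conjI) auto
next
  show "continuous_on {a..b} semicircle_cdf"
    using assms by (intro continuous_on_subset[OF semicircle_cdf_continuous]) auto
qed

text \<open>The inverse of \<open>semicircle_cdf\<close>; its derivative is the reciprocal of the
  semicircle density. That density vanishes at both ends, so the derivative is claimed only for
  \<open>0 < s < 1\<close>.\<close>

lemma semicircle_quantile:
  obtains Q :: "real \<Rightarrow> real" where
    "Q \<in> borel_measurable borel" "\<And>s. \<bar>Q s\<bar> \<le> 1" "\<And>s. 0 < s \<Longrightarrow> s < 1 \<Longrightarrow> \<bar>Q s\<bar> < 1"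
    "\<And>s. 0 < s \<Longrightarrow> s < 1 \<Longrightarrow>
       (Q has_real_derivative (pi / (2 * sqrt (1 - (Q s)\<^sup>2)))) (at s)"
proof -
  have inj: "inj_on semicircle_cdf {-1..1}"
    by (rule inj_onI) (metis atLeastAtMost_iff linorder_neqE_linordered_idom
        order_less_irrefl semicircle_cdf_strict_mono)
  define q where "q = the_inv_into {-1..1} semicircle_cdf"
  have q_left: "q (semicircle_cdf t) = t" if "t \<in> {-1..1}" for t
    unfolding q_def using the_inv_into_f_f[OF inj that] .
  have m1: "semicircle_cdf (-1) = 0" and p1: "semicircle_cdf 1 = 1"
    by (simp_all add: semicircle_cdf_def field_simps)
  have img: "semicircle_cdf ` {-1..1} = {0..1}"
  proof
    show "semicircle_cdf ` {-1..1} \<subseteq> {0..1}"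
      using semicircle_cdf_strict_mono[of "-1"] semicircle_cdf_strict_mono[of _ 1]
      by (force simp: m1 p1 less_eq_real_def)
    show "{0..1} \<subseteq> semicircle_cdf ` {-1..1}"
    proof
      fix s :: real assume "s \<in> {0..1}"
      then obtain x where "-1 \<le> x" "x \<le> 1" "semicircle_cdf x = s"
        using IVT'[of semicircle_cdf "-1" s 1] semicircle_cdf_continuous m1 p1 by auto
      then show "s \<in> semicircle_cdf ` {-1..1}" by auto
    qed
  qed
  have q_right: "semicircle_cdf (q s) = s" and q_mem: "q s \<in> {-1..1}" if "s \<in> {0..1}" for s
    using f_the_inv_into_f[OF inj, of s] the_inv_into_into[OF inj, of s "{-1..1}"] that
    unfolding q_def by (auto simp: img)
  have q_strict: "\<bar>q s\<bar> < 1" if "0 < s" "s < 1" for s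
  proof -
    have "q s \<noteq> 1" "q s \<noteq> -1" using q_right[of s] m1 p1 that by force+
    then show ?thesis using q_mem[of s] that by auto
  qed
  have q_cont: "continuous_on {0..1} q"
    using continuous_on_inv[OF semicircle_cdf_continuous, of q] q_left by (simp add: img)
  have q_deriv: "(q has_real_derivative (pi / (2 * sqrt (1 - (q s)\<^sup>2)))) (at s)"
    if s: "0 < s" "s < 1" for s
  proof -
    have "(q s)\<^sup>2 < 1" using q_strict[OF s] by (simp add: abs_square_less_1)
    have "(q has_real_derivative inverse (2 / pi * sqrt (1 - (q s)\<^sup>2))) (at s)"
    proof (rule DERIV_inverse_function[of semicircle_cdf _ _ _ 0 1])
      show "(semicircle_cdf has_real_derivative 2 / pi * sqrt (1 - (q s)\<^sup>2)) (at (q s))"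
        using q_strict[OF s] by (intro semicircle_cdf_deriv) auto
      show "isCont q s"
        by (rule continuous_on_interior[OF q_cont]) (use s in \<open>simp add:
            interior_atLeastAtMost_real\<close>)
    qed (use s q_right \<open>(q s)\<^sup>2 < 1\<close> in auto)
    then show ?thesis by (simp add: divide_simps)
  qed
  \<comment> \<open>The value 0 outside \<open>{0<..<1}\<close> gives a Borel function on the whole
    line that is bounded by 1, whatever \<open>the_inv_into\<close> returns outside the unit
    interval.\<close>
  define Q where "Q s = indicator {0<..<1} s * q s" for s
  have Qq: "Q s = q s" if "0 < s" "s < 1" for s using that by (simp add: Q_def)
  show thesis
  proof (rule that[of Q])
    have "(\<lambda>s. indicator {0<..<1} s *\<^sub>R q s) \<in> borel_measurable borel"
      by (intro borel_measurable_continuous_on_indicator continuous_on_subset[OF q_cont]) auto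
    then show "Q \<in> borel_measurable borel" by (simp add: Q_def[abs_def])
    show "\<bar>Q s\<bar> \<le> 1" for s
      using q_strict[of s] by (cases "0 < s \<and> s < 1") (auto simp: Q_def indicator_def)
    show "\<bar>Q s\<bar> < 1" if "0 < s" "s < 1" for s using q_strict Qq that by simp
    show "(Q has_real_derivative (pi / (2 * sqrt (1
        - (Q s)\<^sup>2)))) (at s)" if s: "0 < s" "s < 1" for s
      unfolding Qq[OF s]
      by (rule DERIV_cong[OF DERIV_subset[OF has_field_derivative_transform_within_open[OF
          q_deriv[OF s], of "{0<..<1}"]]])
         (use s Qq in auto)
  qed
qed

section \<open>Compactly supported functions of one variable\<close>

text \<open>Only the sum \<open>p + q\<close> is assumed to be a derivative; this covers products in which
  one factor fails to be differentiable where the other one vanishes.\<close>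
lemma nn_integral_of_deriv_eq_zero:
  fixes f p q :: "real \<Rightarrow> real"
  assumes der: "\<And>x. (f has_real_derivative (p x + q x)) (at x)"
    and p: "integrable lborel p" and q: "q \<in> borel_measurable borel" "\<And>x. 0 \<le> q x"
    and supp: "\<And>x. R \<le> \<bar>x\<bar> \<Longrightarrow> f x = 0 \<and> p x = 0 \<and> q x = 0"
  shows "(\<integral>\<^sup>+x. q x \<partial>lborel) = ennreal (- (LINT x|lborel. p x))"
    and "0 \<le> - (LINT x|lborel. p x)"
proof -
  define S where "S = \<bar>R\<bar> + 1"
  have "((\<lambda>x. p x + q x) has_integral (f S - f (-S))) {-S..S}"
    by (rule fundamental_theorem_of_calculus)
       (use der in \<open>auto simp: S_def has_real_derivative_iff_has_vector_derivative[symmetric]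
          intro: has_field_derivative_at_within\<close>)
  then have "((\<lambda>x. p x + q x) has_integral 0) {-S..S}"
    using supp[of S] supp[of "-S"] by (simp add: S_def)
  then have "((\<lambda>x. p x + q x) has_integral 0) UNIV"
    by (rule has_integral_on_superset) (use supp in \<open>auto simp: S_def\<close>)
  from has_integral_diff[OF this has_integral_integral_lborel[OF p]]
  have "(q has_integral (- (LINT x|lborel. p x))) UNIV" by simp
  from nn_integral_has_integral_lborel[OF q this] has_integral_nonneg[OF this] q(2)
  show "(\<integral>\<^sup>+x. q x \<partial>lborel) = ennreal (- (LINT x|lborel. p x))"
    and "0 \<le> - (LINT x|lborel. p x)" by auto
qed

lemma continuous_compact_support_integrable:
  fixes h :: "'a::euclidean_space \<Rightarrow> real"
  assumes "continuous_on UNIV h" "\<And>x. x \<notin> cbox a b \<Longrightarrow> h x = 0"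
  shows "integrable lborel h"
proof -
  have "integrable lborel (\<lambda>x. indicator (cbox a b) x *\<^sub>R h x)"
    by (rule borel_integrable_compact) (use assms in \<open>auto intro: continuous_on_subset\<close>)
  also have "(\<lambda>x. indicator (cbox a b) x *\<^sub>R h x) = h"
  proof
    fix x show "indicator (cbox a b) x *\<^sub>R h x = h x"
      using assms(2)[of x] by (cases "x \<in> cbox a b") auto
  qed
  finally show ?thesis .
qed

lemma has_real_derivative_integral_atMost:
  fixes h :: "real \<Rightarrow> real"
  assumes cont: "continuous_on UNIV h" and supp: "\<And>x. R \<le> \<bar>x\<bar> \<Longrightarrow> h x = 0"
  shows "((\<lambda>y. LINT s|lborel. indicator {..y} s * h s) has_real_derivative h y) (at y)"
proof -
  \<comment> \<open>\<open>L\<close> lies to the left of the support and of \<open>y\<close>, so for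
    all \<open>z\<close> near \<open>y\<close> the half-line integral is an ordinary integral over
    \<open>{L..z}\<close>.\<close>
  define L where "L = min (y - 1) (- \<bar>R\<bar> - 1)"
  have eq: "(LINT s|lborel. indicator {..z} s * h s) = integral {L..z} h" if "L < z" for z
  proof -
    have "set_integrable lborel {L..z} h"
      unfolding set_integrable_def
      by (rule borel_integrable_compact) (use cont in \<open>auto intro: continuous_on_subset\<close>)
    from set_borel_integral_eq_integral(2)[OF this]
    have "integral {L..z} h = (LINT s|lborel. indicator {L..z} s * h s)"
      by (simp add: set_lebesgue_integral_def)
    also have "\<dots> = (LINT s|lborel. indicator {..z} s * h s)"
      using supp by (intro Bochner_Integration.integral_cong) (auto simp: indicator_def L_def)
    finally show ?thesis by simp
  qed
  have "((\<lambda>z. integral {L..z} h) has_real_derivative h y) (at y within {L..y+1})"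
    by (rule integral_has_real_derivative)
       (use cont in \<open>auto simp: L_def intro: continuous_on_subset\<close>)
  then have "((\<lambda>z. integral {L..z} h) has_real_derivative h y) (at y)"
    by (subst (asm) at_within_interior) (auto simp: L_def)
  then show ?thesis
    by (rule has_field_derivative_transform_within_open[of _ _ _ "{L<..}"])
       (auto simp: L_def eq[unfolded L_def])
qed


section \<open>Fubini in the plane\<close>

lemma nn_integral_lborel_pair:
  fixes f :: "real \<times> real \<Rightarrow> ennreal"
  assumes "f \<in> borel_measurable borel"
  shows "(\<integral>\<^sup>+z. f z \<partial>lborel) = (\<integral>\<^sup>+x. \<integral>\<^sup>+y. f (x, y) \<partial>lborel \<partial>lborel)"
    and "(\<integral>\<^sup>+z. f z \<partial>lborel) = (\<integral>\<^sup>+y. \<integral>\<^sup>+x. f (x, y) \<partial>lborel \<partial>lborel)"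
proof -
  have f: "f \<in> borel_measurable (lborel \<Otimes>\<^sub>M lborel)" using assms by (simp add: lborel_prod)
  show "(\<integral>\<^sup>+z. f z \<partial>lborel) = (\<integral>\<^sup>+x. \<integral>\<^sup>+y. f (x, y) \<partial>lborel \<partial>lborel)"
    using lborel.nn_integral_fst[OF f] by (simp add: lborel_prod)
  show "(\<integral>\<^sup>+z. f z \<partial>lborel) = (\<integral>\<^sup>+y. \<integral>\<^sup>+x. f (x, y) \<partial>lborel \<partial>lborel)"
    using lborel_pair.nn_integral_snd[of f] f by (simp add: lborel_prod)
qed

lemma integral_lborel_pair:
  fixes f :: "real \<times> real \<Rightarrow> 'b::euclidean_space"
  assumes "integrable lborel f"
  shows "integrable lborel (\<lambda>x. LINT y|lborel. f (x, y))"
    and "integrable lborel (\<lambda>y. LINT x|lborel. f (x, y))"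
    and "(LINT z|lborel. f z) = (LINT x|lborel. LINT y|lborel. f (x, y))"
    and "(LINT z|lborel. f z) = (LINT y|lborel. LINT x|lborel. f (x, y))"
proof -
  have f: "integrable (lborel \<Otimes>\<^sub>M lborel) (\<lambda>(x, y). f (x, y))" using assms
      by (simp add: lborel_prod)
  show "integrable lborel (\<lambda>x. LINT y|lborel. f (x, y))"
    "integrable lborel (\<lambda>y. LINT x|lborel. f (x, y))"
    "(LINT z|lborel. f z) = (LINT x|lborel. LINT y|lborel. f (x, y))"
    "(LINT z|lborel. f z) = (LINT y|lborel. LINT x|lborel. f (x, y))"
    using lborel_pair.integrable_fst[OF f] lborel_pair.integrable_snd[OF f]
      lborel_pair.integral_fst[OF f] lborel_pair.integral_snd[OF f] by (simp_all add: lborel_prod)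
qed

text \<open>The difference quotient of the product is dominated by that of \<open>h\<close>, so
  \<open>k\<close> may fail to be differentiable. This serves on lines where the marginal density
  vanishes and the transport map may have no derivative.\<close>

lemma deriv_zero_mult_bounded:
  fixes h k :: "real \<Rightarrow> real"
  assumes "(h has_real_derivative 0) (at x)" "h x = 0" "\<And>t. \<bar>k t\<bar> \<le> 1"
  shows "((\<lambda>t. h t * k t) has_real_derivative 0) (at x)"
proof -
  have "((\<lambda>t. (h t - h x) / (t - x)) \<longlongrightarrow> 0) (at x)"
    using assms(1) by (simp add: has_field_derivative_iff)
  then have "((\<lambda>t. (h t * k t - h x * k x) / (t - x)) \<longlongrightarrow> 0) (at x)"
  proof (rule Lim_null_comparison[rotated, OF tendsto_rabs_zero])
    have "norm ((h t * k t - h x * k x) / (t - x)) \<le> \<bar>(h t - h x) / (t - x)\<bar>" for t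
      using mult_left_mono[OF assms(3)[of t], of "\<bar>h t\<bar>"] assms(2)
      by (simp add: abs_mult divide_right_mono)
    then show "\<forall>\<^sub>F t in at x. norm ((h t * k t - h x * k x) / (t - x)) \<le> \<bar>(h t - h x) / (t - x)\<bar>"
      by simp
  qed
  then show ?thesis by (simp add: has_field_derivative_iff)
qed

lemma square_supp_not_in_cbox:
  fixes z :: "real \<times> real"
  assumes "z \<notin> cbox (-R, -R) (R, R)"
  shows "R \<le> \<bar>fst z\<bar> \<or> R \<le> \<bar>snd z\<bar>"
  using assms by (cases z) (auto simp: cbox_Pair_eq)

text \<open>The Knothe map \<open>(T1, T2)\<close> transports the density \<open>g^2 / M\<close> to the uniform distribution on the
    unit
  disc, so \<open>D1 * D2 = pi g^2 / M\<close> for its diagonal derivatives, and \<open>D1 + D2 \<ge> 2 sqrt (D1 * D2)\<close> is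
  integrated against \<open>g\<close> by parts.\<close>
theorem sobolev_plane:
  fixes g gx gy :: "real \<times> real \<Rightarrow> real"
  assumes nonneg: "\<And>z. 0 \<le> g z"
    and cont: "continuous_on UNIV g" "continuous_on UNIV gx" "continuous_on UNIV gy"
    and dx: "\<And>x y. ((\<lambda>x. g (x, y)) has_real_derivative gx (x, y)) (at x)"
    and dy: "\<And>x y. ((\<lambda>y. g (x, y)) has_real_derivative gy (x, y)) (at y)"
    and supp: "\<And>x y. R \<le> \<bar>x\<bar> \<or> R \<le> \<bar>y\<bar> \<Longrightarrow> g (x, y) = 0"
  shows "2 * sqrt (pi * (LINT z|lborel. (g z)\<^sup>2)) \<le> (LINT z|lborel. sqrt ((gx z)\<^sup>2 + (gy z)\<^sup>2))"
proof -
  \<comment> \<open>A zero of \<open>g\<close> is a minimum, so the gradient vanishes there as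
    well.\<close>
  have gx0: "gx (x, y) = 0" if "g (x, y) = 0" for x y
    by (rule DERIV_local_min[OF dx, of 1]) (auto simp: that nonneg)
  have gy0: "gy (x, y) = 0" if "g (x, y) = 0" for x y
    by (rule DERIV_local_min[OF dy, of 1]) (auto simp: that nonneg)
  note suppx = gx0[OF supp] and suppy = gy0[OF supp]
  have [measurable]: "g \<in> borel_measurable borel" "gx \<in> borel_measurable borel"
      "gy \<in> borel_measurable borel"
    using cont by (auto intro: borel_measurable_continuous_onI)
  have int_pair: "integrable lborel h"
    if "continuous_on UNIV h" "\<And>x y. R \<le> \<bar>x\<bar> \<or> R \<le> \<bar>y\<bar> \<Longrightarrow> h (x, y) = 0" for h :: "real \<times> real \<Rightarrow> real"
    by (rule continuous_compact_support_integrable[OF that(1), of "(-R, -R)" "(R, R)"])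
       (use that(2) square_supp_not_in_cbox in \<open>force\<close>)
  have int_line: "integrable lborel h"
    if "continuous_on UNIV h" "\<And>x. R \<le> \<bar>x\<bar> \<Longrightarrow> h x = 0" for h :: "real \<Rightarrow> real"
    by (rule continuous_compact_support_integrable[OF that(1), of "-R" R]) (use that(2) in force)
  have contL: "continuous_on UNIV (\<lambda>x. h (x, y))" "continuous_on UNIV (\<lambda>y. h (x, y))"
    if "continuous_on UNIV h" for h :: "real \<times> real \<Rightarrow> real" and x y
    using that by (auto intro!: continuous_on_compose2[of UNIV h] continuous_intros)
  define M where "M = (LINT z|lborel. (g z)\<^sup>2)"
  \<comment> \<open>The first marginal of the density \<open>g^2\<close>, whose total mass is
    \<open>M\<close>.\<close>
  define A where "A x = (LINT s|lborel. (g (x, s))\<^sup>2)" for x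
  have int_g2: "integrable lborel (\<lambda>z. (g z)\<^sup>2)"
    by (rule int_pair) (auto intro!: continuous_intros cont simp: supp)
  have int_g2L: "integrable lborel (\<lambda>s. (g (x, s))\<^sup>2)" for x
    by (rule int_line) (auto intro!: continuous_intros contL cont simp: supp)
  have M_A: "M = (LINT x|lborel. A x)" and int_A: "integrable lborel A"
    unfolding M_def A_def[abs_def] using integral_lborel_pair[OF int_g2] by auto
  have A_nonneg: "0 \<le> A x" for x unfolding A_def by (intro integral_nonneg_AE) auto
  have A_supp: "A x = 0" if "R \<le> \<bar>x\<bar>" for x using that by (simp add: A_def supp)
  \<comment> \<open>Written over a fixed compact interval, the marginal is seen to depend
    continuously on \<open>x\<close>.\<close>
  have A_eq: "A x = integral (cbox (-R) R) (\<lambda>s. (g (x, s))\<^sup>2)" for x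
  proof -
    have "set_integrable lborel (cbox (-R) R) (\<lambda>s. (g (x, s))\<^sup>2)"
      unfolding set_integrable_def by (rule integrable_mult_indicator[OF _ int_g2L]) auto
    from set_borel_integral_eq_integral(2)[OF this]
    have "integral (cbox (-R) R) (\<lambda>s. (g (x, s))\<^sup>2)
        = (LINT s|lborel. indicator (cbox (-R) R) s * (g (x, s))\<^sup>2)"
      by (simp add: set_lebesgue_integral_def)
    also have "\<dots> = A x"
      unfolding A_def
    proof (intro Bochner_Integration.integral_cong refl)
      fix s show "indicator (cbox (-R) R) s * (g (x, s))\<^sup>2 = (g (x, s))\<^sup>2"
        using supp[of x s] by (cases "R \<le> \<bar>x\<bar> \<or> R \<le> \<bar>s\<bar>") (auto simp: indicator_def)
    qed
    finally show ?thesis by simp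
  qed
  have A_cont: "continuous_on UNIV A"
    unfolding A_eq[abs_def]
    by (rule integral_continuous_on_param)
       (auto intro!: continuous_intros continuous_on_subset[OF cont(1)] simp: case_prod_beta)
  have A_zero: "g (x, s) = 0" if "A x = 0" for x s
  proof (cases "\<bar>s\<bar> < R")
    case True
    have "((\<lambda>s. (g (x, s))\<^sup>2) has_integral 0) (cbox (-R) R)"
      using that A_eq[of x]
      by (metis contL(2)[OF cont(1)] continuous_on_power continuous_on_subset has_integral_integral
          integrable_continuous subset_UNIV)
    from has_integral_0_cbox_imp_0[OF _ _ this, of s] True
    have "(g (x, s))\<^sup>2 = 0"
      by (force intro!: continuous_intros continuous_on_subset[OF contL(2)[OF cont(1)]] simp:
          box_ne_empty)
    then show ?thesis by simp
  qed (use supp in auto)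
  show ?thesis
  proof (cases "M = 0")
    case True
    then show ?thesis by (simp add: M_def integral_nonneg_AE)
  next
    case False
    have "0 \<le> M" unfolding M_def by (intro integral_nonneg_AE) auto
    with False have M: "0 < M" by simp
    define C where "C x = (LINT t|lborel. indicator {..x} t * A t)" for x
    have C_deriv: "(C has_real_derivative A x) (at x)" for x
      unfolding C_def[abs_def] by (rule has_real_derivative_integral_atMost[OF A_cont A_supp])
    have C0: "0 \<le> C x" for x
      unfolding C_def using A_nonneg by (intro integral_nonneg_AE) auto
    have int_CA: "integrable lborel (\<lambda>t. indicator {..x} t * A t)" for x
      using integrable_mult_indicator[OF _ int_A, of "{..x}"] by simp
    have CM: "C x \<le> M" for x
      unfolding C_def M_A using A_nonneg int_A int_CA
      by (intro integral_mono) (auto simp: indicator_def)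
    \<comment> \<open>\<open>C\<close> takes its values between 0 and \<open>M\<close>; attaining
      one of these bounds would make \<open>x\<close> an extremum and force the derivative
      \<open>A x\<close> to be 0.\<close>
    have C_strict: "0 < C x / M" "C x / M < 1" if "0 < A x" for x
    proof -
      have "C x \<noteq> 0"
        using DERIV_local_min[OF C_deriv[of x], of 1] C0 that by auto
      then show "0 < C x / M" using C0[of x] M by auto
      have "C x \<noteq> M"
        using DERIV_local_max[OF C_deriv[of x], of 1] CM that by auto
      then show "C x / M < 1" using CM[of x] M by auto
    qed
    obtain Q :: "real \<Rightarrow> real" where Q: "Q \<in> borel_measurable borel" "\<And>s. \<bar>Q s\<bar> \<le> 1"
        "\<And>s. 0 < s \<Longrightarrow> s < 1 \<Longrightarrow> \<bar>Q s\<bar> < 1"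
        "\<And>s. 0 < s \<Longrightarrow> s < 1 \<Longrightarrow>
         (Q has_real_derivative (pi / (2 * sqrt (1 - (Q s)\<^sup>2)))) (at s)"
      using semicircle_quantile by metis
    note Q(1)[measurable]
    \<comment> \<open>\<open>T1\<close> matches the first marginal with that of the disc. The
      vertical chord of the disc at abscissa \<open>T1 x\<close> has half length \<open>w x\<close>,
      and \<open>T2\<close> maps the conditional distribution function \<open>G / A\<close> affinely
      onto that chord. Where \<open>A\<close> vanishes, \<open>D1\<close> and \<open>D2\<close> are
      0, the latter by division by 0.\<close>
    define T1 where "T1 x = Q (C x / M)" for x
    define w where "w x = sqrt (1 - (T1 x)\<^sup>2)" for x
    define D1 where "D1 x = pi / (2 * w x) * (A x / M)" for x
    define G where "G z = (LINT s|lborel. indicator {..snd z} s * (g (fst z, s))\<^sup>2)" for z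
    define T2 where "T2 z = w (fst z) * (2 * G z / A (fst z) - 1)" for z
    define D2 where "D2 z = w (fst z) * (2 * (g z)\<^sup>2 / A (fst z))" for z
    have [measurable]: "A \<in> borel_measurable borel"
      by (rule borel_measurable_continuous_onI[OF A_cont])
    have [measurable]: "C \<in> borel_measurable borel"
      using C_deriv by (intro borel_measurable_continuous_onI) (meson DERIV_isCont
          continuous_at_imp_continuous_on)
    have [measurable]: "T1 \<in> borel_measurable borel" unfolding T1_def[abs_def] by measurable
    have [measurable]: "w \<in> borel_measurable borel" unfolding w_def[abs_def] by measurable
    have [measurable]: "D1 \<in> borel_measurable borel" unfolding D1_def[abs_def] by measurable
    have [measurable]: "g \<in> borel_measurable (borel \<Otimes>\<^sub>M borel)"
      by (simp add: borel_prod)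
    have "(\<lambda>z :: real \<times> real. LINT s|lborel. (if s \<le> snd z then (g (fst z, s))\<^sup>2 else 0))
        \<in> borel_measurable (borel \<Otimes>\<^sub>M borel)"
      by measurable
    then have "(\<lambda>z :: real \<times> real. LINT s|lborel. (if s \<le> snd z then (g (fst z, s))\<^sup>2 else 0))
        \<in> borel_measurable borel"
      by (simp only: borel_prod)
    also have "(\<lambda>z. LINT s|lborel. (if s \<le> snd z then (g (fst z, s))\<^sup>2 else 0)) = G"
      by (auto simp: G_def fun_eq_iff indicator_def intro!: Bochner_Integration.integral_cong)
    finally have [measurable]: "G \<in> borel_measurable borel" .
    have [measurable]: "(fst :: real \<times> real \<Rightarrow> real) \<in> borel_measurable borel"
      by (intro borel_measurable_continuous_onI continuous_intros)
    have [measurable]: "T2 \<in> borel_measurable borel" unfolding T2_def[abs_def] by measurable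
    have [measurable]: "D2 \<in> borel_measurable borel" unfolding D2_def[abs_def] by measurable
    have T1_le: "\<bar>T1 x\<bar> \<le> 1" for x by (simp add: T1_def Q)
    have T1_sq: "(T1 x)\<^sup>2 \<le> 1" for x using T1_le[of x] by (simp add: abs_square_le_1)
    have w_nonneg: "0 \<le> w x" and w_sq: "(w x)\<^sup>2 = 1 - (T1 x)\<^sup>2" for x
      using T1_sq[of x] by (auto simp: w_def)
    have w_pos: "0 < w x" if "0 < A x" for x
      using Q(3)[OF C_strict[OF that]] by (simp add: w_def T1_def abs_square_less_1)
    have D1_nonneg: "0 \<le> D1 x" for x using w_nonneg A_nonneg M by (simp add: D1_def)
    have D2_nonneg: "0 \<le> D2 z" for z using w_nonneg A_nonneg M by (simp add: D2_def)
    have G_bounds: "0 \<le> G z" "G z \<le> A (fst z)" for z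
    proof -
      show "0 \<le> G z" unfolding G_def by (intro integral_nonneg_AE) auto
      show "G z \<le> A (fst z)" unfolding G_def A_def
        using integrable_mult_indicator[OF _ int_g2L, of "{..snd z}" "fst z"] int_g2L
        by (intro integral_mono) (auto simp: indicator_def)
    qed
    have "\<bar>2 * G z / A (fst z) - 1\<bar> \<le> 1" for z
      using G_bounds[of z] A_nonneg[of "fst z"]
      by (cases "A (fst z) = 0") (auto simp: abs_le_iff field_simps)
    then have "(2 * G z / A (fst z) - 1)\<^sup>2 \<le> 1" for z by (simp add: abs_square_le_1)
    then have T2_sq: "(T2 z)\<^sup>2 \<le> (w (fst z))\<^sup>2" for z
      by (simp add: T2_def power_mult_distrib mult_left_le)
    then have T_le: "(T1 (fst z))\<^sup>2 + (T2 z)\<^sup>2 \<le> 1" for z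
      using w_sq[of "fst z"] T2_sq[of z] by simp
    have T2_le: "\<bar>T2 z\<bar> \<le> 1" for z
    proof -
      have "(T2 z)\<^sup>2 \<le> 1" using T_le[of z] zero_le_power2[of "T1 (fst z)"] by linarith
      then show ?thesis by (simp add: abs_square_le_1)
    qed
    have T1_deriv: "(T1 has_real_derivative D1 x) (at x)" if "0 < A x" for x
    proof -
      have "((\<lambda>x. Q (C x / M)) has_real_derivative
          (pi / (2 * sqrt (1 - (Q (C x / M))\<^sup>2)) * (A x / M))) (at x)"
        using Q(4)[OF C_strict[OF that]] DERIV_cdivide[OF C_deriv[of x], of M]
        by (rule DERIV_chain2)
      then show ?thesis by (simp add: T1_def[abs_def] D1_def w_def)
    qed
    have G_deriv: "((\<lambda>y. G (x, y)) has_real_derivative (g (x, y))\<^sup>2) (at y)" for x y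
      unfolding G_def fst_conv snd_conv
      by (rule has_real_derivative_integral_atMost[of _ R])
         (auto intro!: continuous_intros contL cont simp: supp)
    have T2_deriv: "((\<lambda>y. T2 (x, y)) has_real_derivative D2 (x, y)) (at y)" for x y
    proof -
      have "((\<lambda>y. w x * (2 * G (x, y) / A x - 1)) has_real_derivative
          (w x * (2 * (g (x, y))\<^sup>2 / A x - 0))) (at y)"
        by (intro DERIV_cmult DERIV_diff DERIV_cdivide G_deriv DERIV_const)
      then show ?thesis by (simp add: T2_def D2_def)
    qed
    have dxT: "((\<lambda>x. g (x, y) * T1 x) has_real_derivative
        (gx (x, y) * T1 x + g (x, y) * D1 x)) (at x)" for x y
    proof (cases "A x = 0")
      case True
      then have "g (x, y) = 0" "gx (x, y) = 0" using A_zero gx0 by auto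
      then show ?thesis
        using deriv_zero_mult_bounded[of "\<lambda>x. g (x, y)" x T1] dx[of y x] T1_le by simp
    next
      case False
      then have "0 < A x" using A_nonneg[of x] by simp
      from DERIV_mult[OF dx T1_deriv[OF this]] show ?thesis by (simp add: algebra_simps)
    qed
    have dyT: "((\<lambda>y. g (x, y) * T2 (x, y)) has_real_derivative
        (gy (x, y) * T2 (x, y) + g (x, y) * D2 (x, y))) (at y)" for x y
      using DERIV_mult[OF dy T2_deriv] by (simp add: algebra_simps)
    have bnd: "integrable lborel (\<lambda>z. h z * k z)"
      if "integrable lborel h" "k \<in> borel_measurable borel" "\<And>z. \<bar>k z\<bar> \<le> 1"
      for h k :: "'c::euclidean_space \<Rightarrow> real"
    proof (rule Bochner_Integration.integrable_bound[OF that(1)])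
      show "AE z in lborel. norm (h z * k z) \<le> norm (h z)"
        using that(3) by (simp add: abs_mult mult_left_le)
    qed (use that in auto)
    have int_gx: "integrable lborel gx" "integrable lborel (\<lambda>x. gx (x, y))" for y
      using int_pair[OF cont(2) suppx] int_line[OF contL(1)[OF cont(2)] suppx] by auto
    have int_gy: "integrable lborel gy" "integrable lborel (\<lambda>y. gy (x, y))" for x
      using int_pair[OF cont(3) suppy] int_line[OF contL(2)[OF cont(3)] suppy] by auto
    have int_X: "integrable lborel (\<lambda>z. gx z * T1 (fst z))"
      by (rule bnd[OF int_gx(1)]) (auto simp: T1_le)
    have int_Y: "integrable lborel (\<lambda>z. gy z * T2 z)"
      by (rule bnd[OF int_gy(1)]) (auto simp: T2_le)
    \<comment> \<open>No bound on \<open>D1\<close> is at hand, because \<open>w\<close> may come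
      close to 0. Integration by parts on each horizontal line is what shows that
      \<open>g * D1\<close> has a finite integral.\<close>
    have X: "(\<integral>\<^sup>+z. ennreal (g z * D1 (fst z)) \<partial>lborel)
        = ennreal (- (LINT z|lborel. gx z * T1 (fst z)))"
      and X0: "0 \<le> - (LINT z|lborel. gx z * T1 (fst z))"
    proof -
      have 1: "(\<integral>\<^sup>+x. ennreal (g (x, y) * D1 x) \<partial>lborel)
          = ennreal (- (LINT x|lborel. gx (x, y) * T1 x))"
        and 2: "0 \<le> - (LINT x|lborel. gx (x, y) * T1 x)" for y
        by (rule nn_integral_of_deriv_eq_zero[OF dxT _ _ _, of _ R];
            auto intro!: bnd int_gx T1_le simp: nonneg D1_nonneg supp suppx)+
      have "(\<integral>\<^sup>+z. ennreal (g z * D1 (fst z)) \<partial>lborel)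
          = (\<integral>\<^sup>+y. ennreal (- (LINT x|lborel. gx (x, y) * T1 x)) \<partial>lborel)"
        by (subst nn_integral_lborel_pair(2)) (auto simp: 1)
      also have "\<dots> = ennreal (LINT y|lborel. - (LINT x|lborel. gx (x, y) * T1 x))"
        using integral_lborel_pair(2)[OF int_X] 2 by (intro nn_integral_eq_integral) auto
      also have eq: "(LINT y|lborel. - (LINT x|lborel. gx (x, y) * T1 x))
          = - (LINT z|lborel. gx z * T1 (fst z))"
        using integral_lborel_pair(4)[OF int_X] by simp
      finally show "(\<integral>\<^sup>+z. ennreal (g z * D1 (fst z)) \<partial>lborel)
          = ennreal (- (LINT z|lborel. gx z * T1 (fst z)))" .
      show "0 \<le> - (LINT z|lborel. gx z * T1 (fst z))"
        unfolding eq[symmetric] using 2 by (intro integral_nonneg_AE) auto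
    qed
    have Y: "(\<integral>\<^sup>+z. ennreal (g z * D2 z) \<partial>lborel) = ennreal (- (LINT z|lborel. gy z * T2 z))"
      and Y0: "0 \<le> - (LINT z|lborel. gy z * T2 z)"
    proof -
      have 1: "(\<integral>\<^sup>+y. ennreal (g (x, y) * D2 (x, y)) \<partial>lborel)
          = ennreal (- (LINT y|lborel. gy (x, y) * T2 (x, y)))"
        and 2: "0 \<le> - (LINT y|lborel. gy (x, y) * T2 (x, y))" for x
        by (rule nn_integral_of_deriv_eq_zero[OF dyT _ _ _, of _ R];
            auto intro!: bnd int_gy T2_le simp: nonneg D2_nonneg supp suppy)+
      have "(\<integral>\<^sup>+z. ennreal (g z * D2 z) \<partial>lborel)
          = (\<integral>\<^sup>+x. ennreal (- (LINT y|lborel. gy (x, y) * T2 (x, y))) \<partial>lborel)"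
        by (subst nn_integral_lborel_pair(1)) (auto simp: 1)
      also have "\<dots> = ennreal (LINT x|lborel. - (LINT y|lborel. gy (x, y) * T2 (x, y)))"
        using integral_lborel_pair(1)[OF int_Y] 2 by (intro nn_integral_eq_integral) auto
      also have eq: "(LINT x|lborel. - (LINT y|lborel. gy (x, y) * T2 (x, y)))
          = - (LINT z|lborel. gy z * T2 z)"
        using integral_lborel_pair(3)[OF int_Y] by simp
      finally show "(\<integral>\<^sup>+z. ennreal (g z * D2 z) \<partial>lborel)
          = ennreal (- (LINT z|lborel. gy z * T2 z))" .
      show "0 \<le> - (LINT z|lborel. gy z * T2 z)"
        unfolding eq[symmetric] using 2 by (intro integral_nonneg_AE) auto
    qed
    have am_gm: "2 * sqrt (pi / M) * (g z)\<^sup>2 \<le> g z * D1 (fst z) + g z * D2 z" for z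
    proof (cases "g z = 0")
      case False
      then have A: "0 < A (fst z)" using A_zero[of "fst z" "snd z"] A_nonneg[of "fst z"] by force
      have "D1 (fst z) * D2 z = pi / M * (g z)\<^sup>2"
        using A w_pos[OF A] by (simp add: D1_def D2_def field_simps)
      then have "sqrt (pi / M * (g z)\<^sup>2) \<le> (D1 (fst z) + D2 z) / 2"
        using arith_geo_mean_sqrt[OF D1_nonneg D2_nonneg, of "fst z" z] by simp
      then have "2 * sqrt (pi / M) * g z \<le> D1 (fst z) + D2 z"
        using nonneg[of z] by (simp add: real_sqrt_mult real_sqrt_divide mult_ac)
      from mult_left_mono[OF this nonneg[of z]] show ?thesis
        by (simp add: power2_eq_square algebra_simps)
    qed simp
    \<comment> \<open>Cauchy-Schwarz, together with the fact that \<open>(T1, T2)\<close> lies in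
      the unit disc.\<close>
    have cs: "- (gx z * T1 (fst z) + gy z * T2 z) \<le> sqrt ((gx z)\<^sup>2 + (gy z)\<^sup>2)" for z
    proof -
      have "(gx z * T1 (fst z) + gy z * T2 z)\<^sup>2
          \<le> ((gx z)\<^sup>2 + (gy z)\<^sup>2) * ((T1 (fst z))\<^sup>2 + (T2 z)\<^sup>2)"
        using zero_le_power2[of "gx z * T2 z - gy z * T1 (fst z)"]
        by (simp add: power2_eq_square algebra_simps)
      also have "\<dots> \<le> (gx z)\<^sup>2 + (gy z)\<^sup>2" using T_le[of z] by (simp add: mult_left_le)
      finally show ?thesis by (intro real_le_rsqrt) (simp only: power2_minus)
    qed
    have "ennreal (2 * sqrt (pi / M) * M) = (\<integral>\<^sup>+z. ennreal (2 * sqrt (pi / M) * (g z)\<^sup>2) \<partial>lborel)"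
      using int_g2 M by (subst nn_integral_eq_integral) (auto simp: M_def)
    also have "\<dots> \<le> (\<integral>\<^sup>+z. ennreal (g z * D1 (fst z)) + ennreal (g z * D2 z) \<partial>lborel)"
      using am_gm by (intro nn_integral_mono)
         (simp add: ennreal_plus[symmetric] nonneg D1_nonneg D2_nonneg del: ennreal_plus)
    also have "\<dots> = (\<integral>\<^sup>+z. ennreal (g z * D1 (fst z)) \<partial>lborel)
        + (\<integral>\<^sup>+z. ennreal (g z * D2 z) \<partial>lborel)"
      by (intro nn_integral_add) auto
    also have "\<dots> = ennreal (LINT z|lborel. - (gx z * T1 (fst z) + gy z * T2 z))"
      unfolding X Y using X0 Y0 int_X int_Y
      by (simp add: ennreal_plus[symmetric] del: ennreal_plus)
    also have "\<dots> \<le> ennreal (LINT z|lborel. sqrt ((gx z)\<^sup>2 + (gy z)\<^sup>2))"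
    proof (intro ennreal_leI integral_mono cs)
      show "integrable lborel (\<lambda>z. - (gx z * T1 (fst z) + gy z * T2 z))" using int_X int_Y by auto
      show "integrable lborel (\<lambda>z. sqrt ((gx z)\<^sup>2 + (gy z)\<^sup>2))"
        by (rule int_pair) (auto intro!: continuous_intros cont simp: suppx suppy)
    qed
    finally have "2 * sqrt (pi / M) * M \<le> (LINT z|lborel. sqrt ((gx z)\<^sup>2 + (gy z)\<^sup>2))"
      by (simp add: integral_nonneg_AE)
    also have "2 * sqrt (pi / M) * M = 2 * sqrt (pi * M)"
      using M by (simp add: real_sqrt_mult real_sqrt_divide field_simps)
    finally show ?thesis by (simp add: M_def)
  qed
qed

section \<open>Decay of the distribution function\<close>

text \<open>A \<open>C^1\<close> version of the truncation of \<open>t - a\<close> to values between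
  0 and \<open>b - a\<close>. The slope \<open>k\<close> is a trapezoid with flanks of width
  \<open>\<epsilon> / 2\<close>, which costs at most \<epsilon> of the total rise
  \<open>c\<close>.\<close>

lemma ramp_function:
  fixes a b \<epsilon> :: real
  assumes ab: "a < b" and \<epsilon>: "0 < \<epsilon>"
  obtains \<psi> k :: "real \<Rightarrow> real" and c where
    "\<And>t. (\<psi> has_real_derivative k t) (at t)" "continuous_on UNIV k"
    "\<And>t. 0 \<le> k t" "\<And>t. k t \<le> 1" "\<And>t. t \<le> a \<or> b \<le> t \<Longrightarrow> k t = 0"
    "\<And>t. t \<le> a \<Longrightarrow> \<psi> t = 0" "\<And>t. 0 \<le> \<psi> t" "\<And>t. \<psi> t \<le> c" "\<And>t. b \<le> t \<Longrightarrow> \<psi> t = c"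
    "b - a - \<epsilon> \<le> c"
proof -
  define \<delta> where "\<delta> = \<epsilon> / 2"
  have \<delta>: "0 < \<delta>" using \<epsilon> by (simp add: \<delta>_def)
  define k where "k t = max 0 (min 1 (min ((t - a) / \<delta>) ((b - t) / \<delta>)))" for t
  have k_cont: "continuous_on UNIV k" unfolding k_def[abs_def] using \<delta>
      by (intro continuous_intros) auto
  have k_nonneg: "0 \<le> k t" and k_le: "k t \<le> 1" for t by (auto simp: k_def)
  have k_zero: "k t = 0" if "t \<le> a \<or> b \<le> t" for t
  proof -
    have "(t - a) / \<delta> \<le> 0 \<or> (b - t) / \<delta> \<le> 0" using that \<delta> by (auto simp: divide_le_0_iff)
    then have "min 1 (min ((t - a) / \<delta>) ((b - t) / \<delta>)) \<le> 0" by (auto simp only: min_le_iff_disj)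
    then show ?thesis unfolding k_def by (rule max_absorb1)
  qed
  have k_one: "k t = 1" if "a + \<delta> \<le> t" "t \<le> b - \<delta>" for t
  proof -
    have "1 \<le> (t - a) / \<delta>" "1 \<le> (b - t) / \<delta>" using that \<delta> by (auto simp: field_simps)
    then show ?thesis by (simp add: k_def)
  qed
  define R where "R = \<bar>a\<bar> + \<bar>b\<bar>"
  have k_supp: "k t = 0" if "R \<le> \<bar>t\<bar>" for t using that by (intro k_zero) (auto simp: R_def)
  have k_int: "integrable lborel k"
    by (rule continuous_compact_support_integrable[OF k_cont, of a b]) (use k_zero in force)
  define c where "c = (LINT t|lborel. k t)"
  define \<psi> where "\<psi> t = (LINT s|lborel. indicator {..t} s * k s)" for t
  have int_k: "integrable lborel (\<lambda>s. indicator {..t} s * k s)" for t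
    using integrable_mult_indicator[OF _ k_int, of "{..t}"] by simp
  show thesis
  proof (rule that[of \<psi> k c])
    show "(\<psi> has_real_derivative k t) (at t)" for t
      unfolding \<psi>_def[abs_def] by (rule has_real_derivative_integral_atMost[OF k_cont k_supp])
    show "\<psi> t = 0" if "t \<le> a" for t
    proof -
      have "indicator {..t} s * k s = 0" for s using k_zero[of s] that by (auto simp: indicator_def)
      then show ?thesis unfolding \<psi>_def by (simp only: Bochner_Integration.integral_zero)
    qed
    show "0 \<le> \<psi> t" for t unfolding \<psi>_def using k_nonneg by (intro integral_nonneg_AE) auto
    show "\<psi> t \<le> c" for t
      unfolding \<psi>_def c_def using k_nonneg int_k k_int
          by (intro integral_mono) (auto simp: indicator_def)
    show "\<psi> t = c" if "b \<le> t" for t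
      unfolding \<psi>_def c_def
    proof (intro Bochner_Integration.integral_cong refl)
      fix s show "indicator {..t} s * k s = k s" using k_zero[of s] that
          by (auto simp: indicator_def)
    qed
    show "b - a - \<epsilon> \<le> c"
    proof (cases "a + \<delta> \<le> b - \<delta>")
      case True
      have "b - a - \<epsilon> = (LINT t|lborel. indicator {a + \<delta>..b - \<delta>} t)"
        using True by (simp add: \<delta>_def)
      also have "\<dots> \<le> c"
        unfolding c_def
      proof (rule integral_mono[OF _ k_int])
        show "integrable lborel (\<lambda>t. indicator {a + \<delta>..b - \<delta>} t :: real)"
          using True by (simp add: integrable_indicator_iff emeasure_lborel_Icc)
      qed (use k_nonneg k_one in \<open>auto simp: indicator_def\<close>)
      finally show ?thesis .
    next
      \<comment> \<open>Here the flanks overlap and \<open>b - a - \<epsilon>\<close> is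
        negative.\<close>
      case False
      have "0 \<le> c" unfolding c_def using k_nonneg by (intro integral_nonneg_AE) auto
      then show ?thesis using False by (simp add: \<delta>_def)
    qed
  qed (use k_cont k_nonneg k_le k_zero in auto)
qed

lemma integral_deriv_compact_support:
  fixes f f' :: "real \<Rightarrow> real"
  assumes der: "\<And>x. (f has_real_derivative f' x) (at x)" and int: "integrable lborel f'"
    and supp: "\<And>x. R \<le> \<bar>x\<bar> \<Longrightarrow> f x = 0 \<and> f' x = 0"
  shows "(LINT x|lborel. f' x) = 0"
proof -
  define S where "S = \<bar>R\<bar> + 1"
  have "(f' has_integral (f S - f (-S))) {-S..S}"
    by (rule fundamental_theorem_of_calculus)
       (use der in \<open>auto simp: S_def has_real_derivative_iff_has_vector_derivative[symmetric]
          intro: has_field_derivative_at_within\<close>)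
  then have "(f' has_integral 0) {-S..S}"
    using supp[of S] supp[of "-S"] by (simp add: S_def)
  then have "(f' has_integral 0) UNIV"
    by (rule has_integral_on_superset) (use supp in \<open>auto simp: S_def\<close>)
  with has_integral_integral_lborel[OF int] show ?thesis by (rule has_integral_unique)
qed

text \<open>The derivatives \<open>vx\<close> to \<open>vyy\<close> of \<open>ln u\<close> are total
  functions that carry information only where \<open>u\<close> is positive. The assumption
  \<open>vanishing\<close> makes every superlevel set bounded.\<close>

locale log_superharmonic =
  fixes u :: "real \<times> real \<Rightarrow> real" and vx vy vxx vyy :: "real \<times> real \<Rightarrow> real" and \<Lambda> :: real
  assumes u_cont: "continuous_on UNIV u" and u_nonneg: "\<And>z. 0 \<le> u z"
    and vx: "\<And>x y. 0 < u (x, y) \<Longrightarrow> ((\<lambda>x. ln (u (x, y))) has_real_derivative vx (x, y)) (at x)"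
    and vy: "\<And>x y. 0 < u (x, y) \<Longrightarrow> ((\<lambda>y. ln (u (x, y))) has_real_derivative vy (x, y)) (at y)"
    and vxx: "\<And>x y. 0 < u (x, y) \<Longrightarrow> ((\<lambda>x. vx (x, y)) has_real_derivative vxx (x, y)) (at x)"
    and vyy: "\<And>x y. 0 < u (x, y) \<Longrightarrow> ((\<lambda>y. vy (x, y)) has_real_derivative vyy (x, y)) (at y)"
    and v_cont: "continuous_on {z. 0 < u z} vx" "continuous_on {z. 0 < u z} vy"
      "continuous_on {z. 0 < u z} vxx" "continuous_on {z. 0 < u z} vyy"
    and laplace: "\<And>z. 0 < u z \<Longrightarrow> vxx z + vyy z = - \<Lambda>" and \<Lambda>: "0 < \<Lambda>"
    and vanishing: "\<And>t. 0 < t \<Longrightarrow> \<exists>R. \<forall>x y. t \<le> u (x, y) \<longrightarrow> \<bar>x\<bar> < R \<and> \<bar>y\<bar> < R"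
begin

lemma open_superlevel: "open {z. t < u z}" and open_sublevel: "open {z. u z < t}"
  using u_cont by (auto intro!: open_Collect_less continuous_intros)

text \<open>The open sets \<open>{z. 0 < u z}\<close> and \<open>{z. u z < t}\<close> cover the
  plane, so a function that is 0 on the second has to be examined only on the first. The ramp
  creates this situation with \<open>t = exp a\<close>.\<close>

lemma extend_continuous:
  assumes "continuous_on {z. 0 < u z} h" "\<And>z. u z < t \<Longrightarrow> h z = 0" "0 < t"
  shows "continuous_on UNIV h"
proof -
  have "continuous_on {z. u z < t} h"
    by (rule continuous_on_eq[of _ "\<lambda>_. 0"]) (use assms in auto)
  then have "continuous_on ({z. 0 < u z} \<union> {z. u z < t}) h"
    using assms(1) open_superlevel open_sublevel by (intro continuous_on_open_Un) auto
  also have "{z. 0 < u z} \<union> {z. u z < t} = UNIV" using \<open>0 < t\<close> by force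
  finally show ?thesis .
qed

text \<open>The same cover, for differentiability: \<open>f\<close> is the formula valid where
  \<open>u\<close> is positive, and \<open>h'\<close> is its extension by 0.\<close>

lemma extend_deriv_x:
  assumes "0 < u (x, y) \<Longrightarrow> (f has_real_derivative h (x, y)) (at x)"
    and "\<And>x'. 0 < u (x', y) \<Longrightarrow> f x' = h' (x', y)"
    and zero: "\<And>z. u z < t \<Longrightarrow> h z = 0" "\<And>z. u z < t \<Longrightarrow> h' z = 0" and "0 < t"
  shows "((\<lambda>x. h' (x, y)) has_real_derivative h (x, y)) (at x)"
proof -
  have op: "open {x'. P (x', y)}" if "open {z. P z}" for P :: "real \<times> real \<Rightarrow> bool"
    using open_vimage[OF that, of "\<lambda>x. (x, y)"]
        by (simp add: vimage_def continuous_on_Pair continuous_on_id)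
  show ?thesis
  proof (cases "0 < u (x, y)")
    case True
    from assms(1)[OF True] show ?thesis
    proof (rule has_field_derivative_transform_within_open)
      show "open {x'. 0 < u (x', y)}" by (rule op[OF open_superlevel])
    qed (use True assms(2) in auto)
  next
    case False
    then have "u (x, y) < t" using \<open>0 < t\<close> by simp
    then have "h (x, y) = 0" using zero(1) by blast
    have "((\<lambda>_. 0 :: real) has_real_derivative 0) (at x)" by simp
    then have "((\<lambda>x'. h' (x', y)) has_real_derivative 0) (at x)"
    proof (rule has_field_derivative_transform_within_open)
      show "open {x'. u (x', y) < t}" by (rule op[OF open_sublevel])
    qed (use \<open>u (x, y) < t\<close> zero(2) in auto)
    then show ?thesis using \<open>h (x, y) = 0\<close> by simp
  qed
qed

lemma extend_deriv_y:
  assumes "0 < u (x, y) \<Longrightarrow> (f has_real_derivative h (x, y)) (at y)"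
    and "\<And>y'. 0 < u (x, y') \<Longrightarrow> f y' = h' (x, y')"
    and zero: "\<And>z. u z < t \<Longrightarrow> h z = 0" "\<And>z. u z < t \<Longrightarrow> h' z = 0" and "0 < t"
  shows "((\<lambda>y. h' (x, y)) has_real_derivative h (x, y)) (at y)"
proof -
  have op: "open {y'. P (x, y')}" if "open {z. P z}" for P :: "real \<times> real \<Rightarrow> bool"
    using open_vimage[OF that, of "\<lambda>y. (x, y)"]
        by (simp add: vimage_def continuous_on_Pair continuous_on_id)
  show ?thesis
  proof (cases "0 < u (x, y)")
    case True
    from assms(1)[OF True] show ?thesis
    proof (rule has_field_derivative_transform_within_open)
      show "open {y'. 0 < u (x, y')}" by (rule op[OF open_superlevel])
    qed (use True assms(2) in auto)
  next
    case False
    then have "u (x, y) < t" using \<open>0 < t\<close> by simp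
    then have "h (x, y) = 0" using zero(1) by blast
    have "((\<lambda>_. 0 :: real) has_real_derivative 0) (at y)" by simp
    then have "((\<lambda>y'. h' (x, y')) has_real_derivative 0) (at y)"
    proof (rule has_field_derivative_transform_within_open)
      show "open {y'. u (x, y') < t}" by (rule op[OF open_sublevel])
    qed (use \<open>u (x, y) < t\<close> zero(2) in auto)
    then show ?thesis using \<open>h (x, y) = 0\<close> by simp
  qed
qed

lemma superlevel_finite: "0 < t \<Longrightarrow> emeasure lborel {z. t < u z} < \<infinity>"
proof -
  assume "0 < t"
  then obtain R where R: "\<And>x y. t \<le> u (x, y) \<Longrightarrow> \<bar>x\<bar> < R \<and> \<bar>y\<bar> < R" using vanishing by blast
  have "{z. t < u z} \<subseteq> cbox (-R, -R) (R, R)"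
  proof
    fix z assume "z \<in> {z. t < u z}"
    then show "z \<in> cbox (-R, -R) (R, R)" using R[of "fst z" "snd z"]
        by (cases z) (auto simp: cbox_Pair_eq)
  qed
  then show ?thesis by (meson bounded_cbox bounded_subset emeasure_bounded_finite)
qed

text \<open>The argument is the logarithm of the level, the scale on which the sharp decay is
  linear.\<close>

definition m :: "real \<Rightarrow> real" where "m t = measure lborel {z. exp t < u z}"

lemma m_anti: "a \<le> b \<Longrightarrow> m b \<le> m a"
proof -
  assume "a \<le> b"
  then have *: "exp a \<le> exp b" by simp
  show ?thesis
    unfolding m_def using superlevel_finite[of "exp a"] borel_open[OF open_superlevel]
    by (intro measure_mono_fmeasurable)
       (use le_less_trans[OF *] in \<open>auto simp: fmeasurable_def\<close>)
qed

text \<open>The Sobolev inequality for \<open>g = \<psi>(v)\<close>, with \<open>2 |\<nabla>v| \<le> l |\<nabla>v|^2 + 1/l\<close> and Green's formula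
  \<open>\<integral>\<psi>'(v) |\<nabla>v|^2 = \<Lambda> \<integral>\<psi>(v)\<close>; the ramp \<open>\<psi>\<close> is \<open>C^1\<close> and almost linear of slope \<open>1\<close> on \<open>[a, b]\<close>.\<close>
lemma one_step:
  assumes ab: "a < b" and mb: "0 < m b"
  shows "4 * pi / \<Lambda> * (b - a) * m b \<le> m a * (m a - m b)"
proof (rule ccontr)
  assume neg: "\<not> ?thesis"
  define K where "K = 4 * pi / \<Lambda> * m b"
  have K: "0 < K" using \<Lambda> mb by (simp add: K_def)
  define gap where "gap = K * (b - a) - m a * (m a - m b)"
  have "K * (b - a) = 4 * pi / \<Lambda> * (b - a) * m b" by (simp add: K_def)
  then have gap: "0 < gap" using neg unfolding gap_def by linarith
  \<comment> \<open>Smoothing the ramp costs at most \<open>K * \<epsilon>\<close>, half of the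
    assumed gap; the second bound keeps the height \<open>c\<close> positive.\<close>
  define \<epsilon> where "\<epsilon> = min (gap / (2 * K)) ((b - a) / 2)"
  have "0 < gap / (2 * K)" "0 < (b - a) / 2" using gap K ab by simp_all
  then have \<epsilon>: "0 < \<epsilon>" "\<epsilon> \<le> gap / (2 * K)" "\<epsilon> \<le> (b - a) / 2"
    unfolding \<epsilon>_def by (simp_all only: min.cobounded1 min.cobounded2 min_less_iff_conj)
  obtain \<psi> k :: "real \<Rightarrow> real" and c where \<psi>: "\<And>t. (\<psi> has_real_derivative k t) (at t)"
    and k: "continuous_on UNIV k" "\<And>t. 0 \<le> k t" "\<And>t. k t \<le> 1" "\<And>t. t \<le> a \<or> b \<le> t \<Longrightarrow> k t = 0"
    and \<psi>': "\<And>t. t \<le> a \<Longrightarrow> \<psi> t = 0" "\<And>t. 0 \<le> \<psi> t" "\<And>t. \<psi> t \<le> c" "\<And>t. b \<le> t \<Longrightarrow> \<psi> t = c"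
    and c: "b - a - \<epsilon> \<le> c"
    by (rule ramp_function[OF ab \<epsilon>(1)]) (rule that)
  have c_pos: "0 < c" using c \<epsilon> ab by (simp add: field_simps)
  obtain R where R: "\<And>x y. exp a \<le> u (x, y) \<Longrightarrow> \<bar>x\<bar> < R \<and> \<bar>y\<bar> < R"
    using vanishing[of "exp a"] by auto
  define g where "g z = (if 0 < u z then \<psi> (ln (u z)) else 0)" for z
  \<comment> \<open>\<open>d\<close> is the slope of the ramp at \<open>ln u\<close>, so
    \<open>(gx, gy)\<close> is the gradient of \<open>g\<close>.\<close>
  define d where "d z = (if 0 < u z then k (ln (u z)) else 0)" for z
  define gx where "gx z = d z * vx z" for z
  define gy where "gy z = d z * vy z" for z
  have ln_le: "ln w \<le> t \<longleftrightarrow> w \<le> exp t" and ln_ge: "t \<le> ln w \<longleftrightarrow> exp t \<le> w" if "0 < w" for w t :: real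
    by (subst exp_le_cancel_iff[symmetric], simp add: that)+
  have ln_less: "ln (u z) \<le> a" if "0 < u z" "u z < exp a" for z
    using that by (simp add: ln_le)
  have low: "g z = 0" "d z = 0" if "u z < exp a" for z
    using ln_less[of z] that \<psi>'(1) k(4) by (auto simp: g_def d_def)
  have outside: "u (x, y) < exp a" if "R \<le> \<bar>x\<bar> \<or> R \<le> \<bar>y\<bar>" for x y
    using R[of x y] that by force
  have ext: "continuous_on UNIV h" if "continuous_on {z. 0 < u z} h" "\<And>z. u z < exp a \<Longrightarrow> h z = 0"
    for h :: "real \<times> real \<Rightarrow> real"
    by (rule extend_continuous[OF that]) auto
  have \<psi>_cont: "continuous_on UNIV \<psi>" using \<psi>
      by (meson DERIV_isCont continuous_at_imp_continuous_on)
  have lnu: "continuous_on {z. 0 < u z} (\<lambda>z. ln (u z))"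
    by (intro continuous_intros continuous_on_subset[OF u_cont]) auto
  have g_U: "continuous_on {z. 0 < u z} g"
    by (rule continuous_on_eq[OF continuous_on_compose2[OF \<psi>_cont lnu]]) (auto simp: g_def)
  have d_U: "continuous_on {z. 0 < u z} d"
    by (rule continuous_on_eq[OF continuous_on_compose2[OF k(1) lnu]]) (auto simp: d_def)
  have g_cont: "continuous_on UNIV g" by (rule ext[OF g_U low(1)])
  have d_cont: "continuous_on UNIV d" by (rule ext[OF d_U low(2)])
  have gx_cont: "continuous_on UNIV gx" and gy_cont: "continuous_on UNIV gy"
    unfolding gx_def gy_def by (rule ext; auto intro!: continuous_intros d_U v_cont simp: low)+
  have g_nonneg: "0 \<le> g z" and g_le: "g z \<le> c" for z using \<psi>' c_pos by (auto simp: g_def)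
  have d_nonneg: "0 \<le> d z" and d_le: "d z \<le> 1" for z using k by (auto simp: d_def)
  have gx: "((\<lambda>x. g (x, y)) has_real_derivative gx (x, y)) (at x)" for x y
  proof (rule extend_deriv_x[where t = "exp a" and f = "\<lambda>x. \<psi> (ln (u (x, y)))"])
    show "((\<lambda>x. \<psi> (ln (u (x, y)))) has_real_derivative gx (x, y)) (at x)" if "0 < u (x, y)"
      using DERIV_chain2[OF \<psi> vx[OF that]] that by (simp add: gx_def d_def)
  qed (auto simp: low gx_def, simp add: g_def)
  have gy: "((\<lambda>y. g (x, y)) has_real_derivative gy (x, y)) (at y)" for x y
  proof (rule extend_deriv_y[where t = "exp a" and f = "\<lambda>y. \<psi> (ln (u (x, y)))"])
    show "((\<lambda>y. \<psi> (ln (u (x, y)))) has_real_derivative gy (x, y)) (at y)" if "0 < u (x, y)"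
      using DERIV_chain2[OF \<psi> vy[OF that]] that by (simp add: gy_def d_def)
  qed (auto simp: low gy_def, simp add: g_def)
  have int_pair: "integrable lborel h"
    if "continuous_on UNIV h" "\<And>z. u z < exp a \<Longrightarrow> h z = 0" for h :: "real \<times> real \<Rightarrow> real"
    by (rule continuous_compact_support_integrable[OF that(1), of "(-R, -R)" "(R, R)"])
       (use that(2) outside square_supp_not_in_cbox in \<open>metis prod.collapse\<close>)
  \<comment> \<open>\<open>X + Y\<close> is the divergence of \<open>g\<close> times the gradient of
    \<open>ln u\<close>; each summand integrates to 0 along its own family of lines.\<close>
  define X where "X z = gx z * vx z + g z * vxx z" for z
  define Y where "Y z = gy z * vy z + g z * vyy z" for z
  have X_low: "X z = 0" and Y_low: "Y z = 0" if "u z < exp a" for z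
    using low[OF that] by (auto simp: X_def Y_def gx_def gy_def)
  have X_cont: "continuous_on UNIV X"
    unfolding X_def
    by (rule ext, intro continuous_intros g_U v_cont continuous_on_subset[OF gx_cont] subset_UNIV)
       (use X_low in \<open>simp add: X_def\<close>)
  have Y_cont: "continuous_on UNIV Y"
    unfolding Y_def
    by (rule ext, intro continuous_intros g_U v_cont continuous_on_subset[OF gy_cont] subset_UNIV)
       (use Y_low in \<open>simp add: Y_def\<close>)
  have int_X: "integrable lborel X" and int_Y: "integrable lborel Y"
    using int_pair[OF X_cont X_low] int_pair[OF Y_cont Y_low] by auto
  have X_deriv: "((\<lambda>x. g (x, y) * vx (x, y)) has_real_derivative X (x, y)) (at x)" for x y
  proof (rule extend_deriv_x[where t = "exp a" and f = "\<lambda>x. g (x, y) * vx (x, y)"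
        and h' = "\<lambda>z. g z * vx z"])
    show "((\<lambda>x. g (x, y) * vx (x, y)) has_real_derivative X (x, y)) (at x)" if "0 < u (x, y)"
      using DERIV_mult[OF gx vxx[OF that]] by (simp add: X_def mult_ac)
  qed (auto simp: low X_low)
  have Y_deriv: "((\<lambda>y. g (x, y) * vy (x, y)) has_real_derivative Y (x, y)) (at y)" for x y
  proof (rule extend_deriv_y[where t = "exp a" and f = "\<lambda>y. g (x, y) * vy (x, y)"
        and h' = "\<lambda>z. g z * vy z"])
    show "((\<lambda>y. g (x, y) * vy (x, y)) has_real_derivative Y (x, y)) (at y)" if "0 < u (x, y)"
      using DERIV_mult[OF gy vyy[OF that]] by (simp add: Y_def mult_ac)
  qed (auto simp: low Y_low)
  have X_int: "(LINT z|lborel. X z) = 0"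
  proof -
    have "(LINT x|lborel. X (x, y)) = 0" for y
    proof (rule integral_deriv_compact_support[OF X_deriv, where R = R])
      show "integrable lborel (\<lambda>x. X (x, y))"
        by (rule continuous_compact_support_integrable[of _ "-R" R])
           (use outside X_low in \<open>force intro!: continuous_on_compose2[OF X_cont]
               continuous_intros\<close>)+
    qed (use outside X_low low in auto)
    then show ?thesis using integral_lborel_pair(4)[OF int_X] by simp
  qed
  have Y_int: "(LINT z|lborel. Y z) = 0"
  proof -
    have "(LINT y|lborel. Y (x, y)) = 0" for x
    proof (rule integral_deriv_compact_support[OF Y_deriv, where R = R])
      show "integrable lborel (\<lambda>y. Y (x, y))"
        by (rule continuous_compact_support_integrable[of _ "-R" R])
           (use outside Y_low in \<open>force intro!: continuous_on_compose2[OF Y_cont]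
               continuous_intros\<close>)+
    qed (use outside Y_low low in auto)
    then show ?thesis using integral_lborel_pair(3)[OF int_Y] by simp
  qed
  define E where "E z = d z * ((vx z)\<^sup>2 + (vy z)\<^sup>2)" for z
  have E_cont: "continuous_on UNIV E"
    unfolding E_def by (rule ext; auto intro!: continuous_intros d_U v_cont simp: low)
  have int_E: "integrable lborel E" by (rule int_pair[OF E_cont]) (simp add: E_def low)
  have int_g: "integrable lborel g" by (rule int_pair[OF g_cont low(1)])
  have int_d: "integrable lborel d" by (rule int_pair[OF d_cont low(2)])
  have int_g2: "integrable lborel (\<lambda>z. (g z)\<^sup>2)"
    by (rule int_pair) (auto intro!: continuous_intros g_cont simp: low)
  have XY: "X z + Y z = E z - \<Lambda> * g z" for z
  proof (cases "0 < u z")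
    case True
    have "X z + Y z = E z + g z * (vxx z + vyy z)"
      by (simp add: X_def Y_def E_def gx_def gy_def power2_eq_square algebra_simps)
    then show ?thesis using laplace[OF True] by simp
  next
    case False
    then have "u z < exp a" using exp_gt_zero[of a] by linarith
    then show ?thesis using low[of z] X_low[of z] Y_low[of z] by (simp add: E_def)
  qed
  have E_int: "(LINT z|lborel. E z) = \<Lambda> * (LINT z|lborel. g z)"
  proof -
    have "0 = (LINT z|lborel. X z + Y z)" using int_X int_Y X_int Y_int by simp
    also have "\<dots> = (LINT z|lborel. E z - \<Lambda> * g z)" by (simp add: XY)
    also have "\<dots> = (LINT z|lborel. E z) - \<Lambda> * (LINT z|lborel. g z)" using int_E int_g by simp
    finally show ?thesis by simp
  qed
  have lv: "{z. exp t < u z} \<in> lmeasurable" "emeasure lborel {z. exp t < u z} < \<infinity>"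
    "{z. exp t < u z} \<in> sets borel" for t
    using superlevel_finite[of "exp t"] borel_open[OF open_superlevel[of "exp t"]]
    by (auto simp: fmeasurable_def)
  have int_ind: "integrable lborel (\<lambda>z. indicator {z. exp t < u z} z :: real)" for t
    using lv[of t] by (simp add: integrable_indicator_iff)
  have g2: "c\<^sup>2 * m b \<le> (LINT z|lborel. (g z)\<^sup>2)"
  proof -
    have "c\<^sup>2 * indicator {z. exp b < u z} z \<le> (g z)\<^sup>2" for z
    proof (cases "exp b < u z")
      case True
      then have "0 < u z" using exp_gt_zero[of b] by linarith
      then have "b \<le> ln (u z)" using True by (simp add: ln_ge)
      then show ?thesis using \<open>0 < u z\<close> True \<psi>'(4) by (simp add: g_def)
    qed simp
    then have "(LINT z|lborel. c\<^sup>2 * indicator {z. exp b < u z} z) \<le> (LINT z|lborel. (g z)\<^sup>2)"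
      using int_g2 int_ind by (intro integral_mono) auto
    then show ?thesis using int_ind by (simp add: m_def)
  qed
  have g1: "(LINT z|lborel. g z) \<le> c * m a"
  proof -
    have "g z \<le> c * indicator {z. exp a < u z} z" for z
    proof (cases "exp a < u z")
      case False
      then have "ln (u z) \<le> a" if "0 < u z" using that by (simp add: ln_le)
      then have "g z = 0" using \<psi>'(1) by (simp add: g_def)
      then show ?thesis using False by simp
    qed (simp add: g_le)
    then have "(LINT z|lborel. g z) \<le> (LINT z|lborel. c * indicator {z. exp a < u z} z)"
      using int_g int_ind by (intro integral_mono) auto
    then show ?thesis using int_ind by (simp add: m_def)
  qed
  have d1: "(LINT z|lborel. d z) \<le> m a - m b"
  proof -
    have "d z \<le> indicator {z. exp a < u z} z - indicator {z. exp b < u z} z" for z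
    proof (cases "exp a < u z \<and> u z \<le> exp b")
      case True
      then show ?thesis using d_le[of z] by simp
    next
      case False
      have "d z = 0"
      proof (cases "0 < u z")
        case True
        then have "ln (u z) \<le> a \<or> b \<le> ln (u z)"
          using False ln_le[OF True] ln_ge[OF True] by auto
        then show ?thesis using k(4) by (simp add: d_def)
      qed (simp add: d_def)
      moreover have "exp b < u z \<Longrightarrow> exp a < u z"
        using less_trans[of "exp a" "exp b"] ab by simp
      ultimately show ?thesis using False by (auto simp: indicator_def)
    qed
    then have "(LINT z|lborel. d z) \<le> (LINT z|lborel. indicator {z. exp a < u z} z
        - indicator {z. exp b < u z} z)"
      using int_d int_ind by (intro integral_mono) auto
    then show ?thesis using int_ind by (simp add: m_def)
  qed
  have ma: "0 < m a" using mb m_anti[of a b] ab by simp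
  define B where "B = 4 * sqrt (pi * m b) * c"
  define P where "P = \<Lambda> * c * m a"
  define Q where "Q = m a - m b"
  have B: "0 < B" and P: "0 < P" using mb ma c_pos \<Lambda> by (auto simp: B_def P_def)
  \<comment> \<open>With this value \<open>B \<le> l * P + Q / l\<close> becomes
    \<open>B^2 \<le> 4 * P * Q\<close>. The minimiser \<open>sqrt (Q / P)\<close> is avoided because
    \<open>Q\<close> could be 0.\<close>
  define l where "l = B / (2 * P)"
  have l: "0 < l" using B P by (simp add: l_def)
  have "B \<le> l * P + Q / l"
  proof -
    have "B / 2 = 2 * sqrt (pi * (c\<^sup>2 * m b))"
      using c_pos by (simp add: B_def real_sqrt_mult mult_ac)
    also have "\<dots> \<le> 2 * sqrt (pi * (LINT z|lborel. (g z)\<^sup>2))" using g2 by simp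
    also have "\<dots> \<le> (LINT z|lborel. sqrt ((gx z)\<^sup>2 + (gy z)\<^sup>2))"
      using low(1)[OF outside] by (intro sobolev_plane[OF g_nonneg g_cont gx_cont gy_cont gx gy,
          where R = R])
    also have "\<dots> \<le> (LINT z|lborel. (l * E z + d z / l) / 2)"
    proof (rule integral_mono)
      show "integrable lborel (\<lambda>z. sqrt ((gx z)\<^sup>2 + (gy z)\<^sup>2))"
        by (rule int_pair, intro continuous_on_real_sqrt continuous_on_add continuous_on_power
            gx_cont gy_cont)
           (simp add: low gx_def gy_def)
      show "integrable lborel (\<lambda>z. (l * E z + d z / l) / 2)" using int_E int_d by auto
      fix z
      define n where "n = sqrt ((vx z)\<^sup>2 + (vy z)\<^sup>2)"
      have n2: "n\<^sup>2 = (vx z)\<^sup>2 + (vy z)\<^sup>2" by (simp add: n_def)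
      have "(gx z)\<^sup>2 + (gy z)\<^sup>2 = (d z)\<^sup>2 * n\<^sup>2"
        by (simp add: n2 gx_def gy_def power_mult_distrib distrib_left)
      then have "sqrt ((gx z)\<^sup>2 + (gy z)\<^sup>2) = d z * n"
        using d_nonneg[of z] by (simp add: real_sqrt_mult n_def)
      moreover have "2 * n \<le> l * n\<^sup>2 + 1 / l"
      proof -
        have "0 \<le> (l * n - 1)\<^sup>2 / l" using l by simp
        also have "(l * n - 1)\<^sup>2 / l = l * n\<^sup>2 + 1 / l - 2 * n"
          using l by (simp add: power2_eq_square field_simps)
        finally show ?thesis by simp
      qed
      then have "d z * (2 * n) \<le> d z * (l * n\<^sup>2 + 1 / l)"
        using d_nonneg[of z] by (rule mult_left_mono)
      ultimately show "sqrt ((gx z)\<^sup>2 + (gy z)\<^sup>2) \<le> (l * E z + d z / l) / 2"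
        by (simp add: E_def n2[symmetric] algebra_simps)
    qed
    also have "\<dots> = (l * (\<Lambda> * (LINT z|lborel. g z)) + (LINT z|lborel. d z) / l) / 2"
      using int_E int_d by (simp add: E_int)
    also have "\<dots> \<le> (l * P + Q / l) / 2"
    proof -
      have "\<Lambda> * (LINT z|lborel. g z) \<le> P"
        using mult_left_mono[OF g1, of \<Lambda>] \<Lambda> by (simp add: P_def mult_ac)
      then have "l * (\<Lambda> * (LINT z|lborel. g z)) \<le> l * P" using l by simp
      moreover have "(LINT z|lborel. d z) / l \<le> Q / l"
        using d1 l by (simp add: Q_def divide_right_mono)
      ultimately show ?thesis by (intro divide_right_mono[OF add_mono]) auto
    qed
    finally show ?thesis by simp
  qed
  also have "l * P + Q / l = B / 2 + 2 * P * Q / B"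
    using B P by (simp add: l_def)
  finally have "B / 2 \<le> 2 * P * Q / B" by simp
  then have "B / 2 * B \<le> 2 * P * Q" using B by (simp only: pos_le_divide_eq)
  then have "B * B \<le> 4 * P * Q" by simp
  also have "B * B = 16 * pi * m b * c * c"
    using mb by (simp add: B_def)
  \<comment> \<open>The ramp height enters squared on the left, through the square of
    \<open>g\<close>, and once on the right; the factor that remains after cancelling is close to
    \<open>b - a\<close>.\<close>
  finally have "c * (16 * pi * m b * c) \<le> c * (4 * \<Lambda> * m a * Q)" by (simp add: P_def mult_ac)
  then have "16 * pi * m b * c \<le> 4 * \<Lambda> * m a * Q" using c_pos by simp
  then have "4 * pi * m b * c \<le> m a * Q * \<Lambda>" by (simp add: mult_ac)
  then have "4 * pi * m b * c / \<Lambda> \<le> m a * Q" using \<Lambda> by (simp only: pos_divide_le_eq)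
  then have "K * c \<le> m a * Q" by (simp add: K_def mult_ac)
  moreover have "K * (b - a - \<epsilon>) \<le> K * c" using c K by simp
  moreover have "K * \<epsilon> \<le> gap / 2" using mult_left_mono[OF \<epsilon>(2), of K] K by simp
  ultimately show False using gap by (simp add: gap_def Q_def algebra_simps)
qed

text \<open>\<open>one_step\<close> loses the factor \<open>m b / m a\<close>. Over \<open>n\<close>
  equal steps the inequality \<open>1 + ln q \<le> q\<close> makes the logarithms of these factors
  telescope, so the total loss is a fixed multiple of \<open>1 / n\<close>.\<close>

lemma m_decay:
  assumes ab: "a < b" and mb: "0 < m b"
  shows "4 * pi / \<Lambda> * (b - a) \<le> m a - m b"
proof -
  define \<kappa> where "\<kappa> = 4 * pi / \<Lambda>"
  have \<kappa>: "0 < \<kappa>" using \<Lambda> by (simp add: \<kappa>_def)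
  have step: "\<kappa> * (t - s) * (1 + (ln (m t) - ln (m s))) \<le> m s - m t" if "s < t" "0 < m t" for s t
  proof -
    have ms: "0 < m s" using m_anti[of s t] that by simp
    have "1 + (ln (m t) - ln (m s)) \<le> m t / m s"
      using ln_le_minus_one[of "m t / m s"] that ms by (simp add: ln_div)
    then have "\<kappa> * (t - s) * (1 + (ln (m t) - ln (m s))) \<le> \<kappa> * (t - s) * (m t / m s)"
      using \<kappa> that by (intro mult_left_mono) auto
    also have "\<dots> = \<kappa> * (t - s) * m t / m s" by simp
    also have "\<dots> \<le> m s - m t"
    proof -
      have "\<kappa> * (t - s) * m t \<le> (m s - m t) * m s"
        using one_step[OF that] by (simp only: \<kappa>_def mult.commute)
      then show ?thesis using ms by (simp only: pos_divide_le_eq)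
    qed
    finally show ?thesis .
  qed
  have iter: "\<kappa> * h * (real i + (ln (m (a + real i * h)) - ln (m a))) \<le> m a - m (a + real i * h)"
    if "0 < h" "0 < m (a + real i * h)" for h i
    using that(2)
  proof (induction i)
    case (Suc i)
    have e: "a + real (Suc i) * h = a + real i * h + h" by (simp add: algebra_simps)
    have pos: "0 < m (a + real i * h)"
      using m_anti[of "a + real i * h" "a + real (Suc i) * h"] Suc.prems \<open>0 < h\<close> by (simp add: e)
    show ?case
    proof -
      have "\<kappa> * h * (1 + (ln (m (a + real (Suc i) * h)) - ln (m (a + real i * h))))
          \<le> m (a + real i * h) - m (a + real (Suc i) * h)"
        using step[of "a + real i * h" "a + real i * h + h"] Suc.prems \<open>0 < h\<close> unfolding e by simp
      moreover have "\<kappa> * h * (real (Suc i) + (ln (m (a + real (Suc i) * h)) - ln (m a)))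
          = \<kappa> * h * (1 + (ln (m (a + real (Suc i) * h)) - ln (m (a + real i * h))))
            + \<kappa> * h * (real i + (ln (m (a + real i * h)) - ln (m a)))"
        unfolding distrib_left[symmetric] by simp
      ultimately show ?thesis using Suc.IH[OF pos] by linarith
    qed
  qed simp
  have bound: "\<kappa> * (b - a) + \<kappa> * (b - a) * (ln (m b) - ln (m a)) / real n
      \<le> m a - m b" if "0 < n" for n
  proof -
    have "a + real n * ((b - a) / real n) = b" using that by simp
    moreover have "0 < (b - a) / real n" using that ab by simp
    ultimately have "\<kappa> * ((b - a) / real n) * (real n + (ln (m b) - ln (m a))) \<le> m a - m b"
      using iter[of "(b - a) / real n" n] mb by simp
    then show ?thesis using that by (simp add: field_simps)
  qed
  have "(\<lambda>n. \<kappa> * (b - a) + \<kappa> * (b - a) * (ln (m b) - ln (m a)) / real n) \<longlonglongrightarrow> \<kappa> * (b - a) + 0"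
    by (intro tendsto_intros lim_const_over_n)
  then have "\<kappa> * (b - a) + 0 \<le> m a - m b"
    by (rule tendsto_upperbound) (auto intro!: eventually_sequentiallyI[of 1] bound)
  then show ?thesis by (simp add: \<kappa>_def)
qed

lemma superlevel_decay:
  assumes "0 < s" "s < t" "0 < measure lborel {z. t < u z}"
  shows "4 * pi / \<Lambda> * (ln t - ln s) \<le> measure lborel {z. s < u z} - measure lborel {z. t < u z}"
  using m_decay[of "ln s" "ln t"] assms by (simp add: m_def)

end

section \<open>Rearrangement\<close>

text \<open>Fubini for the region below the graph of \<open>u\<close>. Restricting the levels to
  \<open>S\<close> lets the parts above and below a threshold be treated separately.\<close>

lemma layer_cake:
  fixes u :: "'a::euclidean_space \<Rightarrow> real"
  assumes [measurable]: "u \<in> borel_measurable borel" "S \<in> sets borel"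
  shows "(\<integral>\<^sup>+z. emeasure lborel (S \<inter> {..<u z}) \<partial>lborel)
    = (\<integral>\<^sup>+t. emeasure lborel {z. t < u z} * indicator S t \<partial>lborel)"
proof -
  have "(\<integral>\<^sup>+z. emeasure lborel (S \<inter> {..<u z}) \<partial>lborel)
      = (\<integral>\<^sup>+z. \<integral>\<^sup>+t. indicator S t * (if t < u z then 1 else 0) \<partial>lborel \<partial>lborel)"
  proof (intro nn_integral_cong)
    fix z
    have "emeasure lborel (S \<inter> {..<u z}) = (\<integral>\<^sup>+t. indicator (S \<inter> {..<u z}) t \<partial>lborel)"
      by simp
    also have "\<dots> = (\<integral>\<^sup>+t. indicator S t * (if t < u z then 1 else 0) \<partial>lborel)"
      by (intro nn_integral_cong) (auto simp: indicator_def)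
    finally show "emeasure lborel (S \<inter> {..<u z})
      = (\<integral>\<^sup>+t. indicator S t * (if t < u z then 1 else 0) \<partial>lborel)" .
  qed
  also have "\<dots> = (\<integral>\<^sup>+t. \<integral>\<^sup>+z. indicator S t * (if t < u z then 1 else 0) \<partial>lborel \<partial>lborel)"
    by (rule lborel_pair.Fubini'[symmetric]) measurable
  also have "\<dots> = (\<integral>\<^sup>+t. emeasure lborel {z. t < u z} * indicator S t \<partial>lborel)"
  proof (intro nn_integral_cong)
    fix t
    have "(\<integral>\<^sup>+z. indicator S t * (if t < u z then 1 else 0) \<partial>lborel)
        = (\<integral>\<^sup>+z. indicator S t * indicator {z. t < u z} z \<partial>lborel)"
      by (intro nn_integral_cong) (auto simp: indicator_def)
    also have "\<dots> = indicator S t * emeasure lborel {z. t < u z}"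
      by (subst nn_integral_cmult) auto
    finally show "(\<integral>\<^sup>+z. indicator S t * (if t < u z then 1 else 0) \<partial>lborel)
        = emeasure lborel {z. t < u z} * indicator S t" by (simp add: mult.commute)
  qed
  finally show ?thesis .
qed

lemma layer_cake_above:
  fixes u :: "'a::euclidean_space \<Rightarrow> real"
  assumes "u \<in> borel_measurable borel"
  shows "(\<integral>\<^sup>+z. ennreal (max 0 (u z - s)) \<partial>lborel)
    = (\<integral>\<^sup>+t. emeasure lborel {z. t < u z} * indicator {s..} t \<partial>lborel)"
proof -
  have "{s..} \<inter> {..<u z} = {s..<u z}" for z by auto
  then have "emeasure lborel ({s..} \<inter> {..<u z}) = ennreal (max 0 (u z - s))" for z
    by (cases "s \<le> u z") (auto simp: max_def)
  with layer_cake[OF assms, of "{s..}"] show ?thesis by simp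
qed

lemma layer_cake_below:
  fixes u :: "'a::euclidean_space \<Rightarrow> real"
  assumes "u \<in> borel_measurable borel" "\<And>z. 0 \<le> u z" "0 \<le> s"
  shows "(\<integral>\<^sup>+z. ennreal (min s (u z)) \<partial>lborel)
    = (\<integral>\<^sup>+t. emeasure lborel {z. t < u z} * indicator {0..<s} t \<partial>lborel)"
proof -
  have "{0..<s} \<inter> {..<u z} = {0..<min s (u z)}" for z by auto
  then have "emeasure lborel ({0..<s} \<inter> {..<u z}) = ennreal (min s (u z))" for z
    using assms by simp
  with layer_cake[OF assms(1), of "{0..<s}"] show ?thesis by simp
qed

text \<open>A primitive of \<open>ln T - ln t\<close>, which up to a factor is the distribution
  function of a Gaussian of height \<open>T\<close>. Its value at 0 is 0, in agreement with the
  limit of \<open>t * ln t\<close>.\<close>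

definition log_primitive :: "real \<Rightarrow> real \<Rightarrow> real" where
  "log_primitive T t = t * ln T - t * ln t + t"

text \<open>The integrand is unbounded at 0, but the fundamental theorem asks only for a primitive
  that is continuous on the closed interval and differentiable inside.\<close>

lemma nn_integral_log:
  assumes "0 \<le> a" "a \<le> b" "b \<le> T" "0 < T" "0 \<le> k"
  shows "(\<integral>\<^sup>+t. ennreal (k * (ln T - ln t)) * indicator {a<..<b} t \<partial>lborel)
    = ennreal (k * (log_primitive T b - log_primitive T a))"
proof -
  have cont: "continuous_on {a..b} (log_primitive T)"
  proof (cases "a = 0")
    case False
    then show ?thesis
      using assms unfolding log_primitive_def[abs_def] by (intro continuous_intros) auto
  next
    case True
    have "continuous (at x within {a..b}) (log_primitive T)" if "x \<in> {a..b}" for x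
    proof (cases "x = 0 \<and> b > 0")
      case True
      have "((\<lambda>t. t * ln T - t * ln t + t) \<longlongrightarrow> 0) (at_right 0)" by real_asymp
      then have "(log_primitive T \<longlongrightarrow> log_primitive T 0) (at_right 0)"
        by (simp add: log_primitive_def[abs_def])
      then show ?thesis
        using True \<open>a = 0\<close> by (simp add: continuous_within at_within_Icc_at_right)
    next
      case False
      show ?thesis
      proof (cases "x = 0")
        case True
        then have "{a..b} = {x}" using False that \<open>a = 0\<close> by auto
        then show ?thesis
          using continuous_on_sing[of x "log_primitive T"]
          by (simp add: continuous_on_eq_continuous_within)
      next
        case x: False
        then show ?thesis using that assms unfolding log_primitive_def[abs_def]
          by (intro continuous_intros) auto
      qed
    qed
    then show ?thesis by (simp add: continuous_on_eq_continuous_within)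
  qed
  have "((\<lambda>t. ln T - ln t) has_integral (log_primitive T b - log_primitive T a)) {a..b}"
  proof (rule fundamental_theorem_of_calculus_interior[OF \<open>a \<le> b\<close> cont])
    fix x assume x: "x \<in> {a<..<b}"
    then have "(log_primitive T has_real_derivative (ln T - ln x)) (at x)"
      using assms unfolding log_primitive_def[abs_def]
      by (auto intro!: derivative_eq_intros)
    then show "(log_primitive T has_vector_derivative (ln T - ln x)) (at x)"
      by (simp add: has_real_derivative_iff_has_vector_derivative)
  qed
  then have "((\<lambda>t. k * (ln T - ln t)) has_integral (k * (log_primitive T b
      - log_primitive T a))) {a<..<b}"
    using has_integral_mult_right by (subst has_integral_Icc_iff_Ioo[symmetric]) blast
  from nn_integral_has_integral_lebesgue'[OF _ this] assms
  show ?thesis by auto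
qed

lemma measure_superlevel:
  fixes u :: "'a::euclidean_space \<Rightarrow> real"
  assumes int: "integrable lborel u" and nonneg: "\<And>z. 0 \<le> u z" and t: "0 < t"
  shows "emeasure lborel {z. t < u z} \<noteq> \<infinity>"
    and "t * measure lborel {z. t < u z} \<le> (LINT z|lborel. u z)"
proof -
  have [measurable]: "u \<in> borel_measurable borel" using borel_measurable_integrable[OF int] by simp
  have *: "ennreal t * emeasure lborel {z. t < u z} \<le> ennreal (LINT z|lborel. u z)"
  proof -
    have "ennreal t * emeasure lborel {z. t < u z}
        = (\<integral>\<^sup>+z. ennreal t * indicator {z. t < u z} z \<partial>lborel)"
      by (subst nn_integral_cmult) auto
    also have "\<dots> \<le> (\<integral>\<^sup>+z. ennreal (u z) \<partial>lborel)"
      using nonneg by (intro nn_integral_mono) (auto simp: indicator_def ennreal_leI)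
    also have "\<dots> = ennreal (LINT z|lborel. u z)"
      by (rule nn_integral_eq_integral[OF int]) (simp add: nonneg)
    finally show ?thesis .
  qed
  then show fin: "emeasure lborel {z. t < u z} \<noteq> \<infinity>"
    using t by (auto simp: ennreal_mult_eq_top_iff top_unique)
  then show "t * measure lborel {z. t < u z} \<le> (LINT z|lborel. u z)"
    using * t nonneg by (simp add: emeasure_eq_ennreal_measure ennreal_mult[symmetric]
        integral_nonneg_AE)
qed

text \<open>With \<open>m t\<close> the measure of the superlevel set, the hypothesis \<open>decay\<close> says that
  \<open>m t + \<kappa> ln t\<close> is nonincreasing. Equality in it is attained by the comparison function
  \<open>\<kappa> (ln T - ln t)\<close>, where \<open>T\<close> is chosen such that both functions cross the value
  \<open>measure lebesgue \<Omega>\<close> at the same level \<open>\<tau>\<close>.\<close>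
theorem rearrangement_bound:
  fixes u :: "'a::euclidean_space \<Rightarrow> real"
  assumes cont: "continuous_on UNIV u" and nonneg: "\<And>z. 0 \<le> u z" and int: "integrable lborel u"
    and nonzero: "u z0 \<noteq> 0" and k: "0 < \<kappa>"
    and decay: "\<And>s t. 0 < s \<Longrightarrow> s < t \<Longrightarrow> 0 < measure lborel {z. t < u z} \<Longrightarrow>
       \<kappa> * (ln t - ln s) \<le> measure lborel {z. s < u z} - measure lborel {z. t < u z}"
    and Om: "\<Omega> \<in> lmeasurable" "0 < measure lebesgue \<Omega>"
  shows "(LINT z:\<Omega>|lebesgue. u z) \<le> (1 - exp (- measure lebesgue \<Omega> / \<kappa>)) * (LINT z|lborel. u z)"
    and "(LINT z:\<Omega>|lebesgue. u z) = (1 - exp (- measure lebesgue \<Omega> / \<kappa>)) * (LINT z|lborel. u z) \<Longrightarrow>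
      \<exists>\<tau> T. 0 < \<tau> \<and> \<tau> < T \<and> (LINT z|lborel. u z) = \<kappa> * T \<and> (\<forall>z. u z \<le> T) \<and> (\<forall>t<T. \<exists>z. t < u z) \<and>
        (AE z in lebesgue. (z \<in> \<Omega> \<longrightarrow> \<tau> \<le> u z) \<and> (z \<notin> \<Omega> \<longrightarrow> u z \<le> \<tau>))"
proof -
  define m where "m t = measure lborel {z. t < u z}" for t
  define \<sigma> where "\<sigma> = measure lebesgue \<Omega>"
  define J where "J = (LINT z|lborel. u z)"
  have \<sigma>: "0 < \<sigma>" using Om by (simp add: \<sigma>_def)
  have [measurable]: "u \<in> borel_measurable borel" by (rule borel_measurable_continuous_onI[OF cont])
  have em: "emeasure lborel {z. t < u z} = ennreal (m t)" if "0 < t" for t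
    unfolding m_def by (rule emeasure_eq_ennreal_measure) (use measure_superlevel(1)[OF int nonneg
        that] in simp)
  have m_nonneg: "0 \<le> m t" for t by (simp add: m_def)
  have m_anti: "m t \<le> m s" if "0 < s" "s \<le> t" for s t
  proof -
    have "ennreal (m t) \<le> ennreal (m s)"
      unfolding em[OF \<open>0 < s\<close>, symmetric] using that
      by (subst em[symmetric]) (auto intro!: emeasure_mono)
    then show ?thesis using m_nonneg by simp
  qed
  have opn: "open {z. t < u z}" for t
    using cont by (intro open_Collect_less continuous_intros) auto
  have m_pos_iff: "0 < m t \<longleftrightarrow> (\<exists>z. t < u z)" if "0 < t" for t
  proof
    assume "\<exists>z. t < u z"
    then have "\<not> negligible {z. t < u z}" using open_not_negligible[OF opn] by blast
    then have "emeasure lborel {z. t < u z} \<noteq> 0"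
      by (metis (mono_tags) completion.complete2 emeasure_completion negligible_iff_null_sets
          null_setsI
          null_sets_completionI opn order_refl sets_lborel borel_open)
    then show "0 < m t" using em[OF that] m_nonneg[of t] by (metis ennreal_0 less_eq_real_def)
  next
    assume "0 < m t"
    then have "{z. t < u z} \<noteq> {}" unfolding m_def by (metis less_irrefl measure_empty)
    then show "\<exists>z. t < u z" by auto
  qed
  define S where "S = {t. 0 < t \<and> \<sigma> < m t}"
  have tJ: "t * m t \<le> J" if "0 < t" for t
    using measure_superlevel(2)[OF int nonneg that] by (simp add: m_def J_def)
  have S_bdd: "t \<le> J / \<sigma>" if "t \<in> S" for t
  proof -
    have "t * \<sigma> \<le> t * m t" using that by (simp add: S_def)
    also have "\<dots> \<le> J" using tJ that by (simp add: S_def)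
    finally show ?thesis using \<sigma> by (simp add: field_simps)
  qed
  then have bdd: "bdd_above S" by (meson bdd_aboveI)
  have S_ne: "S \<noteq> {}"
  proof -
    have u0: "0 < u z0" using nonneg[of z0] nonzero by simp
    define t where "t = u z0 / 2"
    have t: "0 < t" "0 < m t" using u0 m_pos_iff[of t] exI[of "\<lambda>z. t < u z" z0]
        by (auto simp: t_def)
    \<comment> \<open>Placed so that the decay between \<open>s\<close> and \<open>t\<close> is
      worth exactly \<sigma>; this puts \<open>m s\<close> above \<sigma>.\<close>
    define s where "s = t * exp (- (\<sigma> / \<kappa>))"
    have "\<sigma> / \<kappa> > 0" using \<sigma> k by simp
    then have s: "0 < s" "s < t" using t by (auto simp: s_def)
    have "ln t - ln s = \<sigma> / \<kappa>" using t by (simp add: s_def ln_mult)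
    then have "\<sigma> \<le> m s - m t" using decay[OF s] t k by (simp add: m_def)
    then show ?thesis using s t by (auto simp: S_def)
  qed
  \<comment> \<open>The value of \<open>m\<close> at \<tau> itself is not controlled. What follows
    uses levels strictly below or strictly above \<tau>.\<close>
  define \<tau> where "\<tau> = Sup S"
  have \<tau>_ub: "t \<le> \<tau>" if "t \<in> S" for t using cSup_upper[OF that bdd] by (simp add: \<tau>_def)
  have \<tau>: "0 < \<tau>" using S_ne \<tau>_ub by (force simp: S_def)
  have below_\<tau>: "\<sigma> < m t" if t: "0 < t" "t < \<tau>" for t
  proof -
    obtain t' where "t' \<in> S" "t < t'" using t(2) less_cSup_iff[OF S_ne bdd] by (auto simp: \<tau>_def)
    then show ?thesis using m_anti[of t t'] t by (auto simp: S_def)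
  qed
  have above_\<tau>: "m t \<le> \<sigma>" if "\<tau> < t" for t
    using \<tau>_ub[of t] that \<tau> by (force simp: S_def)
  \<comment> \<open>This choice gives the comparison function \<open>n\<close> the value \<sigma> at
    \<tau>.\<close>
  define T where "T = \<tau> * exp (\<sigma> / \<kappa>)"
  have \<tau>T: "\<tau> < T" and T: "0 < T" using \<tau> \<sigma> k by (auto simp: T_def)
  have lnT: "ln T = ln \<tau> + \<sigma> / \<kappa>" using \<tau> by (simp add: T_def ln_mult)
  define n where "n t = \<kappa> * (ln T - ln t)" for t
  have n_alt: "n t = \<sigma> + \<kappa> * (ln \<tau> - ln t)" for t using k by (simp add: n_def lnT field_simps)
  have m_ge: "n t \<le> m t" if t: "0 < t" "t < \<tau>" for t
  proof (rule field_le_epsilon)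
    fix e :: real assume e: "0 < e"
    \<comment> \<open>A level between \<open>t\<close> and \<tau>, so close to \<tau> that
      \<open>\<kappa> * (ln \<tau> - ln r) \<le> e\<close>.\<close>
    define r where "r = max ((t + \<tau>) / 2) (\<tau> * exp (- (e / \<kappa>)))"
    have "\<tau> * exp (- (e / \<kappa>)) < \<tau>" using \<tau> e k by simp
    moreover have "t < (t + \<tau>) / 2" "(t + \<tau>) / 2 < \<tau>" using t by auto
    ultimately have r: "t < r" "r < \<tau>" "\<tau> * exp (- (e / \<kappa>)) \<le> r"
      unfolding r_def by (auto simp only: less_max_iff_disj max_less_iff_conj max.cobounded2)
    then have r0: "0 < r" using t by simp
    note r = r r0
    have "ln \<tau> - e / \<kappa> = ln (\<tau> * exp (- (e / \<kappa>)))" using \<tau> by (simp add: ln_mult)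
    also have "\<dots> \<le> ln r" using r \<tau> by (subst ln_le_cancel_iff) auto
    finally have "\<kappa> * (ln \<tau> - e / \<kappa>) \<le> \<kappa> * ln r" using k by (intro mult_left_mono) auto
    then have "\<kappa> * ln \<tau> - e \<le> \<kappa> * ln r" using k by (simp add: right_diff_distrib)
    moreover have "\<kappa> * (ln r - ln t) \<le> m t - m r"
      using decay[OF t(1) r(1)] below_\<tau>[OF r(4,2)] \<sigma> by (simp add: m_def)
    ultimately show "n t \<le> m t + e"
      using below_\<tau>[OF r(4,2)] by (simp add: n_alt algebra_simps)
  qed
  have m_le: "m t \<le> n t" if t: "\<tau> < t" "0 < m t" for t
  proof (rule field_le_epsilon)
    fix e :: real assume e: "0 < e"
    define r where "r = min ((t + \<tau>) / 2) (\<tau> * exp (e / \<kappa>))"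
    have "\<tau> < \<tau> * exp (e / \<kappa>)" using \<tau> e k by simp
    moreover have "\<tau> < (t + \<tau>) / 2" "(t + \<tau>) / 2 < t" using t by auto
    ultimately have r: "\<tau> < r" "r < t" "r \<le> \<tau> * exp (e / \<kappa>)"
      unfolding r_def by (auto simp only: min_less_iff_disj min_less_iff_conj min.cobounded2)
    then have r0: "0 < r" using \<tau> by simp
    note r = r r0
    have "ln r \<le> ln (\<tau> * exp (e / \<kappa>))" using r \<tau> by (subst ln_le_cancel_iff) auto
    also have "\<dots> = ln \<tau> + e / \<kappa>" using \<tau> by (simp add: ln_mult)
    finally have "\<kappa> * ln r \<le> \<kappa> * (ln \<tau> + e / \<kappa>)" using k by (intro mult_left_mono) auto
    then have "\<kappa> * ln r \<le> \<kappa> * ln \<tau> + e" using k by (simp add: distrib_left)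
    moreover have "\<kappa> * (ln t - ln r) \<le> m r - m t" using decay[OF r(4,2)] t by (simp add: m_def)
    ultimately show "m t \<le> n t + e" using above_\<tau>[OF r(1)] by (simp add: n_alt algebra_simps)
  qed
  have m_zero: "m t = 0" if "T \<le> t" for t
  proof (rule ccontr)
    assume "m t \<noteq> 0"
    then have "0 < m t" using m_nonneg[of t] by simp
    moreover have "n t \<le> 0" using that T k by (simp add: n_def mult_le_0_iff)
    ultimately show False using m_le[of t] that \<tau>T by auto
  qed
  have n_pos: "0 < n t" if "0 < t" "t < T" for t using that T k by (simp add: n_def)
  have m_le': "m t \<le> n t" if "\<tau> < t" "t < T" for t
    using m_le[of t] n_pos[of t] that m_nonneg[of t] \<tau> by force
  \<comment> \<open>The mass of \<open>u\<close> above and below the level \<tau>. The comparison of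
    \<open>m\<close> with \<open>n\<close> goes in opposite directions on the two ranges of
    levels.\<close>
  define \<alpha> where "\<alpha> = (LINT z|lborel. max 0 (u z - \<tau>))"
  define \<beta> where "\<beta> = (LINT z|lborel. min \<tau> (u z))"
  have int_\<alpha>: "integrable lborel (\<lambda>z. max 0 (u z - \<tau>))"
    by (rule Bochner_Integration.integrable_bound[OF int]) (use nonneg \<tau> in \<open>auto simp: max_def\<close>)
  have int_\<beta>: "integrable lborel (\<lambda>z. min \<tau> (u z))"
    by (rule Bochner_Integration.integrable_bound[OF int]) (use nonneg \<tau> in \<open>auto simp: min_def\<close>)
  have J_eq: "J = \<alpha> + \<beta>"
    unfolding J_def \<alpha>_def \<beta>_def
    by (subst Bochner_Integration.integral_add[OF int_\<alpha> int_\<beta>, symmetric])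
       (auto intro!: Bochner_Integration.integral_cong simp: max_def min_def)
  have \<alpha>_nonneg: "0 \<le> \<alpha>" unfolding \<alpha>_def by (intro integral_nonneg_AE) auto
  have \<beta>_nonneg: "0 \<le> \<beta>" unfolding \<beta>_def using nonneg \<tau>
      by (intro integral_nonneg_AE) (auto simp: less_imp_le)
  have LT: "log_primitive T T = T" "log_primitive T 0 = 0"
      "log_primitive T \<tau> = \<tau> + \<tau> * \<sigma> / \<kappa>"
    using \<tau> T by (auto simp: log_primitive_def lnT algebra_simps)
  have LT_diff: "\<kappa> * (T - log_primitive T \<tau>) = \<kappa> * (T - \<tau>) - \<sigma> * \<tau>"
    "\<kappa> * (log_primitive T \<tau> - 0) = \<kappa> * \<tau> + \<sigma> * \<tau>"
    using k by (simp_all add: LT right_diff_distrib distrib_left)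
  have n_above: "(\<integral>\<^sup>+t. ennreal (n t) * indicator {\<tau><..<T} t \<partial>lborel)
      = ennreal (\<kappa> * (T - \<tau>) - \<sigma> * \<tau>)"
    unfolding n_def LT_diff[symmetric] using nn_integral_log[of \<tau> T T \<kappa>] \<tau> \<tau>T T k LT(1) by simp
  have n_below: "(\<integral>\<^sup>+t. ennreal (n t) * indicator {0<..<\<tau>} t \<partial>lborel) = ennreal (\<kappa> * \<tau> + \<sigma> * \<tau>)"
    unfolding n_def LT_diff[symmetric] using nn_integral_log[of 0 \<tau> T \<kappa>] \<tau> \<tau>T T k LT(2) by simp
  have ae1: "AE t in lborel. t \<noteq> c" for c :: real by (rule AE_lborel_singleton)
  have m_above: "(\<integral>\<^sup>+t. ennreal (m t) * indicator {\<tau><..<T} t \<partial>lborel) = ennreal \<alpha>"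
  proof -
    have "ennreal \<alpha> = (\<integral>\<^sup>+z. ennreal (max 0 (u z - \<tau>)) \<partial>lborel)"
      unfolding \<alpha>_def using int_\<alpha> by (intro nn_integral_eq_integral[symmetric]) auto
    also have "\<dots> = (\<integral>\<^sup>+t. emeasure lborel {z. t < u z} * indicator {\<tau>..} t \<partial>lborel)"
      by (rule layer_cake_above) simp
    also have "\<dots> = (\<integral>\<^sup>+t. ennreal (m t) * indicator {\<tau><..<T} t \<partial>lborel)"
    proof (rule nn_integral_cong_AE, use ae1[of \<tau>] in eventually_elim)
      fix t assume "t \<noteq> \<tau>"
      then show "emeasure lborel {z. t < u z} * indicator {\<tau>..} t
          = ennreal (m t) * indicator {\<tau><..<T} t"
        using em[of t] \<tau> m_zero[of t] by (auto simp: indicator_def)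
    qed
    finally show ?thesis by simp
  qed
  have m_below: "(\<integral>\<^sup>+t. ennreal (m t) * indicator {0<..<\<tau>} t \<partial>lborel) = ennreal \<beta>"
  proof -
    have "ennreal \<beta> = (\<integral>\<^sup>+z. ennreal (min \<tau> (u z)) \<partial>lborel)"
      unfolding \<beta>_def using int_\<beta> nonneg \<tau>
      by (intro nn_integral_eq_integral[symmetric]) (auto simp: less_imp_le)
    also have "\<dots> = (\<integral>\<^sup>+t. emeasure lborel {z. t < u z} * indicator {0..<\<tau>} t \<partial>lborel)"
      using \<tau> nonneg by (intro layer_cake_below) auto
    also have "\<dots> = (\<integral>\<^sup>+t. ennreal (m t) * indicator {0<..<\<tau>} t \<partial>lborel)"
    proof (rule nn_integral_cong_AE, use ae1[of 0] in eventually_elim)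
      fix t :: real assume "t \<noteq> 0"
      then show "emeasure lborel {z. t < u z} * indicator {0..<\<tau>} t
          = ennreal (m t) * indicator {0<..<\<tau>} t"
        using em[of t] by (auto simp: indicator_def)
    qed
    finally show ?thesis by simp
  qed
  \<comment> \<open>This is \<open>1 + x < exp x\<close> at \<open>x = \<sigma> / \<kappa>\<close>.
    Positivity allows inequalities in \<open>ennreal\<close> to be read as real ones.\<close>
  have ab_pos: "0 < \<kappa> * (T - \<tau>) - \<sigma> * \<tau>"
  proof -
    have "0 < \<sigma> / \<kappa>" using \<sigma> k by simp
    then have "1 + \<sigma> / \<kappa> < 1 + \<sigma> / \<kappa> + (\<sigma> / \<kappa>)\<^sup>2 / 2" using \<sigma> k by simp
    also have "\<dots> \<le> exp (\<sigma> / \<kappa>)"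
      using \<open>0 < \<sigma> / \<kappa>\<close> by (intro exp_lower_Taylor_quadratic) simp
    finally have "\<kappa> * \<tau> * (1 + \<sigma> / \<kappa>) < \<kappa> * \<tau> * exp (\<sigma> / \<kappa>)"
      using k \<tau> by (intro mult_strict_left_mono) auto
    moreover have "\<kappa> * \<tau> * (1 + \<sigma> / \<kappa>) = \<kappa> * \<tau> + \<sigma> * \<tau>" using k by (simp add: distrib_left)
    ultimately show ?thesis by (simp add: T_def right_diff_distrib mult.assoc)
  qed
  have \<alpha>_le: "\<alpha> \<le> \<kappa> * (T - \<tau>) - \<sigma> * \<tau>"
  proof -
    have "ennreal \<alpha> \<le> ennreal (\<kappa> * (T - \<tau>) - \<sigma> * \<tau>)"
      unfolding m_above[symmetric] n_above[symmetric]
      by (intro nn_integral_mono) (auto simp: indicator_def ennreal_leI m_le')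
    then show ?thesis using ab_pos by simp
  qed
  have \<beta>_ge: "\<kappa> * \<tau> + \<sigma> * \<tau> \<le> \<beta>"
  proof -
    have "ennreal (\<kappa> * \<tau> + \<sigma> * \<tau>) \<le> ennreal \<beta>"
      unfolding m_below[symmetric] n_below[symmetric]
      by (intro nn_integral_mono) (auto simp: indicator_def ennreal_leI m_ge)
    then show ?thesis using \<beta>_nonneg by simp
  qed
  define q where "q = exp (- \<sigma> / \<kappa>)"
  have q: "0 < q" "q < 1" using \<sigma> k by (auto simp: q_def)
  have qT: "q * T = \<tau>" by (simp add: q_def T_def mult_exp_exp)
  have intL: "integrable lebesgue u" using int by (simp add: integrable_completion)
  have int_\<alpha>L: "integrable lebesgue (\<lambda>z. max 0 (u z - \<tau>))" using int_\<alpha>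
      by (simp add: integrable_completion)
  have \<alpha>L: "(LINT z|lebesgue. max 0 (u z - \<tau>)) = \<alpha>" by (simp add: \<alpha>_def integral_completion)
  have Om_set: "\<Omega> \<in> sets lebesgue" using Om(1) by (simp add: fmeasurableD)
  have int_ind: "integrable lebesgue (\<lambda>z. indicator \<Omega> z * \<tau>)"
    using Om by (intro integrable_mult_left) (auto simp: fmeasurable_def)
  have int_uOm: "integrable lebesgue (\<lambda>z. indicator \<Omega> z * u z)"
    using integrable_mult_indicator[OF Om_set intL] by simp
  \<comment> \<open>The bathtub principle: \<open>\<tau> * \<sigma> + \<alpha>\<close> bounds the
    integral of \<open>u\<close> over \<Omega>, and \<open>d\<close> is the pointwise loss, which
    vanishes only if \<Omega> agrees with the superlevel set up to the level set of \<tau>.\<close>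
  define d where "d z = indicator \<Omega> z * \<tau> + max 0 (u z - \<tau>) - indicator \<Omega> z * u z" for z
  have d_nonneg: "0 \<le> d z" for z by (auto simp: d_def indicator_def)
  have int_d: "integrable lebesgue d"
    unfolding d_def[abs_def] using int_ind int_\<alpha>L int_uOm by auto
  have d_int: "(LINT z|lebesgue. d z) = \<tau> * \<sigma> + \<alpha> - (LINT z:\<Omega>|lebesgue. u z)"
    unfolding d_def[abs_def] set_lebesgue_integral_def
    using int_ind int_\<alpha>L int_uOm \<alpha>L by (simp add: \<sigma>_def mult.commute)
  have d_ge: "0 \<le> (LINT z|lebesgue. d z)" using d_nonneg by (intro integral_nonneg_AE) auto
  \<comment> \<open>The comparison function satisfies the claim with equality because
    \<open>q * T = \<tau>\<close>. The slack is therefore a combination, with positive weights, of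
    the slack in \<beta> and the slack in \<alpha>.\<close>
  have key: "(1 - q) * J - (\<tau> * \<sigma> + \<alpha>)
      = (1 - q) * (\<beta> - (\<kappa> * \<tau> + \<sigma> * \<tau>)) + q * (\<kappa> * (T - \<tau>) - \<sigma> * \<tau> - \<alpha>)"
  proof -
    have "\<kappa> * \<tau> = \<kappa> * (q * T)" by (simp add: qT)
    then show ?thesis unfolding J_eq by (simp add: algebra_simps)
  qed
  have t1: "0 \<le> (1 - q) * (\<beta> - (\<kappa> * \<tau> + \<sigma> * \<tau>))" using q \<beta>_ge by simp
  have t2: "0 \<le> q * (\<kappa> * (T - \<tau>) - \<sigma> * \<tau> - \<alpha>)" using q \<alpha>_le by simp
  show "(LINT z:\<Omega>|lebesgue. u z) \<le> (1 - exp (- measure lebesgue \<Omega> / \<kappa>)) * (LINT z|lborel. u z)"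
    using key t1 t2 d_ge d_int unfolding q_def \<sigma>_def J_def by linarith
  assume "(LINT z:\<Omega>|lebesgue. u z) = (1 - exp (- measure lebesgue \<Omega> / \<kappa>)) * (LINT z|lborel. u z)"
  then have eq: "(LINT z:\<Omega>|lebesgue. u z) = (1 - q) * J" by (simp add: q_def \<sigma>_def J_def)
  have "(1 - q) * (\<beta> - (\<kappa> * \<tau> + \<sigma> * \<tau>)) = 0" "q * (\<kappa> * (T - \<tau>) - \<sigma> * \<tau> - \<alpha>) = 0"
    and d0: "(LINT z|lebesgue. d z) = 0"
    using key t1 t2 d_ge d_int eq by linarith+
  then have \<beta>: "\<beta> = \<kappa> * \<tau> + \<sigma> * \<tau>" and \<alpha>: "\<alpha> = \<kappa> * (T - \<tau>) - \<sigma> * \<tau>" using q by auto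
  have JT: "J = \<kappa> * T" by (simp add: J_eq \<alpha> \<beta> algebra_simps)
  have u_le: "u z \<le> T" for z
    using m_pos_iff[OF T] m_zero[of T] by (metis less_irrefl not_le order_refl)
  \<comment> \<open>If \<open>u\<close> stayed below some \<open>t < T\<close>, then
    \<open>m\<close> would vanish near \<open>T\<close> while \<open>n\<close> is positive there,
    and \<alpha> would fall short of its extremal value.\<close>
  have sup_u: "\<exists>z. t < u z" if "t < T" for t
  proof (rule ccontr)
    assume no: "\<nexists>z. t < u z"
    define r where "r = max t \<tau>"
    have r: "0 < r" "r < T" "\<tau> \<le> r" using that \<tau>T \<tau> by (auto simp: r_def)
    have m0: "m t' = 0" if "r \<le> t'" for t'
    proof -
      have "t \<le> t'" "0 < t'" using that r by (auto simp: r_def)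
      then have "\<nexists>z. t' < u z" using no by (meson le_less_trans)
      then show ?thesis using m_pos_iff[OF \<open>0 < t'\<close>] m_nonneg[of t'] by auto
    qed
    have "ennreal \<alpha> \<le> (\<integral>\<^sup>+t. ennreal (n t) * indicator {\<tau><..<r} t \<partial>lborel)"
      unfolding m_above[symmetric]
      using m0 m_le' r by (intro nn_integral_mono) (auto simp: indicator_def ennreal_leI not_less)
    also have "\<dots> = ennreal (\<kappa> * (log_primitive T r - log_primitive T \<tau>))"
      unfolding n_def using nn_integral_log[of \<tau> r T \<kappa>] r \<tau> T k by simp
    finally have 1: "ennreal \<alpha> \<le> ennreal (\<kappa> * (log_primitive T r - log_primitive T \<tau>))" .
    have "(\<integral>\<^sup>+t. ennreal (n t) * indicator {r<..<T} t \<partial>lborel)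
        = ennreal (\<kappa> * (T - log_primitive T r))"
      unfolding n_def using nn_integral_log[of r T T \<kappa>] r T k LT by simp
    moreover have "(\<integral>\<^sup>+t. ennreal (n t) * indicator {r<..<T} t \<partial>lborel) \<noteq> 0"
    proof
      assume "(\<integral>\<^sup>+t. ennreal (n t) * indicator {r<..<T} t \<partial>lborel) = 0"
      then have "AE t in lborel. ennreal (n t) * indicator {r<..<T} t = 0"
        unfolding n_def by (subst (asm) nn_integral_0_iff_AE) auto
      then have "AE t in lborel. t \<notin> {r<..<T}"
      proof eventually_elim
        case (elim t)
        then show ?case using n_pos[of t] r by (auto simp: indicator_def)
      qed
      then have "emeasure lborel {r<..<T} = 0"
          by (subst (asm) AE_iff_measurable[of "{r<..<T}"]) auto
      then show False using r by simp
    qed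
    ultimately have "0 < \<kappa> * (T - log_primitive T r)" by (metis ennreal_eq_0_iff not_less)
    then have "\<kappa> * (log_primitive T r - log_primitive T \<tau>) < \<kappa> * (T - log_primitive T \<tau>)"
      by (simp add: algebra_simps)
    also have "\<dots> = \<alpha>" using k by (simp add: \<alpha> LT field_simps)
    finally show False using 1 ab_pos \<alpha> by (simp add: ennreal_le_iff2)
  qed
  have "AE z in lebesgue. d z = 0"
    using integral_nonneg_eq_0_iff_AE[OF int_d] d_nonneg d0 by auto
  then have "AE z in lebesgue. (z \<in> \<Omega> \<longrightarrow> \<tau> \<le> u z) \<and> (z \<notin> \<Omega> \<longrightarrow> u z \<le> \<tau>)"
    by eventually_elim (auto simp: d_def indicator_def max_def split: if_splits)
  then show "\<exists>\<tau> T. 0 < \<tau> \<and> \<tau> < T \<and> (LINT z|lborel. u z) = \<kappa> * T \<and> (\<forall>z. u z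
      \<le> T) \<and> (\<forall>t<T. \<exists>z. t < u z) \<and>
        (AE z in lebesgue. (z \<in> \<Omega> \<longrightarrow> \<tau> \<le> u z) \<and> (z \<notin> \<Omega> \<longrightarrow> u z \<le> \<tau>))"
    using \<tau> \<tau>T JT u_le sup_u unfolding J_def by blast
qed

section \<open>Mean values of entire functions\<close>

lemma nn_integral_shear_fst:
  fixes f :: "real \<times> real \<Rightarrow> ennreal"
  assumes [measurable]: "f \<in> borel_measurable borel"
  shows "(\<integral>\<^sup>+z. f (fst z + a * snd z, snd z) \<partial>lborel) = (\<integral>\<^sup>+z. f z \<partial>lborel)"
proof -
  have "(\<lambda>z :: real \<times> real. (fst z + a * snd z, snd z)) \<in> borel_measurable borel"
    by (intro borel_measurable_continuous_onI continuous_intros)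
  then have m: "(\<lambda>z. f (fst z + a * snd z, snd z)) \<in> borel_measurable borel" by measurable
  have m1: "(\<lambda>x. f (x, y)) \<in> borel_measurable borel" for y
    by (rule measurable_compose[OF _ assms]) (intro borel_measurable_continuous_onI
        continuous_intros)
  have "(\<integral>\<^sup>+x. f (x, y) \<partial>lborel) = (\<integral>\<^sup>+x. f (x + a * y, y) \<partial>lborel)" for y
    using nn_integral_real_affine[OF m1, of 1 y "a * y"] by (simp add: add.commute)
  then show ?thesis
    by (simp add: nn_integral_lborel_pair(2)[OF m] nn_integral_lborel_pair(2)[OF assms])
qed

lemma nn_integral_shear_snd:
  fixes f :: "real \<times> real \<Rightarrow> ennreal"
  assumes [measurable]: "f \<in> borel_measurable borel"
  shows "(\<integral>\<^sup>+z. f (fst z, snd z + a * fst z) \<partial>lborel) = (\<integral>\<^sup>+z. f z \<partial>lborel)"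
proof -
  have "(\<lambda>z :: real \<times> real. (fst z, snd z + a * fst z)) \<in> borel_measurable borel"
    by (intro borel_measurable_continuous_onI continuous_intros)
  then have m: "(\<lambda>z. f (fst z, snd z + a * fst z)) \<in> borel_measurable borel" by measurable
  have m1: "(\<lambda>y. f (x, y)) \<in> borel_measurable borel" for x
    by (rule measurable_compose[OF _ assms]) (intro borel_measurable_continuous_onI
        continuous_intros)
  have "(\<integral>\<^sup>+y. f (x, y) \<partial>lborel) = (\<integral>\<^sup>+y. f (x, y + a * x) \<partial>lborel)" for x
    using nn_integral_real_affine[OF m1, of 1 x "a * x"] by (simp add: add.commute)
  then show ?thesis
    by (simp add: nn_integral_lborel_pair(1)[OF m] nn_integral_lborel_pair(1)[OF assms])
qed

text \<open>A rotation by an angle other than \<open>\<pi>\<close> is a product of three shears.\<close>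
lemma nn_integral_rotation_aux:
  fixes f :: "real \<times> real \<Rightarrow> ennreal"
  assumes f: "f \<in> borel_measurable borel" and cs: "c\<^sup>2 + s\<^sup>2 = 1" and c: "c \<noteq> -1"
  shows "(\<integral>\<^sup>+z. f (c * fst z - s * snd z, s * fst z + c * snd z) \<partial>lborel) = (\<integral>\<^sup>+z. f z \<partial>lborel)"
proof -
  \<comment> \<open>For an angle with cosine \<open>c\<close> and sine \<open>s\<close> this is the
    tangent of half the angle.\<close>
  define t where "t = s / (1 + c)"
  have c1: "1 + c \<noteq> 0" using c by auto
  have "s * s = (1 + c) * (1 - c)" using cs by (simp add: power2_eq_square algebra_simps)
  then have st: "s * t = 1 - c" and ct: "t * (1 + c) = s" using c1 by (simp_all add: t_def)
  define f1 where "f1 z = f (fst z + (- t) * snd z, snd z)" for z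
  define f2 where "f2 z = f1 (fst z, snd z + s * fst z)" for z
  have m1: "f1 \<in> borel_measurable borel" unfolding f1_def[abs_def]
    by (rule measurable_compose[OF _ f]) (intro borel_measurable_continuous_onI continuous_intros)
  have m2: "f2 \<in> borel_measurable borel" unfolding f2_def[abs_def]
    by (rule measurable_compose[OF _ m1]) (intro borel_measurable_continuous_onI continuous_intros)
  have e1: "y + s * (x - t * y) = s * x + c * y" for x y
  proof -
    have "y + s * (x - t * y) = y + s * x - (s * t) * y" by (simp add: algebra_simps)
    then show ?thesis unfolding st by (simp add: algebra_simps)
  qed
  have e2: "x - t * y - t * (s * x + c * y) = c * x - s * y" for x y
  proof -
    have "x - t * y - t * (s * x + c * y) = x - (s * t) * x - (t * (1 + c)) * y"
      by (simp add: algebra_simps)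
    then show ?thesis unfolding st ct by (simp add: algebra_simps)
  qed
  have "(\<integral>\<^sup>+z. f z \<partial>lborel) = (\<integral>\<^sup>+z. f1 z \<partial>lborel)"
    unfolding f1_def by (rule nn_integral_shear_fst[OF f, symmetric])
  also have "\<dots> = (\<integral>\<^sup>+z. f2 z \<partial>lborel)"
    unfolding f2_def by (rule nn_integral_shear_snd[OF m1, symmetric])
  also have "\<dots> = (\<integral>\<^sup>+z. f2 (fst z + (- t) * snd z, snd z) \<partial>lborel)"
    by (rule nn_integral_shear_fst[OF m2, symmetric])
  also have "\<dots> = (\<integral>\<^sup>+z. f (c * fst z - s * snd z, s * fst z + c * snd z) \<partial>lborel)"
    by (simp add: f1_def f2_def e1 e2)
  finally show ?thesis by simp
qed

lemma nn_integral_rotation: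
  fixes f :: "real \<times> real \<Rightarrow> ennreal"
  assumes f: "f \<in> borel_measurable borel" and cs: "c\<^sup>2 + s\<^sup>2 = 1"
  shows "(\<integral>\<^sup>+z. f (c * fst z - s * snd z, s * fst z + c * snd z) \<partial>lborel) = (\<integral>\<^sup>+z. f z \<partial>lborel)"
proof (cases "c = -1")
  case True
  \<comment> \<open>The half turn, which the shears do not reach, is carried out as two quarter
    turns.\<close>
  define g where "g z = f (- snd z, fst z)" for z :: "real \<times> real"
  have g: "g \<in> borel_measurable borel" unfolding g_def[abs_def]
    by (rule measurable_compose[OF _ f]) (intro borel_measurable_continuous_onI continuous_intros)
  have "s = 0" using cs True by simp
  have "(\<integral>\<^sup>+z. f z \<partial>lborel) = (\<integral>\<^sup>+z. g z \<partial>lborel)"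
    using nn_integral_rotation_aux[OF f, of 0 1] by (simp add: g_def)
  also have "\<dots> = (\<integral>\<^sup>+z. g (- snd z, fst z) \<partial>lborel)"
    using nn_integral_rotation_aux[OF g, of 0 1] by simp
  finally show ?thesis by (simp add: g_def True \<open>s = 0\<close>)
qed (use nn_integral_rotation_aux[OF assms] in auto)

lemma lborel_distr_rotation:
  fixes c s :: real
  assumes "c\<^sup>2 + s\<^sup>2 = 1"
  shows "distr lborel borel (\<lambda>z. (c * fst z - s * snd z, s * fst z + c * snd z)) = lborel"
proof (rule measure_eqI)
  let ?r = "\<lambda>z :: real \<times> real. (c * fst z - s * snd z, s * fst z + c * snd z)"
  fix A assume "A \<in> sets (distr lborel borel ?r)"
  then have A[measurable]: "A \<in> sets borel" by simp
  have [measurable]: "?r \<in> borel_measurable borel"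
    by (intro borel_measurable_continuous_onI continuous_intros)
  have "emeasure (distr lborel borel ?r) A = (\<integral>\<^sup>+z. indicator A (?r z) \<partial>lborel)"
    by (subst nn_integral_indicator[symmetric], simp, subst nn_integral_distr) auto
  also have "\<dots> = (\<integral>\<^sup>+z. indicator A z \<partial>lborel)"
    by (rule nn_integral_rotation[OF _ assms]) auto
  finally show "emeasure (distr lborel borel ?r) A = emeasure lborel A" by simp
qed simp

section \<open>Means over circles and against radial weights\<close>

definition cplx :: "real \<times> real \<Rightarrow> complex" where "cplx z = Complex (fst z) (snd z)"

lemma continuous_on_cplx [continuous_intros]: "continuous_on S cplx"
proof -
  have eq: "cplx = (\<lambda>z. complex_of_real (fst z) + \<i> * complex_of_real (snd z))"
    by (simp add: cplx_def fun_eq_iff complex_eq_iff)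
  show ?thesis by (subst eq) (intro continuous_intros)
qed

lemma norm_cplx [simp]: "norm (cplx z) = norm z"
  by (cases z) (simp add: cplx_def norm_Pair cmod_def)

lemma cplx_add: "cplx (z + w) = cplx z + cplx w"
  by (simp add: cplx_def complex_eq_iff)

text \<open>Cauchy's formula on the unit circle for \<open>\<lambda>u. F (u * \<zeta>)\<close>; the
  dilation by \<zeta> covers all radii at once, including 0.\<close>

lemma circle_mean_value:
  assumes F: "F holomorphic_on UNIV"
  shows "((\<lambda>t. F (cis (2 * pi * t) * \<zeta>)) has_integral F 0) {0..1}"
proof -
  have hol: "(\<lambda>u. F (u * \<zeta>)) holomorphic_on cball 0 1"
    by (rule holomorphic_on_compose_gen[of "\<lambda>u. u * \<zeta>" "cball 0 1" F UNIV, unfolded o_def])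
       (auto intro!: holomorphic_intros F)
  have "((\<lambda>u. F (u * \<zeta>) / (u - 0)) has_contour_integral (2 * of_real pi * \<i> * F (0
      * \<zeta>))) (circlepath 0 1)"
    by (rule Cauchy_integral_circlepath_simple[OF hol]) simp
  then have "((\<lambda>t. F (circlepath 0 1 t * \<zeta>) / circlepath 0 1 t
      * vector_derivative (circlepath 0 1) (at t within {0..1}))
      has_integral (2 * of_real pi * \<i> * F 0)) {0..1}"
    by (simp add: has_contour_integral_def)
  then have "((\<lambda>t. 2 * of_real pi * \<i> * F (cis (2 * pi * t) * \<zeta>))
      has_integral (2 * of_real pi * \<i> * F 0)) {0..1}"
  proof (rule has_integral_eq[rotated])
    fix t :: real assume "t \<in> {0..1}"
    then have vd: "vector_derivative (circlepath 0 1) (at t within {0..1})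
        = 2 * of_real pi * \<i> * cis (2 * pi * t)"
      using vector_derivative_circlepath01[of t 0 1] by (simp add: cis_conv_exp mult_ac)
    have cp: "circlepath 0 1 t = cis (2 * pi * t)" by (simp add: circlepath cis_conv_exp mult_ac)
    show "F (circlepath 0 1 t * \<zeta>) / circlepath 0 1 t
        * vector_derivative (circlepath 0 1) (at t within {0..1})
        = 2 * of_real pi * \<i> * F (cis (2 * pi * t) * \<zeta>)"
      unfolding vd cp by simp
  qed
  from has_integral_mult_right[OF this, of "1 / (2 * of_real pi * \<i>)"] show ?thesis by simp
qed

text \<open>The integral is unchanged when \<open>z\<close> is rotated, so it equals its average
  over all rotations. Exchanging the integrals puts the circle mean inside, where it is
  \<open>F 0\<close> for each \<open>z\<close>. This replaces polar coordinates.\<close>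

theorem radial_mean_value:
  fixes w :: "real \<times> real \<Rightarrow> real"
  assumes F: "F holomorphic_on UNIV" and w: "integrable lborel w"
    and radial: "\<And>z z'. norm z = norm z' \<Longrightarrow> w z = w z'"
    and int: "integrable lborel (\<lambda>z. w z *\<^sub>R F (cplx z))"
  shows "(LINT z|lborel. w z *\<^sub>R F (cplx z)) = (LINT z|lborel. w z) *\<^sub>R F 0"
proof -
  define r where "r t z = (cos (2 * pi * t) * fst z - sin (2 * pi * t) * snd z,
     sin (2 * pi * t) * fst z + cos (2 * pi * t) * snd z)" for t and z :: "real \<times> real"
  have cplx_r: "cplx (r t z) = cis (2 * pi * t) * cplx z" for t z
    by (simp add: cplx_def r_def complex_eq_iff)
  have norm_r: "norm (r t z) = norm z" for t z
    using norm_cplx[of "r t z"] by (simp add: cplx_r norm_mult)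
  have F_cont: "continuous_on UNIV F" using F by (rule holomorphic_on_imp_continuous_on)
  have [measurable]: "F \<in> borel_measurable borel"
      by (rule borel_measurable_continuous_onI[OF F_cont])
  have [measurable]: "cplx \<in> borel_measurable borel"
    by (rule borel_measurable_continuous_onI[OF continuous_on_cplx])
  have [measurable]: "w \<in> borel_measurable borel" using borel_measurable_integrable[OF w] by simp
  have r_meas: "r t \<in> borel_measurable borel" for t
    unfolding r_def[abs_def] by (intro borel_measurable_continuous_onI continuous_intros)
  define h where "h z = w z *\<^sub>R F (cplx z)" for z
  have [measurable]: "h \<in> borel_measurable borel" unfolding h_def[abs_def] by measurable
  have h_int: "integrable lborel h" using int by (simp add: h_def[abs_def])
  have h_r: "h (r t z) = w z *\<^sub>R F (cis (2 * pi * t) * cplx z)" for t z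
    using radial[OF norm_r] by (simp add: h_def cplx_r)
  have distr: "distr lborel borel (r t) = lborel" for t
    unfolding r_def[abs_def] by (rule lborel_distr_rotation) simp
  have int_r: "(LINT z|lborel. h (r t z)) = (LINT z|lborel. h z)" for t
    using integral_distr[of "r t" lborel borel h] r_meas distr by simp
  have nn_r: "(\<integral>\<^sup>+z. norm (h (r t z)) \<partial>lborel) = (\<integral>\<^sup>+z. norm (h z) \<partial>lborel)" for t
    using nn_integral_distr[of "r t" lborel borel "\<lambda>z. ennreal (norm (h z))"] r_meas distr by simp
  have "(\<lambda>p. r (fst p) (snd p)) \<in> borel_measurable borel"
    unfolding r_def[abs_def] by (intro borel_measurable_continuous_onI continuous_intros)
  then have [measurable]: "(\<lambda>p. r (fst p) (snd p)) \<in> borel_measurable (lborel \<Otimes>\<^sub>M lborel)"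
    by (simp add: lborel_prod)
  \<comment> \<open>The indicator turns the average over the angle into an integral over the line,
    so that Fubini for \<open>lborel\<close> applies.\<close>
  define K where "K t z = indicator {0..1} t *\<^sub>R h (r t z)" for t z
  have K_meas: "case_prod K \<in> borel_measurable (lborel \<Otimes>\<^sub>M lborel)"
  proof -
    have "(\<lambda>p. indicator {0..1} (fst p) *\<^sub>R h (r (fst p) (snd p))) \<in> borel_measurable (lborel \<Otimes>\<^sub>M
        lborel)"
      by measurable
    also have "(\<lambda>p. indicator {0..1} (fst p) *\<^sub>R h (r (fst p) (snd p))) = case_prod K"
      by (simp add: fun_eq_iff K_def)
    finally show ?thesis .
  qed
  have K_int: "integrable (lborel \<Otimes>\<^sub>M lborel) (case_prod K)"
  proof (rule integrableI_bounded[OF K_meas])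
    have "(\<integral>\<^sup>+p. norm (case_prod K p) \<partial>(lborel \<Otimes>\<^sub>M lborel))
        = (\<integral>\<^sup>+t. \<integral>\<^sup>+z. norm (K t z) \<partial>lborel \<partial>lborel)"
      using K_meas by (subst lborel.nn_integral_fst[symmetric]) auto
    also have "\<dots> = (\<integral>\<^sup>+t. (\<integral>\<^sup>+z. norm (h z) \<partial>lborel) * indicator {0..1::real} t \<partial>lborel)"
      by (intro nn_integral_cong) (auto simp: K_def indicator_def nn_r)
    also have "\<dots> = (\<integral>\<^sup>+z. norm (h z) \<partial>lborel)" by (subst nn_integral_cmult_indicator) auto
    also have "\<dots> < \<infinity>" using h_int by (simp add: integrable_iff_bounded)
    finally show "(\<integral>\<^sup>+p. norm (case_prod K p) \<partial>(lborel \<Otimes>\<^sub>M lborel)) < \<infinity>" .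
  qed
  have inner: "(LINT t|lborel. K t z) = w z *\<^sub>R F 0" for z
  proof -
    have cont: "continuous_on {0..1} (\<lambda>t. F (cis (2 * pi * t) * cplx z))"
      by (intro continuous_on_compose2[OF F_cont] continuous_intros) auto
    have si: "set_integrable lborel {0..1} (\<lambda>t. F (cis (2 * pi * t) * cplx z))"
      unfolding set_integrable_def by (rule borel_integrable_compact[OF _ cont]) auto
    have "(LINT t:{0..1}|lborel. F (cis (2 * pi * t) * cplx z)) = F 0"
      using set_borel_integral_eq_integral(2)[OF si] circle_mean_value[OF F, of "cplx z"]
      by (simp add: integral_unique)
    moreover have "(\<lambda>t. K t z) = (\<lambda>t. w z *\<^sub>R (indicator {0..1} t *\<^sub>R F (cis (2 * pi * t)
        * cplx z)))"
      by (simp add: fun_eq_iff K_def h_r)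
    ultimately show ?thesis
      using si by (simp only: set_lebesgue_integral_def set_integrable_def integral_scaleR_right)
  qed
  have "(LINT z|lborel. w z) *\<^sub>R F 0 = (LINT z|lborel. LINT t|lborel. K t z)"
    using w by (simp add: inner)
  also have "\<dots> = (LINT t|lborel. LINT z|lborel. K t z)"
    by (rule lborel_pair.Fubini_integral[OF K_int])
  also have "\<dots> = (LINT t|lborel. indicator {0..1::real} t *\<^sub>R (LINT z|lborel. h z))"
    by (simp add: K_def int_r)
  also have "\<dots> = (LINT z|lborel. h z)" by simp
  finally show ?thesis by (simp add: h_def)
qed

section \<open>Gaussians in the plane\<close>

definition gaussian :: "real \<Rightarrow> real \<Rightarrow> real \<times> real \<Rightarrow> real \<times> real \<Rightarrow> real" where
  "gaussian T c z0 z = T * exp (- c * (norm (z - z0))\<^sup>2)"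

lemma gaussian_superlevel:
  assumes c: "0 < c" and T: "0 < T" "0 < t" "t < T"
  shows "{z. t < gaussian T c z0 z} = ball z0 (sqrt ((ln T - ln t) / c))"
proof -
  have "t < gaussian T c z0 z \<longleftrightarrow> dist z0 z < sqrt ((ln T - ln t) / c)" for z
  proof -
    have "t < gaussian T c z0 z \<longleftrightarrow> ln t < ln (gaussian T c z0 z)"
      using T by (subst ln_less_cancel_iff) (auto simp: gaussian_def)
    also have "ln (gaussian T c z0 z) = ln T - c * (norm (z - z0))\<^sup>2"
      using T by (simp add: gaussian_def ln_mult)
    also have "ln t < ln T - c * (norm (z - z0))\<^sup>2 \<longleftrightarrow> (norm (z - z0))\<^sup>2 < (ln T - ln t) / c"
      using c by (simp add: field_simps)
    also have "\<dots> \<longleftrightarrow> norm (z - z0) < sqrt ((ln T - ln t) / c)"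
      by (metis real_less_rsqrt real_sqrt_less_iff real_sqrt_abs abs_norm_cancel)
    finally show ?thesis by (simp add: dist_norm norm_minus_commute)
  qed
  then show ?thesis by auto
qed

lemma emeasure_ball_plane:
  fixes z0 :: "real \<times> real"
  assumes "0 \<le> r"
  shows "emeasure lborel (ball z0 r) = ennreal (pi * r\<^sup>2)" "measure lborel (ball z0 r) = pi * r\<^sup>2"
  using emeasure_ball[OF assms, of z0] content_ball[OF assms, of z0]
      by (simp_all add: unit_ball_vol_2 power2_eq_square)

text \<open>The equality case of the decay hypothesis, with \<open>\<kappa> = pi / c\<close>. For
  \<open>t \<ge> T\<close> both sides are 0, since \<open>ennreal\<close> truncates negative
  numbers.\<close>

lemma emeasure_gaussian_superlevel:
  assumes c: "0 < c" and T: "0 < T" "0 < t"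
  shows "emeasure lborel {z. t < gaussian T c z0 z} = ennreal (pi / c * (ln T - ln t))"
proof (cases "t < T")
  case True
  then have "ln t \<le> ln T" using T by simp
  then have "0 \<le> (ln T - ln t) / c" using c by simp
  then show ?thesis
    using gaussian_superlevel[OF c T(1,2) True, of z0] by (simp add: emeasure_ball_plane)
next
  case False
  have "gaussian T c z0 z \<le> T" for z using c T by (simp add: gaussian_def)
  then have "{z. t < gaussian T c z0 z} = {}" using False
      by (auto simp: not_less intro: order_trans)
  moreover have "pi / c * (ln T - ln t) \<le> 0"
    using False T c by (intro mult_nonneg_nonpos) auto
  ultimately show ?thesis by (simp only: emeasure_empty ennreal_neg)
qed

lemma continuous_on_gaussian: "continuous_on S (gaussian T c z0)"
  unfolding gaussian_def[abs_def] by (intro continuous_intros)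

text \<open>Layer cake with the explicit distribution function. The third part, the mass above a
  level, is what evaluates the concentration on a disc.\<close>

lemma gaussian_integral:
  assumes c: "0 < c" and T: "0 < T"
  shows "integrable lborel (gaussian T c z0)" "(LINT z|lborel. gaussian T c z0 z) = pi / c * T"
    and "0 \<le> s \<Longrightarrow> s \<le> T \<Longrightarrow> (LINT z|lborel. max 0 (gaussian T c z0 z - s))
        = pi / c * (T - log_primitive T s)"
proof -
  have [measurable]: "gaussian T c z0 \<in> borel_measurable borel"
    by (rule borel_measurable_continuous_onI[OF continuous_on_gaussian])
  have nonneg: "0 \<le> gaussian T c z0 z" for z using T by (simp add: gaussian_def)
  have nn: "(\<integral>\<^sup>+z. ennreal (max 0 (gaussian T c z0 z - s)) \<partial>lborel)
      = ennreal (pi / c * (T - log_primitive T s))"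
    if s: "0 \<le> s" "s \<le> T" for s
  proof -
    have "(\<integral>\<^sup>+z. ennreal (max 0 (gaussian T c z0 z - s)) \<partial>lborel)
      = (\<integral>\<^sup>+t. emeasure lborel {z. t < gaussian T c z0 z} * indicator {s..} t \<partial>lborel)"
      by (rule layer_cake_above) simp
    also have "\<dots> = (\<integral>\<^sup>+t. ennreal (pi / c * (ln T - ln t)) * indicator {s<..<T} t \<partial>lborel)"
    proof (rule nn_integral_cong_AE, use AE_lborel_singleton[of s] in eventually_elim)
      fix t assume "t \<noteq> s"
      show "emeasure lborel {z. t < gaussian T c z0 z} * indicator {s..} t
          = ennreal (pi / c * (ln T - ln t)) * indicator {s<..<T} t"
      proof (cases "s < t \<and> T \<le> t")
        case True
        then have "pi / c * (ln T - ln t) \<le> 0" using c T by (intro mult_nonneg_nonpos) auto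
        then show ?thesis using emeasure_gaussian_superlevel[OF c T, of t z0] True s
          by (simp add: ennreal_neg)
      next
        case False
        then show ?thesis using \<open>t \<noteq> s\<close> s emeasure_gaussian_superlevel[OF c T, of t z0]
          by (auto simp: indicator_def)
      qed
    qed
    also have "\<dots> = ennreal (pi / c * (log_primitive T T - log_primitive T s))"
      using c T s by (intro nn_integral_log) auto
    finally show ?thesis by (simp add: log_primitive_def)
  qed
  have prim: "log_primitive T 0 = 0" by (simp add: log_primitive_def)
  have nn0: "(\<integral>\<^sup>+z. ennreal (gaussian T c z0 z) \<partial>lborel) = ennreal (pi / c * T)"
    using nn[of 0] T nonneg by (simp add: prim max_def)
  show int: "integrable lborel (gaussian T c z0)"
    by (rule integrableI_nonneg) (use nn0 nonneg in auto)
  show "(LINT z|lborel. gaussian T c z0 z) = pi / c * T"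
    using nn0 c T nonneg by (intro integral_eq_nn_integral[THEN trans]) auto
  show "(LINT z|lborel. max 0 (gaussian T c z0 z - s)) = pi / c * (T - log_primitive T s)" if "0
      \<le> s" "s \<le> T"
  proof -
    have "0 \<le> T - log_primitive T s"
    proof (cases "s = 0")
      case False
      have "ln T - ln s \<le> T / s - 1"
        using ln_le_minus_one[of "T / s"] that False T by (simp add: ln_div)
      then have "s * (ln T - ln s) \<le> s * (T / s - 1)" using that by (intro mult_left_mono) auto
      then show ?thesis using False by (simp add: log_primitive_def algebra_simps)
    qed (use T prim in simp)
    then show ?thesis
      using nn[OF that] c by (intro integral_eq_nn_integral[THEN trans]) auto
  qed
qed

text \<open>Bernoulli's inequality for real exponents: Young's inequality for
  \<open>x powr p\<close> and \<open>1\<close> with the weights \<open>1 / p\<close> and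
  \<open>1 - 1 / p\<close>.\<close>

lemma powr_ge_linear:
  fixes x p :: real
  assumes "0 \<le> x" "1 \<le> p"
  shows "1 + p * (x - 1) \<le> x powr p"
proof (cases "x = 0")
  case False
  then have "(x powr p) powr (1 / p) * 1 powr (1 - 1 / p) \<le> 1 / p * x powr p + (1 - 1 / p) * 1"
    using assms by (intro Youngs_inequality_0) auto
  moreover have "(x powr p) powr (1 / p) = x" using assms False by (simp add: powr_powr)
  ultimately have "x \<le> x powr p / p + (1 - 1 / p)" by simp
  then have "p * x \<le> p * (x powr p / p + (1 - 1 / p))" using assms by (intro mult_left_mono) auto
  then show ?thesis using assms by (simp add: algebra_simps)
qed (use assms in simp)

text \<open>Liouville's theorem for \<open>1 / (G + \<i>)\<close>, which is bounded by 1 because the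
  denominator has imaginary part 1.\<close>

lemma entire_real_valued_constant:
  assumes G: "G holomorphic_on UNIV" and real: "\<And>z. Im (G z) = 0"
  obtains k where "\<And>z. G z = k"
proof -
  have ne: "G z + \<i> \<noteq> 0" for z
  proof
    assume "G z + \<i> = 0"
    then have "Im (G z + \<i>) = 0" by simp
    then show False using real[of z] by simp
  qed
  have "(\<lambda>z. 1 / (G z + \<i>)) constant_on UNIV"
  proof (rule Liouville_theorem)
    show "(\<lambda>z. 1 / (G z + \<i>)) holomorphic_on UNIV" using G ne by (intro holomorphic_intros) auto
    show "bounded (range (\<lambda>z. 1 / (G z + \<i>)))"
    proof (rule boundedI)
      fix y assume "y \<in> range (\<lambda>z. 1 / (G z + \<i>))"
      then obtain z where y: "y = 1 / (G z + \<i>)" by auto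
      have "1 \<le> norm (G z + \<i>)" using abs_Im_le_cmod[of "G z + \<i>"] real[of z] by simp
      then show "norm y \<le> 1" by (simp add: y norm_divide divide_le_eq_1)
    qed
  qed
  then obtain k where k: "1 / (G z + \<i>) = k" for z by (auto simp: constant_on_def)
  have "1 / k = G z + \<i>" for z by (simp add: k[of z, symmetric])
  then have "G z = 1 / k - \<i>" for z by (metis add_diff_cancel_right')
  then show thesis by (rule that)
qed

text \<open>The weight normalises \<open>1\<close> to have the mass of the Gaussian, so the tangent line
  bound \<open>1 + p (Re G - 1) \<le> |G|^p\<close> must be an equality everywhere.\<close>
theorem extremal_constant:
  fixes p :: real
  assumes p: "1 \<le> p" and G: "G holomorphic_on UNIV" and G0: "G 0 = 1"
    and int: "integrable lborel (\<lambda>z. norm (G (cplx z)) powr p * gaussian 1 c 0 z)" and c: "0 < c"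
    and le: "(LINT z|lborel. norm (G (cplx z)) powr p * gaussian 1 c 0 z) \<le> pi / c"
  shows "G \<zeta> = 1"
proof -
  let ?g = "gaussian 1 c 0"
  have g_pos: "0 < ?g z" for z by (simp add: gaussian_def)
  have g_int: "integrable lborel ?g" "(LINT z|lborel. ?g z) = pi / c"
    using gaussian_integral[OF c, of 1 0] by auto
  have G_cont: "continuous_on UNIV (\<lambda>z. G (cplx z))"
    by (intro continuous_on_compose2[OF holomorphic_on_imp_continuous_on[OF G]] continuous_intros)
        auto
  have pw: "1 + p * (norm \<xi> - 1) \<le> norm \<xi> powr p" for \<xi> :: complex
    by (rule powr_ge_linear) (use p in auto)
  \<comment> \<open>This makes \<open>G\<close> itself integrable against the Gaussian, as the mean
    value property requires.\<close>
  have "norm \<xi> \<le> 1 + norm \<xi> powr p" for \<xi> :: complex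
  proof -
    have "norm \<xi> \<le> 1 + p * (norm \<xi> - 1)" if "1 \<le> norm \<xi>"
    proof -
      have "1 * (norm \<xi> - 1) \<le> p * (norm \<xi> - 1)" by (rule mult_right_mono) (use p that in auto)
      then show ?thesis by simp
    qed
    then have "norm \<xi> \<le> 1 + p * (norm \<xi> - 1) \<or> norm \<xi> \<le> 1" by fastforce
    then show ?thesis using pw[of \<xi>] powr_ge_zero[of "norm \<xi>" p] by linarith
  qed
  then have bnd: "norm (?g z *\<^sub>R G (cplx z)) \<le> norm (?g z + norm (G (cplx z)) powr p * ?g z)" for z
    using mult_left_mono[of "norm (G (cplx z))" "1 + norm (G (cplx z)) powr p" "?g z"] g_pos[of z]
    by (simp add: algebra_simps)
  have "integrable lborel (\<lambda>z. ?g z + norm (G (cplx z)) powr p * ?g z)"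
    using g_int int by simp
  then have int1: "integrable lborel (\<lambda>z. ?g z *\<^sub>R G (cplx z))"
  proof (rule Bochner_Integration.integrable_bound)
    show "(\<lambda>z. ?g z *\<^sub>R G (cplx z)) \<in> borel_measurable lborel"
      using G_cont by (auto intro!: borel_measurable_continuous_onI continuous_intros
          continuous_on_gaussian)
  qed (use bnd in simp)
  have mean: "(LINT z|lborel. ?g z *\<^sub>R G (cplx z)) = of_real (pi / c)"
    by (subst radial_mean_value[OF G g_int(1) _ int1]) (auto simp: gaussian_def g_int(2) G0
        scaleR_conv_of_real)
  \<comment> \<open>The gap in the tangent line inequality, formed with \<open>Re G\<close> because
    the Gaussian mean of \<open>Re G\<close> is known and that of \<open>norm G\<close> is
    not.\<close>
  define d where "d z = norm (G (cplx z)) powr p * ?g z - ?g z * (1 + p * (Re (G (cplx z))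
      - 1))" for z
  have int_re: "integrable lborel (\<lambda>z. ?g z * Re (G (cplx z)))"
    using integrable_Re[OF int1] by simp
  have re: "(LINT z|lborel. ?g z * Re (G (cplx z))) = pi / c"
    using integral_Re[OF int1] by (simp add: mean)
  have d_alt: "d z = norm (G (cplx z)) powr p * ?g z - (1 - p) * ?g z
      - p * (?g z * Re (G (cplx z)))" for z
    by (simp add: d_def algebra_simps)
  have int_d: "integrable lborel d" unfolding d_alt[abs_def] using int g_int int_re by auto
  have "(LINT z|lborel. d z) = (LINT z|lborel. norm (G (cplx z)) powr p * ?g z) - (1 - p) * (pi / c)
      - p * (pi / c)"
    unfolding d_alt[abs_def] using int g_int int_re by (simp add: re)
  moreover have "(1 - p) * (pi / c) + p * (pi / c) = pi / c"
      by (simp only: distrib_right[symmetric]) simp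
  ultimately have d_le: "(LINT z|lborel. d z) \<le> 0" using le by linarith
  \<comment> \<open>Bernoulli's inequality holds with \<open>norm G\<close> in place of
    \<open>Re G\<close>. The difference of the two survives as a lower bound for \<open>d\<close>,
    and this is what forces \<open>G\<close> to be real.\<close>
  have key: "?g z * (p * (norm (G (cplx z)) - Re (G (cplx z)))) \<le> d z" for z
  proof -
    have "?g z * (1 + p * (norm (G (cplx z)) - 1)) \<le> ?g z * norm (G (cplx z)) powr p"
      using pw g_pos[of z] by (intro mult_left_mono) auto
    then show ?thesis by (simp add: d_def algebra_simps)
  qed
  have re_le: "0 \<le> norm \<xi> - Re \<xi>" for \<xi> :: complex using complex_Re_le_cmod[of \<xi>] by simp
  have d_nonneg: "0 \<le> d z" for z
    using key[of z] mult_nonneg_nonneg[OF less_imp_le[OF g_pos[of z]] mult_nonneg_nonneg[OF _ re_le,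
        of p "G (cplx z)"]] p
    by simp
  have "(LINT z|lborel. d z) = 0"
    using d_le d_nonneg by (intro antisym integral_nonneg_AE) auto
  then have ae: "AE z in lborel. d z = 0" using integral_nonneg_eq_0_iff_AE[OF int_d] d_nonneg by
      auto
  define N where "N = {z. 0 < norm (G (cplx z)) - Re (G (cplx z))}"
  have "open N" unfolding N_def
    by (intro open_Collect_less continuous_intros continuous_on_norm continuous_on_Re G_cont)
  have "AE z in lborel. z \<notin> N"
    using ae
  proof eventually_elim
    case (elim z)
    then have "?g z * (p * (norm (G (cplx z)) - Re (G (cplx z)))) \<le> 0" using key[of z] by simp
    then show ?case using g_pos[of z] p by (auto simp: N_def mult_le_0_iff)
  qed
  then have "N \<in> null_sets lborel" using \<open>open N\<close> by (subst (asm) AE_iff_null_sets[symmetric]) auto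
  then have "negligible N" by (simp add: negligible_iff_null_sets null_sets_completionI)
  then have "N = {}" using open_not_negligible[OF \<open>open N\<close>] by blast
  have "Im (G \<xi>) = 0" for \<xi>
  proof -
    have \<xi>: "cplx (Re \<xi>, Im \<xi>) = \<xi>" by (simp add: cplx_def)
    have "(Re \<xi>, Im \<xi>) \<notin> N" using \<open>N = {}\<close> by simp
    then have "norm (G \<xi>) = Re (G \<xi>)" using re_le[of "G \<xi>"] by (simp add: N_def \<xi>)
    then have "(norm (G \<xi>))\<^sup>2 = (Re (G \<xi>))\<^sup>2" by simp
    then show ?thesis by (simp add: cmod_power2)
  qed
  then obtain k where k: "\<And>z. G z = k" using entire_real_valued_constant[OF G] by blast
  from k[of 0] k[of \<zeta>] G0 show ?thesis by simp
qed

text \<open>The bound \<open>s \<le> \<epsilon> + \<epsilon>^(1-p) s^p\<close> replaces Hoelder's inequality in passing from the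
  area mean value property to the local \<open>L^p\<close> norm.\<close>
lemma local_mean_bound:
  fixes p \<epsilon> :: real
  assumes p: "1 \<le> p" and H: "H holomorphic_on UNIV" and \<epsilon>: "0 < \<epsilon>"
    and int: "integrable lborel (\<lambda>z. indicator (ball 0 1) z * norm (H (cplx z)) powr p)"
  shows "norm (H 0) \<le> \<epsilon> + \<epsilon> powr (1 - p) * (LINT z|lborel. indicator (ball 0 1) z
      * norm (H (cplx z)) powr p)"
proof -
  let ?w = "indicator (ball 0 1) :: real \<times> real \<Rightarrow> real"
  have w_int: "integrable lborel ?w" and w: "(LINT z|lborel. ?w z) = pi"
    using emeasure_ball_plane[of 1 0] by (auto simp: integrable_indicator_iff)
  have H_cont: "continuous_on UNIV (\<lambda>z. H (cplx z))"
    by (intro continuous_on_compose2[OF holomorphic_on_imp_continuous_on[OF H]] continuous_intros)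
        auto
  have young: "s \<le> \<epsilon> + \<epsilon> powr (1 - p) * s powr p" if "0 \<le> s" for s
  proof (cases "s \<le> \<epsilon>")
    case False
    then have "s = s powr (1 - p) * s powr p" using \<epsilon> by (simp add: powr_add[symmetric])
    \<comment> \<open>The exponent \<open>1 - p\<close> is not positive, so replacing
      \<open>s\<close> by the smaller \<epsilon> can only increase the power.\<close>
    also have "\<dots> \<le> \<epsilon> powr (1 - p) * s powr p"
      using False \<epsilon> p by (intro mult_right_mono powr_mono2') auto
    finally show ?thesis using \<epsilon> by simp
  qed (simp add: add_increasing2)
  have int2: "integrable lborel (\<lambda>z. \<epsilon> * ?w z + \<epsilon> powr (1 - p) * (?w z * norm (H (cplx z)) powr p))"
    using w_int int by auto
  have le: "?w z * norm (H (cplx z)) \<le> \<epsilon> * ?w z + \<epsilon> powr (1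
      - p) * (?w z * norm (H (cplx z)) powr p)" for z
    using young[of "norm (H (cplx z))"] by (auto simp: indicator_def)
  have int1: "integrable lborel (\<lambda>z. ?w z *\<^sub>R H (cplx z))"
  proof (rule Bochner_Integration.integrable_bound[OF int2])
    have "(\<lambda>z. H (cplx z)) \<in> borel_measurable borel"
        by (rule borel_measurable_continuous_onI[OF H_cont])
    then show "(\<lambda>z. ?w z *\<^sub>R H (cplx z)) \<in> borel_measurable lborel"
      by (intro borel_measurable_scaleR borel_measurable_indicator) auto
    show "AE z in lborel. norm (?w z *\<^sub>R H (cplx z))
        \<le> norm (\<epsilon> * ?w z + \<epsilon> powr (1 - p) * (?w z * norm (H (cplx z)) powr p))"
      using le \<epsilon> by (auto simp: abs_mult intro!: AE_I2 order_trans[OF le abs_ge_self])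
  qed
  have "pi *\<^sub>R H 0 = (LINT z|lborel. ?w z *\<^sub>R H (cplx z))"
    by (subst radial_mean_value[OF H w_int _ int1], simp add: indicator_def, simp only: w)
  then have "pi * norm (H 0) = norm (LINT z|lborel. ?w z *\<^sub>R H (cplx z))"
    by (metis norm_scaleR abs_of_pos pi_gt_zero)
  also have "\<dots> \<le> (LINT z|lborel. norm (?w z *\<^sub>R H (cplx z)))" by (rule integral_norm_bound)
  also have "\<dots> \<le> (LINT z|lborel. \<epsilon> * ?w z + \<epsilon> powr (1 - p) * (?w z * norm (H (cplx z)) powr p))"
    using integrable_norm[OF int1] int2 le by (intro integral_mono) auto
  also have "\<dots> = pi * \<epsilon> + \<epsilon> powr (1 - p) * (LINT z|lborel. ?w z * norm (H (cplx z)) powr p)"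
    using w_int int w by simp
  \<comment> \<open>A factor \<open>pi\<close>, which is at least 1, is given away so that
    \<open>pi\<close> cancels in the end.\<close>
  also have "\<dots> \<le> pi * \<epsilon> + pi * (\<epsilon> powr (1 - p) * (LINT z|lborel. ?w z * norm (H (cplx z)) powr p))"
  proof (rule add_left_mono)
    have "0 \<le> \<epsilon> powr (1 - p) * (LINT z|lborel. ?w z * norm (H (cplx z)) powr p)"
      by (intro mult_nonneg_nonneg integral_nonneg_AE) auto
    then show "\<epsilon> powr (1 - p) * (LINT z|lborel. ?w z * norm (H (cplx z)) powr p)
        \<le> pi * (\<epsilon> powr (1 - p) * (LINT z|lborel. ?w z * norm (H (cplx z)) powr p))"
      using pi_ge_two mult_right_mono[of 1 pi "\<epsilon> powr (1
          - p) * (LINT z|lborel. ?w z * norm (H (cplx z)) powr p)"]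
      by simp
  qed
  finally have "pi * norm (H 0) \<le> pi * (\<epsilon> + \<epsilon> powr (1
      - p) * (LINT z|lborel. ?w z * norm (H (cplx z)) powr p))"
    by (simp add: distrib_left)
  then show ?thesis by simp
qed

section \<open>Concentration of weighted entire functions\<close>

text \<open>For the transform of a distribution \<open>c\<close> will be \<open>p * pi / 2\<close>,
  so that the decay constant \<open>pi / c\<close> is \<open>2 / p\<close>.\<close>

locale fock =
  fixes F :: "complex \<Rightarrow> complex" and p c :: real
  assumes F_hol: "F holomorphic_on UNIV" and p: "1 \<le> p" and c: "0 < c"
    and F_ne: "\<exists>\<zeta>. F \<zeta> \<noteq> 0"
    and u_int: "integrable lborel (\<lambda>z. norm (F (cplx z)) powr p * gaussian 1 c 0 z)"
begin

definition u :: "real \<times> real \<Rightarrow> real" where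
  "u z = norm (F (cplx z)) powr p * gaussian 1 c 0 z"

text \<open>The twisted translation that moves \<open>z0\<close> to the origin and preserves the weighted modulus.\<close>
definition shift :: "real \<times> real \<Rightarrow> complex \<Rightarrow> complex" where
  "shift z0 w = F (cplx z0 + w) * exp (- (of_real (2 * c / p) * cnj (cplx z0) * w)
      - of_real (c / p * (norm z0)\<^sup>2))"

lemma u_nonneg: "0 \<le> u z"
  by (simp add: u_def gaussian_def)

lemma F_cplx_cont: "continuous_on S (\<lambda>z. F (cplx z))"
  by (intro continuous_on_compose2[OF holomorphic_on_imp_continuous_on[OF F_hol]] continuous_intros)
      auto

lemma u_cont: "continuous_on UNIV u"
  unfolding u_def[abs_def] using p
  by (intro continuous_on_mult continuous_on_gaussian continuous_on_powr' continuous_on_norm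
      F_cplx_cont continuous_on_const) auto

lemma u_pos_iff: "0 < u z \<longleftrightarrow> F (cplx z) \<noteq> 0"
proof -
  have "0 < gaussian 1 c 0 z" by (simp add: gaussian_def)
  then show ?thesis by (cases "F (cplx z) = 0") (simp_all add: u_def)
qed

lemma u_int': "integrable lborel u"
  using u_int by (simp add: u_def[abs_def])

lemma shift_hol: "shift z0 holomorphic_on UNIV"
  unfolding shift_def[abs_def]
  by (intro holomorphic_intros holomorphic_on_compose_gen[of "\<lambda>w. cplx z0
      + w" UNIV F UNIV, unfolded o_def] F_hol) auto

text \<open>Expanding the square of \<open>norm (z0 + w)\<close> shows that the exponential factor
  of \<open>shift\<close>, in modulus and raised to the power \<open>p\<close>, is the quotient of
  the Gaussians at \<open>z0 + w\<close> and at \<open>w\<close>.\<close>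

lemma norm_shift: "norm (shift z0 (cplx w)) powr p * gaussian 1 c 0 w = u (z0 + w)"
proof -
  have sq: "(norm z)\<^sup>2 = (fst z)\<^sup>2 + (snd z)\<^sup>2" for z :: "real \<times> real"
    by (simp add: norm_prod_def)
  have n: "(norm (z0 + w))\<^sup>2 = (norm z0)\<^sup>2 + 2 * Re (cnj (cplx z0) * cplx w) + (norm w)\<^sup>2"
    unfolding sq by (simp add: cplx_def) (simp add: power2_eq_square algebra_simps)
  define X where "X = Re (cnj (cplx z0) * cplx w)"
  have g: "gaussian 1 c 0 (z0 + w) = exp (- c * ((norm z0)\<^sup>2 + 2 * X + (norm w)\<^sup>2))"
    by (simp only: gaussian_def diff_0_right n mult_1 X_def)
  have "norm (shift z0 (cplx w)) = norm (F (cplx (z0 + w))) * exp (- (2 * c / p) * X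
      - c / p * (norm z0)\<^sup>2)"
    by (simp add: shift_def norm_mult norm_exp_eq_Re cplx_add mult.assoc X_def)
  then have "norm (shift z0 (cplx w)) powr p
      = norm (F (cplx (z0 + w))) powr p * exp (p * (- (2 * c / p) * X - c / p * (norm z0)\<^sup>2))"
    by (simp add: powr_mult exp_powr_real mult.commute)
  also have "p * (- (2 * c / p) * X - c / p * (norm z0)\<^sup>2) = - c * (2 * X + (norm z0)\<^sup>2)"
    using p by (simp add: field_simps)
  finally show ?thesis
    unfolding u_def g by (simp add: gaussian_def mult.assoc exp_add[symmetric]) (simp add:
        algebra_simps)
qed

lemma norm_shift_0: "norm (shift z0 0) powr p = u z0"
proof -
  have "cplx 0 = 0" by (simp add: cplx_def complex_eq_iff)
  then show ?thesis using norm_shift[of z0 0] by (simp add: gaussian_def)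
qed

lemma translate:
  fixes f :: "real \<times> real \<Rightarrow> real"
  assumes "integrable lborel f"
  shows "integrable lborel (\<lambda>w. f (z0 + w))" "(LINT w|lborel. f (z0 + w)) = (LINT z|lborel. f z)"
proof -
  have d: "distr lborel borel ((+) z0) = lborel" by (rule lborel_distr_plus)
  have m: "f \<in> borel_measurable borel" using borel_measurable_integrable[OF assms] by simp
  have i: "integrable (distr lborel borel ((+) z0)) f" using assms by (simp only: d)
  show "integrable lborel (\<lambda>w. f (z0 + w))"
    using integrable_distr_eq[of "(+) z0" lborel borel f] m i by simp
  show "(LINT w|lborel. f (z0 + w)) = (LINT z|lborel. f z)"
    using integral_distr[of "(+) z0" lborel borel f] m d by simp
qed

text \<open>\<open>local_mean_bound\<close> for the recentred function. The Gaussian is at least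
  \<open>exp (- c)\<close> on the unit ball, whence the factor \<open>exp c\<close>; recentring
  makes the constants independent of \<open>z0\<close>.\<close>

lemma u_le_local:
  assumes \<epsilon>: "0 < \<epsilon>"
  shows "u z0 powr (1 / p) \<le> \<epsilon> + \<epsilon> powr (1 - p) * (exp c * (LINT z|lborel. indicator (ball z0 1) z
      * u z))"
proof -
  have ind: "indicator (ball 0 1) w = (indicator (ball z0 1) (z0 + w) :: real)" for w
    by (auto simp: indicator_def dist_norm)
  have int_b: "integrable lborel (\<lambda>z. indicator (ball z0 1) z * u z)"
    using integrable_mult_indicator[of "ball z0 1" lborel u] u_int' by simp
  have le: "indicator (ball 0 1) w * norm (shift z0 (cplx w)) powr p
      \<le> exp c * (indicator (ball z0 1) (z0 + w) * u (z0 + w))" for w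
  proof (cases "w \<in> ball 0 1")
    case True
    then have "(norm w)\<^sup>2 \<le> 1" by (simp add: abs_square_le_1)
    then have "1 \<le> exp c * gaussian 1 c 0 w" using c by (simp add: gaussian_def exp_add[symmetric])
    then have "norm (shift z0 (cplx w)) powr p * 1
        \<le> norm (shift z0 (cplx w)) powr p * (exp c * gaussian 1 c 0 w)"
      by (intro mult_left_mono) auto
    also have "\<dots> = exp c * u (z0 + w)" by (simp add: norm_shift[symmetric])
    finally show ?thesis using True by (simp add: ind[symmetric])
  qed (simp add: u_nonneg)
  have int_r: "integrable lborel (\<lambda>w. exp c * (indicator (ball z0 1) (z0 + w) * u (z0 + w)))"
    using translate(1)[OF int_b, of z0] by simp
  have int_l: "integrable lborel (\<lambda>w. indicator (ball 0 1) w * norm (shift z0 (cplx w)) powr p)"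
  proof (rule Bochner_Integration.integrable_bound[OF int_r])
    have "continuous_on UNIV (\<lambda>w. norm (shift z0 (cplx w)) powr p)"
      using p by (intro continuous_on_powr' continuous_on_norm continuous_on_const
        continuous_on_compose2[OF holomorphic_on_imp_continuous_on[OF shift_hol]] continuous_intros)
            auto
    from borel_measurable_continuous_onI[OF this]
    show "(\<lambda>w. indicator (ball 0 1) w * norm (shift z0 (cplx w)) powr p) \<in> borel_measurable lborel"
      by (intro borel_measurable_times borel_measurable_indicator) auto
    show "AE w in lborel. norm (indicator (ball 0 1) w * norm (shift z0 (cplx w)) powr p)
        \<le> norm (exp c * (indicator (ball z0 1) (z0 + w) * u (z0 + w)))"
    proof (intro AE_I2)
      fix w
      have "norm (indicator (ball 0 1) w * norm (shift z0 (cplx w)) powr p)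
          = indicator (ball 0 1) w * norm (shift z0 (cplx w)) powr p" by simp
      also note le[of w]
      also have "exp c * (indicator (ball z0 1) (z0 + w) * u (z0 + w))
          \<le> norm (exp c * (indicator (ball z0 1) (z0 + w) * u (z0 + w)))" by simp
      finally show "norm (indicator (ball 0 1) w * norm (shift z0 (cplx w)) powr p)
        \<le> norm (exp c * (indicator (ball z0 1) (z0 + w) * u (z0 + w)))" .
    qed
  qed
  have "u z0 powr (1 / p) = norm (shift z0 0)"
    using p by (simp add: norm_shift_0[symmetric] powr_powr)
  also have "\<dots> \<le> \<epsilon> + \<epsilon> powr (1 - p) * (LINT w|lborel. indicator (ball 0 1) w
      * norm (shift z0 (cplx w)) powr p)"
    by (rule local_mean_bound[OF p shift_hol \<epsilon> int_l])
  also have "(LINT w|lborel. indicator (ball 0 1) w * norm (shift z0 (cplx w)) powr p)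
      \<le> (LINT w|lborel. exp c * (indicator (ball z0 1) (z0 + w) * u (z0 + w)))"
    by (intro integral_mono int_l int_r le)
  also have "\<dots> = exp c * (LINT z|lborel. indicator (ball z0 1) z * u z)"
    using translate(2)[OF int_b, of z0] by simp
  finally show ?thesis by (simp add: mult_left_mono)
qed

text \<open>An integrable \<open>u\<close> has little mass far out, and \<open>u_le_local\<close>
  converts small mass on unit balls into small values.\<close>

lemma u_vanishing:
  assumes t: "0 < t"
  shows "\<exists>R. \<forall>x y. t \<le> u (x, y) \<longrightarrow> \<bar>x\<bar> < R \<and> \<bar>y\<bar> < R"
proof -
  \<comment> \<open>Half of the target, since \<open>u_le_local\<close> contributes \<epsilon>
    twice: once directly and once through the small mass.\<close>
  define \<epsilon> where "\<epsilon> = t powr (1 / p) / 2"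
  have \<epsilon>: "0 < \<epsilon>" using t by (simp add: \<epsilon>_def)
  define A where "A = \<epsilon> powr (1 - p) * exp c"
  have A: "0 < A" using \<epsilon> by (simp add: A_def)
  have "(\<lambda>n. LINT z|lborel. indicator {z. real n < norm z} z * u z)
      \<longlonglongrightarrow> (LINT z|(lborel :: (real \<times> real) measure). 0)"
  proof (rule integral_dominated_convergence[where w = u])
    have m: "u \<in> borel_measurable borel" by (rule borel_measurable_continuous_onI[OF u_cont])
    have "open {z :: real \<times> real. real n < norm z}" for n
      by (intro open_Collect_less continuous_intros)
    then show "(\<lambda>z. indicator {z. real n < norm z} z * u z) \<in> borel_measurable lborel" for n
      using m by (intro borel_measurable_times borel_measurable_indicator) auto
    show "AE z in lborel. (\<lambda>n. indicator {z. real n < norm z} z * u z) \<longlonglongrightarrow> 0"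
    proof (intro AE_I2 tendsto_eventually)
      fix z :: "real \<times> real"
      obtain n0 :: nat where "norm z < real n0" using reals_Archimedean2 by blast
      then show "\<forall>\<^sub>F n in sequentially. indicator {z. real n < norm z} z * u z = 0"
        by (intro eventually_sequentiallyI[of n0]) auto
    qed
    show "AE z in lborel. norm (indicator {z. real n < norm z} z * u z) \<le> u z" for n
      using u_nonneg by (auto simp: indicator_def)
  qed (use u_int' in auto)
  then have "(\<lambda>n. LINT z|lborel. indicator {z. real n < norm z} z * u z) \<longlonglongrightarrow> 0" by simp
  then have "\<forall>\<^sub>F n in sequentially. (LINT z|lborel. indicator {z. real n < norm z} z * u z) < \<epsilon> / A"
    by (rule order_tendstoD) (use \<epsilon> A in simp)
  then obtain n where n: "(LINT z|lborel. indicator {z. real n < norm z} z * u z) < \<epsilon> / A"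
    by (auto simp: eventually_sequentially)
  have small: "u z0 < t" if z0: "real n + 1 \<le> norm z0" for z0
  proof -
    have "(LINT z|lborel. indicator (ball z0 1) z * u z)
        \<le> (LINT z|lborel. indicator {z. real n < norm z} z * u z)"
    proof (intro integral_mono)
      show "integrable lborel (\<lambda>z. indicator (ball z0 1) z * u z)"
        using integrable_mult_indicator[of "ball z0 1" lborel u] u_int' by simp
      have "open {z :: real \<times> real. real n < norm z}" by (intro open_Collect_less continuous_intros)
      then show "integrable lborel (\<lambda>z. indicator {z. real n < norm z} z * u z)"
        using integrable_mult_indicator[of "{z. real n < norm z}" lborel u] u_int' by simp
      fix z
      have "real n < norm z" if "z \<in> ball z0 1"
        using that z0 norm_triangle_ineq2[of z0 z] by (simp add: dist_norm)
      then show "indicator (ball z0 1) z * u z \<le> indicator {z. real n < norm z} z * u z"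
        using u_nonneg[of z] by (auto simp: indicator_def)
    qed
    then have "(LINT z|lborel. indicator (ball z0 1) z * u z) < \<epsilon> / A" using n by simp
    then have "A * (LINT z|lborel. indicator (ball z0 1) z * u z) < \<epsilon>" using A
        by (simp add: field_simps)
    then have "u z0 powr (1 / p) < \<epsilon> + \<epsilon>" using u_le_local[OF \<epsilon>, of z0]
        by (simp add: A_def mult.assoc)
    then have "u z0 powr (1 / p) < t powr (1 / p)" by (simp add: \<epsilon>_def)
    then show ?thesis using powr_mono2[of "1 / p" t "u z0"] p t
        by (meson divide_nonneg_nonneg not_le order_trans zero_le_one less_imp_le)
  qed
  show ?thesis
  proof (intro exI[of _ "real n + 1"] allI impI)
    fix x y assume "t \<le> u (x, y)"
    then have "norm (x, y) < real n + 1" using small[of "(x, y)"] by force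
    then show "\<bar>x\<bar> < real n + 1 \<and> \<bar>y\<bar> < real n + 1"
      using norm_fst_le[of x y] norm_snd_le[of y x] by simp
  qed
qed

text \<open>The logarithmic derivative of \<open>F\<close>. The partial derivatives of
  \<open>ln (norm F)\<close> are \<open>Re L\<close> and \<open>- Im L\<close>, and
  \<open>L'\<close> is the complex derivative of \<open>L\<close> off the zeros.\<close>

definition L :: "complex \<Rightarrow> complex" where "L \<zeta> = deriv F \<zeta> / F \<zeta>"
definition L' :: "complex \<Rightarrow> complex" where "L' \<zeta>
    = (deriv (deriv F) \<zeta> * F \<zeta> - deriv F \<zeta> * deriv F \<zeta>) / (F \<zeta> * F \<zeta>)"

lemma F_deriv: "(F has_field_derivative deriv F \<zeta>) (at \<zeta>)"
  using holomorphic_derivI[OF F_hol, of \<zeta>] by simp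

lemma deriv_F_hol: "deriv F holomorphic_on UNIV"
  by (rule holomorphic_deriv[OF F_hol]) simp

lemma L_deriv: "F \<zeta> \<noteq> 0 \<Longrightarrow> (L has_field_derivative L' \<zeta>) (at \<zeta>)"
  unfolding L_def[abs_def] L'_def
  using DERIV_divide[OF holomorphic_derivI[OF deriv_F_hol open_UNIV UNIV_I] F_deriv] .

text \<open>Writing \<open>ln (norm F)\<close> as half the logarithm of the sum of the squares of
  real and imaginary part avoids a branch of the complex logarithm. The curve \<open>g\<close> is
  used for horizontal and vertical lines.\<close>

lemma ln_norm_deriv:
  assumes ne: "F \<zeta> \<noteq> 0" and g: "(g has_vector_derivative d) (at t)" "g t = \<zeta>"
  shows "((\<lambda>t. ln (norm (F (g t)))) has_real_derivative Re (d * L \<zeta>)) (at t)"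
proof -
  have v: "((\<lambda>t. F (g t)) has_vector_derivative (d * deriv F \<zeta>)) (at t)"
    using field_vector_diff_chain_at[OF g(1), of F "deriv F \<zeta>"] F_deriv g(2) by (simp add: o_def)
  have re: "((\<lambda>t. Re (F (g t))) has_real_derivative Re (d * deriv F \<zeta>)) (at t)"
    using bounded_linear.has_vector_derivative[OF bounded_linear_Re v]
    by (simp add: has_real_derivative_iff_has_vector_derivative)
  have im: "((\<lambda>t. Im (F (g t))) has_real_derivative Im (d * deriv F \<zeta>)) (at t)"
    using bounded_linear.has_vector_derivative[OF bounded_linear_Im v]
    by (simp add: has_real_derivative_iff_has_vector_derivative)
  define n where "n = (norm (F \<zeta>))\<^sup>2"
  have n: "0 < n" using ne by (simp add: n_def)
  have sq: "((\<lambda>t. (Re (F (g t)))\<^sup>2 + (Im (F (g t)))\<^sup>2) has_real_derivative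
      (2 * Re (F \<zeta>) * Re (d * deriv F \<zeta>) + 2 * Im (F \<zeta>) * Im (d * deriv F \<zeta>))) (at t)"
    by (rule DERIV_cong[OF DERIV_add[OF DERIV_power[OF re, of 2] DERIV_power[OF im, of 2]]]) (simp
        add: g(2))
  have "((\<lambda>t. ln ((Re (F (g t)))\<^sup>2 + (Im (F (g t)))\<^sup>2) / 2) has_real_derivative
      (2 * Re (F \<zeta>) * Re (d * deriv F \<zeta>) + 2 * Im (F \<zeta>) * Im (d * deriv F \<zeta>)) / n / 2) (at t)"
    using n g(2) DERIV_cdivide[OF DERIV_chain2[OF DERIV_ln_divide sq], of 2]
        by (simp add: n_def cmod_power2)
  moreover have "(2 * Re (F \<zeta>) * Re (d * deriv F \<zeta>) + 2 * Im (F \<zeta>) * Im (d * deriv F \<zeta>)) / n / 2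
      = Re (d * L \<zeta>)"
  proof -
    \<comment> \<open>Multiplying numerator and denominator by \<open>cnj (F \<zeta>)\<close> makes
      the denominator the real number \<open>n\<close>.\<close>
    have "d * L \<zeta> = d * deriv F \<zeta> * cnj (F \<zeta>) / of_real n"
      using ne by (simp add: L_def n_def complex_norm_square divide_simps del: of_real_power)
    then have "Re (d * L \<zeta>) = Re (d * deriv F \<zeta> * cnj (F \<zeta>)) / n" by (simp only: Re_divide_of_real)
    then show ?thesis by (simp add: algebra_simps add_divide_distrib diff_divide_distrib)
  qed
  moreover have "ln ((Re (F (g t)))\<^sup>2 + (Im (F (g t)))\<^sup>2) / 2 = ln (norm (F (g t)))" for t
  proof -
    have "(Re (F (g t)))\<^sup>2 + (Im (F (g t)))\<^sup>2 = (norm (F (g t)))\<^sup>2" by (simp add: cmod_power2)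
    then show ?thesis by (cases "F (g t) = 0") (simp_all add: ln_realpow)
  qed
  ultimately show ?thesis by simp
qed

lemma cplx_deriv_x: "((\<lambda>x. cplx (x, y)) has_vector_derivative 1) (at x)"
proof -
  have eq: "cplx (x, y) = of_real x + of_real y * \<i>" for x by (simp add: cplx_def complex_eq_iff)
  show ?thesis unfolding eq
    using has_vector_derivative_add[OF has_vector_derivative_of_real[OF DERIV_ident, of "at x"]
        has_vector_derivative_const]
    by simp
qed

lemma cplx_deriv_y: "((\<lambda>y. cplx (x, y)) has_vector_derivative \<i>) (at y)"
proof -
  have eq: "cplx (x, y) = of_real x + of_real y * \<i>" for y by (simp add: cplx_def complex_eq_iff)
  show ?thesis unfolding eq
    using has_vector_derivative_add[OF has_vector_derivative_const
        has_vector_derivative_mult_left[OF has_vector_derivative_of_real[OF DERIV_ident, of "at y"],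
        of \<i>]]
    by simp
qed

definition vx where "vx z = p * Re (L (cplx z)) - 2 * c * fst z"
definition vy where "vy z = - p * Im (L (cplx z)) - 2 * c * snd z"
definition vxx where "vxx z = p * Re (L' (cplx z)) - 2 * c"
definition vyy where "vyy z = - p * Re (L' (cplx z)) - 2 * c"

lemma ln_u: "0 < u z \<Longrightarrow> ln (u z) = p * ln (norm (F (cplx z))) - c * ((fst z)\<^sup>2 + (snd z)\<^sup>2)"
  unfolding u_pos_iff by (cases z) (simp add: u_def gaussian_def ln_mult ln_powr norm_Pair)

lemma L_cont: "continuous_on {z. 0 < u z} (\<lambda>z. L (cplx z))" "continuous_on {z. 0 < u z} (\<lambda>z. L'
    (cplx z))"
proof -
  have d: "continuous_on {z. 0 < u z} (\<lambda>z. deriv F (cplx z))" "continuous_on {z. 0 < u z} (\<lambda>z. deriv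
      (deriv F) (cplx z))"
    by (intro continuous_on_compose2[OF holomorphic_on_imp_continuous_on[OF deriv_F_hol]]
        continuous_on_compose2[OF holomorphic_on_imp_continuous_on[OF holomorphic_deriv[OF
            deriv_F_hol open_UNIV]]]
        continuous_on_cplx subset_UNIV)+
  show "continuous_on {z. 0 < u z} (\<lambda>z. L (cplx z))" "continuous_on {z. 0 < u z} (\<lambda>z. L' (cplx z))"
    unfolding L_def L'_def by (intro continuous_intros d F_cplx_cont; simp add: u_pos_iff)+
qed

sublocale log_superharmonic u vx vy vxx vyy "4 * c"
proof
  show "continuous_on UNIV u" by (rule u_cont)
  show "0 \<le> u z" for z by (rule u_nonneg)
  have op: "open {x. 0 < u (x, y)}" "open {y. 0 < u (x, y)}" for x y
    by (intro open_Collect_less continuous_on_compose2[OF u_cont] continuous_intros; simp)+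
  show "((\<lambda>x. ln (u (x, y))) has_real_derivative vx (x, y)) (at x)" if "0 < u (x, y)" for x y
  proof -
    have "((\<lambda>x. p * ln (norm (F (cplx (x, y)))) - c * (x\<^sup>2 + y\<^sup>2))
        has_real_derivative vx (x, y)) (at x)"
    proof -
      have "((\<lambda>x. c * (x\<^sup>2 + y\<^sup>2)) has_real_derivative 2 * c * x) (at x)"
        by (auto intro!: derivative_eq_intros)
      from DERIV_diff[OF DERIV_cmult[OF ln_norm_deriv[OF _ cplx_deriv_x refl], of x y p] this] that
      show ?thesis by (simp add: u_pos_iff vx_def)
    qed
    then show ?thesis
      by (rule has_field_derivative_transform_within_open[OF _ op(1)]) (use that ln_u in auto)
  qed
  show "((\<lambda>y. ln (u (x, y))) has_real_derivative vy (x, y)) (at y)" if "0 < u (x, y)" for x y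
  proof -
    have "((\<lambda>y. p * ln (norm (F (cplx (x, y)))) - c * (x\<^sup>2 + y\<^sup>2))
        has_real_derivative vy (x, y)) (at y)"
    proof -
      have "((\<lambda>y. c * (x\<^sup>2 + y\<^sup>2)) has_real_derivative 2 * c * y) (at y)"
        by (auto intro!: derivative_eq_intros)
      from DERIV_diff[OF DERIV_cmult[OF ln_norm_deriv[OF _ cplx_deriv_y refl], of x y p] this] that
      show ?thesis by (simp add: u_pos_iff vy_def)
    qed
    then show ?thesis
      by (rule has_field_derivative_transform_within_open[OF _ op(2)]) (use that ln_u in auto)
  qed
  show "((\<lambda>x. vx (x, y)) has_real_derivative vxx (x, y)) (at x)" if "0 < u (x, y)" for x y
  proof -
    have "((\<lambda>x. L (cplx (x, y))) has_vector_derivative L' (cplx (x, y))) (at x)"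
      using field_vector_diff_chain_at[OF cplx_deriv_x L_deriv, of x y] that
          by (simp add: o_def u_pos_iff)
    from bounded_linear.has_vector_derivative[OF bounded_linear_Re this]
    have "((\<lambda>x. Re (L (cplx (x, y)))) has_real_derivative Re (L' (cplx (x, y)))) (at x)"
      by (simp add: has_real_derivative_iff_has_vector_derivative)
    from DERIV_diff[OF DERIV_cmult[OF this, of p] DERIV_cmult[OF DERIV_ident, of "2 * c"]]
    show ?thesis by (simp add: vx_def vxx_def)
  qed
  show "((\<lambda>y. vy (x, y)) has_real_derivative vyy (x, y)) (at y)" if "0 < u (x, y)" for x y
  proof -
    have "((\<lambda>y. L (cplx (x, y))) has_vector_derivative \<i> * L' (cplx (x, y))) (at y)"
      using field_vector_diff_chain_at[OF cplx_deriv_y L_deriv, of x y] that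
          by (simp add: o_def u_pos_iff)
    from bounded_linear.has_vector_derivative[OF bounded_linear_Im this]
    have "((\<lambda>y. Im (L (cplx (x, y)))) has_real_derivative Re (L' (cplx (x, y)))) (at y)"
      by (simp add: has_real_derivative_iff_has_vector_derivative)
    from DERIV_diff[OF DERIV_cmult[OF this, of "- p"] DERIV_cmult[OF DERIV_ident, of "2 * c"]]
    show ?thesis by (simp add: vy_def vyy_def)
  qed
  show "continuous_on {z. 0 < u z} vx" "continuous_on {z. 0 < u z} vy"
      "continuous_on {z. 0 < u z} vxx" "continuous_on {z. 0 < u z} vyy"
    unfolding vx_def[abs_def] vy_def[abs_def] vxx_def[abs_def] vyy_def[abs_def]
    by (intro continuous_intros L_cont)+
  \<comment> \<open>The contributions of the harmonic function \<open>ln (norm F)\<close> cancel;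
    each direction of the Gaussian exponent leaves \<open>- 2 * c\<close>.\<close>
  show "vxx z + vyy z = - (4 * c)" for z by (simp add: vxx_def vyy_def)
  show "0 < 4 * c" using c by simp
  show "\<exists>R. \<forall>x y. t \<le> u (x, y) \<longrightarrow> \<bar>x\<bar> < R \<and> \<bar>y\<bar> < R" if "0 < t" for t by (rule u_vanishing[OF that])
qed

lemma u_ne: "\<exists>z. u z \<noteq> 0"
proof -
  obtain \<zeta> where "F \<zeta> \<noteq> 0" using F_ne by blast
  moreover have "cplx (Re \<zeta>, Im \<zeta>) = \<zeta>" by (simp add: cplx_def)
  ultimately have "0 < u (Re \<zeta>, Im \<zeta>)" by (simp add: u_pos_iff)
  then show ?thesis by (metis less_irrefl)
qed

lemma decay: "0 < s \<Longrightarrow> s < t \<Longrightarrow> 0 < measure lborel {z. t < u z} \<Longrightarrow>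
    pi / c * (ln t - ln s) \<le> measure lborel {z. s < u z} - measure lborel {z. t < u z}"
  using superlevel_decay[of s t] by simp

lemma u_integral_pos: "0 < (LINT z|lborel. u z)"
proof -
  have "(LINT z|lborel. u z) \<noteq> 0"
  proof
    assume "(LINT z|lborel. u z) = 0"
    then have "AE z in lborel. u z = 0" using integral_nonneg_eq_0_iff_AE[OF u_int'] u_nonneg by
        auto
    then have "AE z in lborel. z \<notin> {z. 0 < u z}" by eventually_elim simp
    then have "{z. 0 < u z} \<in> null_sets lborel"
      using open_superlevel[of 0] by (subst AE_iff_null_sets) auto
    then have "negligible {z. 0 < u z}" by (simp add: negligible_iff_null_sets
        null_sets_completionI)
    then have "{z. 0 < u z} = {}" using open_not_negligible[OF open_superlevel[of 0]] by blast
    then show False using u_ne u_nonneg by (metis (mono_tags, lifting) Collect_empty_eq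
        less_eq_real_def)
  qed
  moreover have "0 \<le> (LINT z|lborel. u z)" by (intro integral_nonneg_AE) (simp add: u_nonneg)
  ultimately show ?thesis by simp
qed

theorem concentration_le:
  assumes "\<Omega> \<in> lmeasurable" "0 < measure lebesgue \<Omega>"
  shows "(LINT z:\<Omega>|lebesgue. u z) \<le> (1 - exp (- measure lebesgue \<Omega> / (pi / c)))
      * (LINT z|lborel. u z)"
proof -
  obtain z0 where "u z0 \<noteq> 0" using u_ne by blast
  with c show ?thesis
    by (intro rearrangement_bound(1)[OF u_cont u_nonneg u_int' _ _ decay assms]) auto
qed

text \<open>The set \<open>{z. T / 2 \<le> u z}\<close> is compact and contains all points with
  values near the supremum.\<close>

lemma u_attains:
  assumes T: "0 < T" "\<And>z. u z \<le> T" "\<And>t. t < T \<Longrightarrow> \<exists>z. t < u z"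
  shows "\<exists>z0. u z0 = T"
proof -
  define K where "K = {z. T / 2 \<le> u z}"
  have "closed K" unfolding K_def by (intro closed_Collect_le continuous_intros u_cont)
  moreover have "bounded K"
  proof -
    obtain R where R: "\<And>x y. T / 2 \<le> u (x, y) \<Longrightarrow> \<bar>x\<bar> < R \<and> \<bar>y\<bar> < R"
        using u_vanishing[of "T / 2"] T by auto
    have "K \<subseteq> cbox (-R, -R) (R, R)"
    proof
      fix z assume "z \<in> K"
      then show "z \<in> cbox (-R, -R) (R, R)" using R[of "fst z" "snd z"]
          by (cases z) (auto simp: K_def cbox_Pair_eq)
    qed
    then show ?thesis by (meson bounded_cbox bounded_subset)
  qed
  moreover have "K \<noteq> {}" using T(3)[of "T / 2"] T(1) by (auto simp: K_def intro: less_imp_le)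
  ultimately obtain z0 where z0: "z0 \<in> K" "\<And>z. z \<in> K \<Longrightarrow> u z \<le> u z0"
    using continuous_attains_sup[of K u] continuous_on_subset[OF u_cont]
        by (auto simp: compact_eq_bounded_closed)
  have "u z0 = T"
  proof (rule ccontr)
    assume "u z0 \<noteq> T"
    then have "u z0 < T" using T(2)[of z0] by simp
    then obtain z where z: "u z0 < u z" using T(3) by blast
    moreover have "z \<in> K" using z z0(1) by (simp add: K_def)
    ultimately show False using z0(2)[of z] by simp
  qed
  then show ?thesis by blast
qed

theorem concentration_eq:
  assumes Om: "\<Omega> \<in> lmeasurable" "0 < measure lebesgue \<Omega>"
    and eq: "(LINT z:\<Omega>|lebesgue. u z) = (1 - exp (- measure lebesgue \<Omega> / (pi / c)))
        * (LINT z|lborel. u z)"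
  shows "\<exists>z0 r. 0 < r \<and> sym_diff \<Omega> (ball z0 r) \<in> null_sets lebesgue \<and> F (cplx z0) \<noteq> 0 \<and>
    (\<forall>w. F (cplx z0 + w) = F (cplx z0) * exp (of_real (2 * c / p) * cnj (cplx z0) * w))"
proof -
  obtain z1 where z1: "u z1 \<noteq> 0" using u_ne by blast
  have k: "0 < pi / c" using c by simp
  obtain \<tau> T where \<tau>: "0 < \<tau>" "\<tau> < T" and J: "(LINT z|lborel. u z) = pi / c * T"
    and le: "\<And>z. u z \<le> T" and sup: "\<And>t. t < T \<Longrightarrow> \<exists>z. t < u z"
    and ae: "AE z in lebesgue. (z \<in> \<Omega> \<longrightarrow> \<tau> \<le> u z) \<and> (z \<notin> \<Omega> \<longrightarrow> u z \<le> \<tau>)"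
    using rearrangement_bound(2)[OF u_cont u_nonneg u_int' z1 k decay Om eq] by blast
  obtain z0 where z0: "u z0 = T" using u_attains[OF _ le sup] \<tau> by auto
  define H0 where "H0 = shift z0 0"
  have H0: "norm H0 powr p = T" using norm_shift_0[of z0] z0 by (simp add: H0_def)
  then have "H0 \<noteq> 0" using \<tau> by auto
  \<comment> \<open>Normalised at the maximum point: \<open>G 0 = 1\<close>, and the Gaussian
    integral of \<open>norm G powr p\<close> is the integral of \<open>u\<close> divided by
    \<open>T\<close>, which is exactly the extremal value \<open>pi / c\<close>.\<close>
  define G where "G w = shift z0 w / H0" for w
  have G_u: "norm (G (cplx w)) powr p * gaussian 1 c 0 w = u (z0 + w) / T" for w
    unfolding norm_shift[symmetric] H0[symmetric] by (simp add: G_def norm_divide powr_divide)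
  have G1: "G \<zeta> = 1" for \<zeta>
  proof (rule extremal_constant[where G = G, OF p _ _ _ c])
    show "G holomorphic_on UNIV" unfolding G_def[abs_def] using \<open>H0 \<noteq> 0\<close>
        by (intro holomorphic_intros shift_hol) auto
    show "G 0 = 1" using \<open>H0 \<noteq> 0\<close> by (simp add: G_def H0_def)
    show "integrable lborel (\<lambda>z. norm (G (cplx z)) powr p * gaussian 1 c 0 z)"
      unfolding G_u using translate(1)[OF u_int'] by simp
    show "(LINT z|lborel. norm (G (cplx z)) powr p * gaussian 1 c 0 z) \<le> pi / c"
      unfolding G_u using translate(2)[OF u_int', of z0] \<tau> by (simp add: J)
  qed
  have u_eq: "u z = gaussian T c z0 z" for z
    using G_u[of "z - z0"] \<tau> by (simp add: G1 gaussian_def field_simps)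
  have F_eq: "F (cplx z0 + w) = F (cplx z0) * exp (of_real (2 * c / p) * cnj (cplx z0) * w)" for w
  proof -
    define e where "e = exp (- of_real (c / p * (norm z0)\<^sup>2) :: complex)"
    have "shift z0 w = shift z0 0" using G1[of w] \<open>H0 \<noteq> 0\<close> by (simp add: G_def H0_def)
    then have "F (cplx z0 + w) * exp (- (of_real (2 * c / p) * cnj (cplx z0) * w)) * e
        = F (cplx z0) * e"
      unfolding shift_def e_def mult.assoc exp_add[symmetric] by simp
    then have "F (cplx z0 + w) * exp (- (of_real (2 * c / p) * cnj (cplx z0) * w)) = F (cplx z0)"
      by (simp add: e_def)
    then show ?thesis by (simp add: exp_minus field_simps)
  qed
  define r where "r = sqrt ((ln T - ln \<tau>) / c)"
  have r: "0 < r" using \<tau> c by (simp add: r_def)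
  have ball: "z \<in> ball z0 r \<longleftrightarrow> \<tau> < u z" for z
    using gaussian_superlevel[OF c _ \<tau>(1) \<tau>(2), of z0] \<tau> by (auto simp: r_def u_eq)
  \<comment> \<open>Inside \<Omega> only \<open>\<tau> \<le> u z\<close> is known and outside only
    \<open>u z \<le> \<tau>\<close>. The ambiguous points lie on a circle, which is a null
    set.\<close>
  have level: "z \<in> sphere z0 r" if "u z = \<tau>" for z
  proof -
    have "ln \<tau> = ln T - c * (norm (z - z0))\<^sup>2"
      using that \<tau> by (auto simp: u_eq gaussian_def ln_mult)
    then have "(norm (z - z0))\<^sup>2 = r\<^sup>2" using \<tau> c by (simp add: r_def field_simps)
    then have "norm (z - z0) = r" using r by (simp add: power2_eq_iff_nonneg)
    then show ?thesis by (simp add: dist_norm norm_minus_commute)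
  qed
  have "AE z in lebesgue. z \<notin> sphere z0 r"
    using negligible_sphere[of z0 r] unfolding negligible_iff_null_sets by (rule AE_not_in)
  with ae have "AE z in lebesgue. z \<notin> sym_diff \<Omega> (ball z0 r)"
  proof eventually_elim
    case (elim z)
    then show ?case using ball[of z] level[of z] by force
  qed
  moreover have "sym_diff \<Omega> (ball z0 r) \<in> sets lebesgue"
    using fmeasurableD[OF Om(1)] fmeasurableD[OF lmeasurable_ball[of z0 r]] by blast
  ultimately have "sym_diff \<Omega> (ball z0 r) \<in> null_sets lebesgue"
    by (simp add: AE_iff_null_sets)
  moreover have "F (cplx z0) \<noteq> 0" using z0 \<tau> u_pos_iff[of z0] by simp
  ultimately show ?thesis using r F_eq by blast
qed

end

theorem gaussian_concentration:
  fixes c T r :: real and z0 :: "real \<times> real"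
  assumes c: "0 < c" and T: "0 < T" and r: "0 < r" and Om: "\<Omega> \<in> lmeasurable"
    and sd: "sym_diff \<Omega> (ball z0 r) \<in> null_sets lebesgue"
  shows "(LINT z:\<Omega>|lebesgue. gaussian T c z0 z)
      = (1 - exp (- measure lebesgue \<Omega> / (pi / c))) * (LINT z|lborel. gaussian T c z0 z)"
proof -
  let ?g = "gaussian T c z0"
  \<comment> \<open>The value on the boundary circle. The ball becomes a superlevel set, and its
    integral splits into the mass above \<open>s\<close> and \<open>s\<close> times the
    area.\<close>
  define s where "s = T * exp (- c * r\<^sup>2)"
  have "0 < c * r\<^sup>2" using c r by simp
  then have s: "0 < s" "s < T" using T by (auto simp: s_def)
  have ln_s: "ln s = ln T - c * r\<^sup>2" using T by (simp add: s_def ln_mult)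
  have ball: "{z. s < ?g z} = ball z0 r"
    using gaussian_superlevel[OF c T s] c r by (simp add: ln_s)
  have ae: "AE z in lebesgue. (z \<in> \<Omega>) = (z \<in> ball z0 r)"
    using AE_not_in[OF sd] by eventually_elim auto
  have meas: "measure lebesgue \<Omega> = pi * r\<^sup>2"
  proof -
    have "measure lebesgue \<Omega> = measure lebesgue (ball z0 r)"
      using ae Om by (intro measure_eq_AE) (auto simp: fmeasurable_def)
    then show ?thesis using emeasure_ball_plane(2)[of r z0] r by simp
  qed
  have g_int: "integrable lborel ?g" "(LINT z|lborel. ?g z) = pi / c * T"
    using gaussian_integral[OF c T] by auto
  have m: "?g \<in> borel_measurable lebesgue" "?g \<in> borel_measurable borel"
    using borel_measurable_integrable[OF g_int(1)] by (auto intro: measurable_completion)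
  have "(LINT z:\<Omega>|lebesgue. ?g z) = (LINT z|lebesgue. indicator (ball z0 r) z * ?g z)"
    unfolding set_lebesgue_integral_def
  proof (rule integral_cong_AE)
    show "(\<lambda>z. indicat_real \<Omega> z *\<^sub>R ?g z) \<in> borel_measurable lebesgue"
      using m Om by (intro borel_measurable_scaleR borel_measurable_indicator) (auto simp:
          fmeasurable_def)
    show "(\<lambda>z. indicat_real (ball z0 r) z * ?g z) \<in> borel_measurable lebesgue"
      using m by (intro borel_measurable_times borel_measurable_indicator) auto
    show "AE z in lebesgue. indicat_real \<Omega> z *\<^sub>R ?g z = indicat_real (ball z0 r) z * ?g z"
      using ae by eventually_elim (simp add: indicator_def)
  qed
  also have "\<dots> = (LINT z|lborel. indicator (ball z0 r) z * ?g z)"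
    using m by (intro integral_completion borel_measurable_times borel_measurable_indicator) auto
  also have "\<dots> = (LINT z|lborel. max 0 (?g z - s) + s * indicator (ball z0 r) z)"
  proof (intro Bochner_Integration.integral_cong refl)
    fix z
    have "z \<in> ball z0 r \<longleftrightarrow> s < ?g z" using ball by blast
    then show "indicator (ball z0 r) z * ?g z = max 0 (?g z - s) + s * indicator (ball z0 r) z"
      by (cases "z \<in> ball z0 r") (simp_all del: mem_ball)
  qed
  also have "\<dots> = (LINT z|lborel. max 0 (?g z - s)) + s * measure lborel (ball z0 r)"
  proof -
    have i1: "integrable lborel (\<lambda>z. max 0 (?g z - s))"
      by (rule Bochner_Integration.integrable_bound[OF g_int(1)]) (use m s T in \<open>auto simp: max_def
          gaussian_def\<close>)
    have "emeasure lborel (ball z0 r) < \<infinity>" using emeasure_ball_plane(1)[of r z0] r by simp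
    then have i2: "integrable lborel (\<lambda>z. indicator (ball z0 r) z :: real)"
        by (simp add: integrable_indicator_iff)
    show ?thesis using i1 i2 by simp
  qed
  also have "\<dots> = pi / c * (T - log_primitive T s) + s * (pi * r\<^sup>2)"
    using gaussian_integral(3)[OF c T, of s z0] s r emeasure_ball_plane(2)[of r z0] by simp
  also have "\<dots> = pi / c * (T - s)"
  proof -
    have "log_primitive T s = s * (c * r\<^sup>2) + s" by (simp add: log_primitive_def ln_s algebra_simps)
    then show ?thesis using c by (simp add: field_simps)
  qed
  also have "\<dots> = (1 - exp (- c * r\<^sup>2)) * (pi / c * T)"
      by (simp add: s_def algebra_simps diff_divide_distrib)
  also have "- c * r\<^sup>2 = - measure lebesgue \<Omega> / (pi / c)" using c by (simp add: meas)
  finally show ?thesis by (simp add: g_int(2))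
qed

section \<open>Tempered distributions tested on Gaussians\<close>

lemma iter_deriv_0: "iter_deriv 0 g = g"
  by (simp add: iter_deriv_def)

lemma iter_deriv_Suc: "iter_deriv (Suc k) g x = vector_derivative (iter_deriv k g) (at x)"
  by (simp add: iter_deriv_def)

text \<open>Guessing the whole tower of derivatives at once replaces computations with
  \<open>vector_derivative\<close>; it is applied to linear combinations, Gaussians, convolutions
  and translates.\<close>

lemma iter_deriv_eqI:
  assumes "\<And>k x. (D k has_vector_derivative D (Suc k) x) (at x)"
  shows "iter_deriv k (D 0) = D k"
proof (induction k)
  case (Suc k)
  show ?case
    using vector_derivative_at[OF assms] by (auto simp: fun_eq_iff iter_deriv_Suc Suc)
qed (simp add: iter_deriv_0)

lemma schwartz_deriv:
  assumes "g \<in> schwartz_space"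
  shows "(iter_deriv k g has_vector_derivative iter_deriv (Suc k) g x) (at x)"
  using assms by (simp add: schwartz_space_def iter_deriv_Suc vector_derivative_works)

lemma schwartz_bound:
  assumes "g \<in> schwartz_space"
  obtains B where "0 < B" "\<And>x. \<bar>x\<bar> ^ j * norm (iter_deriv k g x) \<le> B"
proof -
  have "bounded (range (\<lambda>x. x ^ j *\<^sub>R iter_deriv k g x))"
    using assms by (simp add: schwartz_space_def)
  then obtain B where "0 < B" "\<And>x. norm (x ^ j *\<^sub>R iter_deriv k g x) \<le> B"
    by (auto simp: bounded_pos)
  then show thesis by (intro that[of B]) (auto simp: power_abs)
qed

lemma schwartzI:
  assumes der: "\<And>k x. (D k has_vector_derivative D (Suc k) x) (at x)"
    and bnd: "\<And>j k. \<exists>B. \<forall>x. \<bar>x\<bar> ^ j * norm (D k x) \<le> B"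
  shows "D 0 \<in> schwartz_space"
proof -
  have "bounded (range (\<lambda>x. x ^ j *\<^sub>R D k x))" for j k
  proof -
    obtain B where "\<And>x. \<bar>x\<bar> ^ j * norm (D k x) \<le> B" using bnd by blast
    then show ?thesis by (intro boundedI[of _ B]) (auto simp: power_abs)
  qed
  moreover have "D k differentiable (at x)" for k x
    using der[of k x] by (auto simp: has_vector_derivative_def differentiable_def)
  ultimately show ?thesis by (simp add: schwartz_space_def iter_deriv_eqI[of D, OF der])
qed

lemma schwartz_lin:
  assumes g: "g \<in> schwartz_space" and h: "h \<in> schwartz_space"
  shows "iter_deriv k (\<lambda>x. a * g x + b * h x) = (\<lambda>x. a * iter_deriv k g x + b * iter_deriv k h x)"
    and "(\<lambda>x. a * g x + b * h x) \<in> schwartz_space"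
proof -
  define D where "D k x = a * iter_deriv k g x + b * iter_deriv k h x" for k x
  have D0: "D 0 = (\<lambda>x. a * g x + b * h x)" by (simp add: D_def iter_deriv_0 fun_eq_iff)
  have der: "(D k has_vector_derivative D (Suc k) x) (at x)" for k x
    unfolding D_def
    by (intro has_vector_derivative_add has_vector_derivative_mult_right schwartz_deriv g h)
  show "iter_deriv k (\<lambda>x. a * g x + b * h x) = (\<lambda>x. a * iter_deriv k g x + b * iter_deriv k h x)"
    using iter_deriv_eqI[of D, OF der, of k] unfolding D0 by (simp add: D_def[abs_def])
  have "D 0 \<in> schwartz_space"
  proof (rule schwartzI[of D, OF der])
    fix j k
    obtain B1 where B1: "\<And>x. \<bar>x\<bar> ^ j * norm (iter_deriv k g x) \<le> B1"
        using schwartz_bound[OF g] by metis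
    obtain B2 where B2: "\<And>x. \<bar>x\<bar> ^ j * norm (iter_deriv k h x) \<le> B2"
        using schwartz_bound[OF h] by metis
    have "\<bar>x\<bar> ^ j * norm (D k x) \<le> norm a * B1 + norm b * B2" for x
    proof -
      have "\<bar>x\<bar> ^ j * norm (D k x) \<le> \<bar>x\<bar> ^ j * (norm a * norm (iter_deriv k g x)
          + norm b * norm (iter_deriv k h x))"
        unfolding D_def by (intro mult_left_mono norm_triangle_le) (auto simp: norm_mult)
      also have "\<dots> = norm a * (\<bar>x\<bar> ^ j * norm (iter_deriv k g x))
          + norm b * (\<bar>x\<bar> ^ j * norm (iter_deriv k h x))"
        by (simp add: algebra_simps)
      also have "\<dots> \<le> norm a * B1 + norm b * B2" using B1 B2 by (intro add_mono mult_left_mono) auto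
      finally show ?thesis .
    qed
    then show "\<exists>B. \<forall>x. \<bar>x\<bar> ^ j * norm (D k x) \<le> B" by blast
  qed
  then show "(\<lambda>x. a * g x + b * h x) \<in> schwartz_space" by (simp add: D0)
qed

lemma schwartz_zero: "(\<lambda>x. 0) \<in> schwartz_space"
  using schwartzI[of "\<lambda>_ _. 0"] by auto

lemma schwartz_diff:
  assumes g: "g \<in> schwartz_space" and h: "h \<in> schwartz_space"
  shows "iter_deriv k (\<lambda>x. g x - h x) = (\<lambda>x. iter_deriv k g x - iter_deriv k h x)"
    and "(\<lambda>x. g x - h x) \<in> schwartz_space"
  using schwartz_lin(1)[OF g h, of k 1 "-1"] schwartz_lin(2)[OF g h, of 1 "-1"] by simp_all

lemma schwartz_seminorm_ge:
  assumes "g \<in> schwartz_space"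
  shows "\<bar>x\<bar> ^ j * norm (iter_deriv k g x) \<le> schwartz_seminorm j k g"
proof -
  obtain B where "\<And>x. \<bar>x\<bar> ^ j * norm (iter_deriv k g x) \<le> B" using schwartz_bound[OF assms] by metis
  then show ?thesis
    unfolding schwartz_seminorm_def by (intro cSUP_upper bdd_aboveI2[of _ _ B]) auto
qed

lemma schwartz_seminorm_le:
  assumes "\<And>x. \<bar>x\<bar> ^ j * norm (iter_deriv k g x) \<le> B"
  shows "schwartz_seminorm j k g \<le> B"
  unfolding schwartz_seminorm_def by (rule cSUP_least) (use assms in auto)

lemma schwartz_seminorm_triangle:
  assumes f: "f \<in> schwartz_space" and g: "g \<in> schwartz_space" and h: "h \<in> schwartz_space"
  shows "schwartz_seminorm j k (\<lambda>x. h x - f x)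
    \<le> schwartz_seminorm j k (\<lambda>x. h x - g x) + schwartz_seminorm j k (\<lambda>x. g x - f x)"
proof (rule schwartz_seminorm_le)
  fix x
  have "\<bar>x\<bar> ^ j * norm (iter_deriv k (\<lambda>x. h x - f x) x)
      \<le> \<bar>x\<bar> ^ j * (norm (iter_deriv k h x - iter_deriv k g x) + norm (iter_deriv k g x
          - iter_deriv k f x))"
    unfolding schwartz_diff(1)[OF h f]
    by (intro mult_left_mono) (auto intro: norm_diff_triangle_ineq simp: norm_triangle_sub
        dist_norm[symmetric] dist_triangle)
  also have "\<dots> = \<bar>x\<bar> ^ j * norm (iter_deriv k (\<lambda>x. h x - g x) x)
      + \<bar>x\<bar> ^ j * norm (iter_deriv k (\<lambda>x. g x - f x) x)"
    by (simp add: schwartz_diff(1)[OF h g] schwartz_diff(1)[OF g f] distrib_left)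
  also have "\<dots> \<le> schwartz_seminorm j k (\<lambda>x. h x - g x) + schwartz_seminorm j k (\<lambda>x. g x - f x)"
    by (intro add_mono schwartz_seminorm_ge schwartz_diff f g h)
  finally show "\<bar>x\<bar> ^ j * norm (iter_deriv k (\<lambda>x. h x - f x) x)
    \<le> schwartz_seminorm j k (\<lambda>x. h x - g x) + schwartz_seminorm j k (\<lambda>x. g x - f x)" .
qed

lemma schwartz_seminorm_zero: "schwartz_seminorm j k (\<lambda>x. 0) = 0"
proof -
  have "iter_deriv k (\<lambda>x. 0) = (\<lambda>x. 0)"
    using iter_deriv_eqI[of "\<lambda>_ _. 0 :: complex" k] by simp
  then show ?thesis by (simp add: schwartz_seminorm_def)
qed

text \<open>\<open>schwartz_topology\<close> is given by a subbasis of sets with arbitrary centres.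
  The triangle inequality recentres them at \<open>g\<close>, and finite intersections enlarge
  \<open>N\<close> and shrink \<open>e\<close>.\<close>

lemma schwartz_open_contains_ball:
  assumes "openin schwartz_topology U" "g \<in> U" "g \<in> schwartz_space"
  shows "\<exists>N e. 0 < e \<and> (\<forall>h\<in>schwartz_space.
    (\<forall>j\<le>N. \<forall>k\<le>N. schwartz_seminorm j k (\<lambda>x. h x - g x) < e) \<longrightarrow> h \<in> U)"
proof -
  have "generate_topology_on {{h \<in> schwartz_space. schwartz_seminorm j k (\<lambda>x. h x
      - g x) < e} | j k g e.
        g \<in> schwartz_space \<and> 0 < e} U"
    using assms(1) by (simp add: schwartz_topology_def openin_topology_generated_by_iff)
  then show ?thesis
    using assms(2)
  proof induction
    case (Int A B)
    obtain N1 e1 where 1: "0 < e1" "\<And>h. h \<in> schwartz_space \<Longrightarrow>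
        \<forall>j\<le>N1. \<forall>k\<le>N1. schwartz_seminorm j k (\<lambda>x. h x - g x) < e1 \<Longrightarrow> h \<in> A"
      using Int by blast
    obtain N2 e2 where 2: "0 < e2" "\<And>h. h \<in> schwartz_space \<Longrightarrow>
        \<forall>j\<le>N2. \<forall>k\<le>N2. schwartz_seminorm j k (\<lambda>x. h x - g x) < e2 \<Longrightarrow> h \<in> B"
      using Int by blast
    show ?case
      by (rule exI[of _ "max N1 N2"], rule exI[of _ "min e1 e2"]) (use 1 2 in auto)
  next
    case (UN K)
    then show ?case by (meson UnionE UnionI)
  next
    case (Basis s)
    then obtain j k g' e where s: "s = {h \<in> schwartz_space. schwartz_seminorm j k (\<lambda>x. h x
        - g' x) < e}"
        and g': "g' \<in> schwartz_space" by blast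
    have d: "0 < e - schwartz_seminorm j k (\<lambda>x. g x - g' x)" using Basis(2) s by simp
    show ?case
    proof (intro exI[of _ "max j k"] exI[of _ "e - schwartz_seminorm j k (\<lambda>x. g x
        - g' x)"] conjI d ballI impI)
      fix h assume h: "h \<in> schwartz_space" and *: "\<forall>j'\<le>max j k. \<forall>k'\<le>max j k.
          schwartz_seminorm j' k' (\<lambda>x. h x - g x) < e - schwartz_seminorm j k (\<lambda>x. g x - g' x)"
      have "schwartz_seminorm j k (\<lambda>x. h x - g x) < e - schwartz_seminorm j k (\<lambda>x. g x - g' x)"
        using * by (meson max.cobounded1 max.cobounded2)
      then show "h \<in> s"
        using schwartz_seminorm_triangle[OF g' assms(3) h, of j k] h by (simp add: s)
    qed
  qed simp
qed

text \<open>Continuity in quantitative form, as control by finitely many seminorms. Stating it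
  pointwise with a number \<open>B\<close> keeps suprema out of the later estimates.\<close>

locale schwartz_functional =
  fixes T :: "(real \<Rightarrow> complex) \<Rightarrow> complex" and N :: nat and C :: real
  assumes lin: "\<And>g h a b. g \<in> schwartz_space \<Longrightarrow> h \<in> schwartz_space \<Longrightarrow>
      T (\<lambda>x. a * g x + b * h x) = a * T g + b * T h"
    and C: "0 \<le> C"
    and bound: "\<And>h B. h \<in> schwartz_space \<Longrightarrow> 0 < B \<Longrightarrow>
      (\<And>j k x. j \<le> N \<Longrightarrow> k \<le> N \<Longrightarrow> \<bar>x\<bar> ^ j * norm (iter_deriv k h x) \<le> B) \<Longrightarrow> norm (T h) \<le> C * B"

text \<open>The preimage of the unit disc is a neighbourhood of 0, and linearity scales the
  resulting bound to all of the Schwartz space.\<close>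

lemma tempered_schwartz_functional:
  assumes T: "T \<in> tempered_distributions"
  obtains N C where "schwartz_functional T N C"
proof -
  have lin: "T (\<lambda>x. a * g x + b * h x) = a * T g + b * T h"
    if "g \<in> schwartz_space" "h \<in> schwartz_space" for g h a b
    using T that by (simp add: tempered_distributions_def)
  have T0: "T (\<lambda>x. 0) = 0" using lin[OF schwartz_zero schwartz_zero, of 0 0] by simp
  have top: "schwartz_space \<subseteq> topspace schwartz_topology"
  proof
    fix g assume g: "g \<in> schwartz_space"
    have "g \<in> {h \<in> schwartz_space. schwartz_seminorm 0 0 (\<lambda>x. h x - g x) < 1}"
      using g by (simp add: schwartz_seminorm_zero)
    then show "g \<in> topspace schwartz_topology"
      unfolding schwartz_topology_def topology_generated_by_topspace using g zero_less_one by blast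
  qed
  define U where "U = {h \<in> topspace schwartz_topology. T h \<in> ball 0 1}"
  have "openin schwartz_topology U"
    unfolding U_def using T
    by (intro openin_continuous_map_preimage[of _ euclidean]) (auto simp:
        tempered_distributions_def)
  moreover have "(\<lambda>x. 0) \<in> U" using top schwartz_zero by (auto simp: U_def T0)
  ultimately have "\<exists>N e. 0 < e \<and> (\<forall>h\<in>schwartz_space.
      (\<forall>j\<le>N. \<forall>k\<le>N. schwartz_seminorm j k (\<lambda>x. h x - 0) < e) \<longrightarrow> h \<in> U)"
    by (rule schwartz_open_contains_ball[OF _ _ schwartz_zero])
  then obtain N e where e: "0 < e" and N': "\<forall>h\<in>schwartz_space.
      (\<forall>j\<le>N. \<forall>k\<le>N. schwartz_seminorm j k (\<lambda>x. h x - 0) < e) \<longrightarrow> h \<in> U"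
    by (elim exE conjE)
  have N: "h \<in> U" if "h \<in> schwartz_space" "\<forall>j\<le>N. \<forall>k\<le>N. schwartz_seminorm j k h < e" for h
    using bspec[OF N' that(1)] that(2) by simp
  have "schwartz_functional T N (2 / e)"
  proof
    fix h B assume h: "h \<in> schwartz_space" and B: "0 < B"
      and bnd: "\<And>j k x. j \<le> N \<Longrightarrow> k \<le> N \<Longrightarrow> \<bar>x\<bar> ^ j * norm (iter_deriv k h x) \<le> B"
    \<comment> \<open>The factor 2 provides the strict inequality that membership in the
      neighbourhood demands.\<close>
    define s where "s = e / (2 * B)"
    have s: "0 < s" "s * B = e / 2" using e B by (auto simp: s_def)
    \<comment> \<open>The vanishing second summand fits \<open>h'\<close> to the two-term form of
      \<open>schwartz_lin\<close> and \<open>lin\<close>.\<close>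
    define h' where "h' = (\<lambda>x. of_real s * h x + 0 * h x)"
    have h': "h' \<in> schwartz_space" "iter_deriv k h'
        = (\<lambda>x. of_real s * iter_deriv k h x + 0 * iter_deriv k h x)" for k
      unfolding h'_def by (rule schwartz_lin[OF h h])+
    have "schwartz_seminorm j k h' < e" if "j \<le> N" "k \<le> N" for j k
    proof -
      have "schwartz_seminorm j k h' \<le> e / 2"
      proof (rule schwartz_seminorm_le)
        fix x
        have "\<bar>x\<bar> ^ j * norm (iter_deriv k h' x) = s * (\<bar>x\<bar> ^ j * norm (iter_deriv k h x))"
          using s(1) by (simp add: h'(2) norm_mult)
        also have "\<dots> \<le> s * B" using bnd[OF that, of x] s(1) by (intro mult_left_mono) auto
        finally show "\<bar>x\<bar> ^ j * norm (iter_deriv k h' x) \<le> e / 2" by (simp only: s(2))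
      qed
      then show ?thesis using e by simp
    qed
    then have "h' \<in> U" using N[OF h'(1)] by simp
    then have "norm (T h') < 1" by (simp add: U_def)
    moreover have "T h' = of_real s * T h" unfolding h'_def by (subst lin[OF h h]) simp
    ultimately have "s * norm (T h) < 1" using s by (simp add: norm_mult)
    then show "norm (T h) \<le> 2 / e * B" using s(1) e B by (simp add: s_def field_simps)
  qed (use lin e in auto)
  then show thesis by (rule that)
qed

section \<open>Gaussians with complex parameters\<close>

text \<open>\<open>gauss_deriv k n a b\<close> is the \<open>k\<close>-th derivative of \<open>y^n exp (- a y^2 + b y)\<close>. For \<open>n = 0\<close> the
  truncated \<open>n - 1\<close> is harmless because of the factor \<open>n\<close>.\<close>
fun gauss_deriv :: "nat \<Rightarrow> nat \<Rightarrow> complex \<Rightarrow> complex \<Rightarrow> real \<Rightarrow> complex" where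
  "gauss_deriv 0 n a b y = of_real y ^ n * exp (- a * of_real (y\<^sup>2) + b * of_real y)"
| "gauss_deriv (Suc k) n a b y = of_nat n * gauss_deriv k (n - 1) a b y
     - 2 * a * gauss_deriv k (n + 1) a b y + b * gauss_deriv k n a b y"

lemma gauss_deriv_y:
  "((\<lambda>y. gauss_deriv k n a b y) has_vector_derivative gauss_deriv (Suc k) n a b y) (at y)"
proof (induction k arbitrary: n)
  case 0
  define F where "F z = z ^ n * exp (- a * z\<^sup>2 + b * z)" for z :: complex
  have "(F has_field_derivative (of_nat n * z ^ (n - 1) * exp (- a * z\<^sup>2 + b * z)
      + (- a * (2 * z) + b) * exp (- a * z\<^sup>2 + b * z) * z ^ n)) (at z)" for z
    unfolding F_def by (auto intro!: derivative_eq_intros)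
  moreover have "(complex_of_real has_vector_derivative 1) (at y)"
    using has_vector_derivative_of_real[OF DERIV_ident, of "at y"] by simp
  ultimately
  have "((\<lambda>y. F (of_real y)) has_vector_derivative (of_nat n * of_real y ^ (n
      - 1) * exp (- a * (of_real y)\<^sup>2 + b * of_real y)
      + (- a * (2 * of_real y) + b) * exp (- a * (of_real y)\<^sup>2
          + b * of_real y) * of_real y ^ n)) (at y)"
    using field_vector_diff_chain_at[of complex_of_real 1 y F] by (simp add: o_def)
  then show ?case by (simp add: F_def algebra_simps)
next
  case (Suc k)
  have "((\<lambda>y. of_nat n * gauss_deriv k (n - 1) a b y - 2 * a * gauss_deriv k (n + 1) a b y
      + b * gauss_deriv k n a b y)
      has_vector_derivative (of_nat n * gauss_deriv (Suc k) (n - 1) a b y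
        - 2 * a * gauss_deriv (Suc k) (n + 1) a b y + b * gauss_deriv (Suc k) n a b y)) (at y)"
    by (intro has_vector_derivative_add has_vector_derivative_diff
        has_vector_derivative_mult_right Suc)
  then show ?case by (simp only: gauss_deriv.simps(2))
qed

text \<open>A derivative in \<open>a\<close> brings down \<open>- y^2\<close>, whereas one in
  \<open>b\<close> brings down \<open>y\<close>, for every \<open>k\<close>. This is the heat
  equation that links the two parameters.\<close>

lemma gauss_deriv_a:
  "((\<lambda>a. gauss_deriv k n a b y) has_field_derivative - gauss_deriv k (n + 2) a b y) (at a)"
proof (induction k arbitrary: n)
  case 0
  show ?case by (auto intro!: derivative_eq_intros simp: power2_eq_square)
next
  case (Suc k)
  have *: "of_nat n * - gauss_deriv k (n - 1 + 2) a b y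
      = - (of_nat n * gauss_deriv k (n + 1) a b y)"
    by (cases n) auto
  have "((\<lambda>a. gauss_deriv (Suc k) n a b y) has_field_derivative
     (of_nat n * - gauss_deriv k (n - 1 + 2) a b y
       - (2 * gauss_deriv k (n + 1) a b y + - gauss_deriv k (n + 1 + 2) a b y * (2 * a))
       + b * - gauss_deriv k (n + 2) a b y)) (at a)"
    unfolding gauss_deriv.simps(2)
    by (intro DERIV_add DERIV_diff DERIV_cmult Suc DERIV_mult) (auto intro!: derivative_eq_intros)
  then show ?case unfolding * by (simp add: algebra_simps)
qed

lemma gauss_deriv_b:
  "((\<lambda>b. gauss_deriv k n a b y) has_field_derivative gauss_deriv k (n + 1) a b y) (at b)"
proof (induction k arbitrary: n)
  case 0
  show ?case by (auto intro!: derivative_eq_intros)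
next
  case (Suc k)
  have *: "of_nat n * gauss_deriv k (n - 1 + 1) a b y = of_nat n * gauss_deriv k n a b y"
    by (cases n) auto
  have "((\<lambda>b. gauss_deriv (Suc k) n a b y) has_field_derivative
     (of_nat n * gauss_deriv k (n - 1 + 1) a b y - 2 * a * gauss_deriv k (n + 1 + 1) a b y
       + (1 * gauss_deriv k n a b y + gauss_deriv k (n + 1) a b y * b))) (at b)"
    unfolding gauss_deriv.simps(2)
    by (intro DERIV_add DERIV_diff DERIV_cmult Suc DERIV_mult) (auto intro!: derivative_eq_intros)
  then show ?case unfolding * by (simp add: algebra_simps)
qed

text \<open>The bound is uniform over a compact set of parameters, because it has to control Taylor
  remainders in \<open>a\<close> and \<open>b\<close>.\<close>

lemma gauss_deriv_bound:
  assumes \<delta>: "0 < \<delta>" and R: "0 \<le> R"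
  shows "\<exists>M>0. \<forall>a b y. \<delta> \<le> Re a \<longrightarrow> norm a \<le> R \<longrightarrow> norm b \<le> R
      \<longrightarrow> \<bar>y\<bar> ^ j * norm (gauss_deriv k n a b y) \<le> M"
proof (induction k arbitrary: n)
  case 0
  define m where "m = real (j + n)"
  have "\<bar>y\<bar> ^ j * norm (gauss_deriv 0 n a b y) \<le> exp ((R + m)\<^sup>2 / (4 * \<delta>))"
    if ab: "\<delta> \<le> Re a" "norm a \<le> R" "norm b \<le> R" for a b y
  proof -
    define t where "t = \<bar>y\<bar>"
    have t: "0 \<le> t" by (simp add: t_def)
    \<comment> \<open>Powers of \<open>t\<close> are absorbed into \<open>exp (m * t)\<close>. Only
      a quadratic exponent remains, and completing the square maximises it.\<close>
    have "t ^ (j + n) \<le> exp t ^ (j + n)"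
      using t exp_ge_add_one_self[of t] by (intro power_mono) linarith+
    also have "\<dots> = exp (m * t)" using exp_of_nat_mult[of "j + n" t] by (simp add: m_def)
    finally have 1: "t ^ (j + n) \<le> exp (m * t)" .
    have "Re b * y \<le> \<bar>Re b\<bar> * t" by (simp add: t_def abs_mult[symmetric])
    also have "\<dots> \<le> R * t" using abs_Re_le_cmod[of b] ab(3) t by (intro mult_right_mono) auto
    finally have "Re b * y \<le> R * t" .
    moreover have "\<delta> * t\<^sup>2 \<le> Re a * y\<^sup>2" using ab(1) by (simp add: t_def mult_right_mono)
    ultimately have 2: "Re (- a * of_real (y\<^sup>2) + b * of_real y) \<le> R * t - \<delta> * t\<^sup>2" by simp
    have "\<bar>y\<bar> ^ j * norm (gauss_deriv 0 n a b y)
        = t ^ (j + n) * exp (Re (- a * of_real (y\<^sup>2) + b * of_real y))"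
      by (simp add: norm_mult norm_power power_add t_def norm_exp_eq_Re)
    also have "\<dots> \<le> exp (m * t) * exp (R * t - \<delta> * t\<^sup>2)" using 1 2 t by (intro mult_mono) auto
    also have "\<dots> = exp ((R + m) * t - \<delta> * t\<^sup>2)" by (simp add: exp_add[symmetric] algebra_simps)
    also have "(R + m) * t - \<delta> * t\<^sup>2 \<le> (R + m)\<^sup>2 / (4 * \<delta>)"
    proof -
      have "0 \<le> (2 * \<delta> * t - (R + m))\<^sup>2 / (4 * \<delta>)" using \<delta> by simp
      also have "\<dots> = (R + m)\<^sup>2 / (4 * \<delta>) - ((R + m) * t - \<delta> * t\<^sup>2)"
        using \<delta> by (simp add: power2_eq_square field_simps)
      finally show ?thesis by simp
    qed
    finally show ?thesis by simp
  qed
  then show ?case by (intro exI[of _ "exp ((R + m)\<^sup>2 / (4 * \<delta>))"]) auto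
next
  case (Suc k)
  obtain M1 where M1: "M1 > 0" "\<And>a b y. \<delta> \<le> Re a \<Longrightarrow> norm a \<le> R \<Longrightarrow> norm b \<le> R
      \<Longrightarrow> \<bar>y\<bar> ^ j * norm (gauss_deriv k (n - 1) a b y) \<le> M1"
    using Suc[of "n - 1"] by blast
  obtain M2 where M2: "M2 > 0" "\<And>a b y. \<delta> \<le> Re a \<Longrightarrow> norm a \<le> R \<Longrightarrow> norm b \<le> R
      \<Longrightarrow> \<bar>y\<bar> ^ j * norm (gauss_deriv k (n + 1) a b y) \<le> M2"
    using Suc[of "n + 1"] by blast
  obtain M3 where M3: "M3 > 0" "\<And>a b y. \<delta> \<le> Re a \<Longrightarrow> norm a \<le> R \<Longrightarrow> norm b \<le> R
      \<Longrightarrow> \<bar>y\<bar> ^ j * norm (gauss_deriv k n a b y) \<le> M3"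
    using Suc[of n] by blast
  have "\<bar>y\<bar> ^ j * norm (gauss_deriv (Suc k) n a b y) \<le> real n * M1 + 2 * R * M2 + R * M3 + 1"
    if ab: "\<delta> \<le> Re a" "norm a \<le> R" "norm b \<le> R" for a b y
  proof -
    have "norm (gauss_deriv (Suc k) n a b y) \<le> real n * norm (gauss_deriv k (n - 1) a b y)
        + 2 * norm a * norm (gauss_deriv k (n + 1) a b y) + norm b * norm (gauss_deriv k n a b y)"
      unfolding gauss_deriv.simps(2)
      by (rule norm_triangle_le, rule add_mono, rule order_trans[OF norm_triangle_ineq4]) (auto
          simp: norm_mult)
    then have "\<bar>y\<bar> ^ j * norm (gauss_deriv (Suc k) n a b y)
        \<le> \<bar>y\<bar> ^ j * (real n * norm (gauss_deriv k (n - 1) a b y)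
        + 2 * norm a * norm (gauss_deriv k (n + 1) a b y) + norm b * norm (gauss_deriv k n a b y))"
      by (intro mult_left_mono) auto
    also have "\<dots> = real n * (\<bar>y\<bar> ^ j * norm (gauss_deriv k (n - 1) a b y))
        + 2 * norm a * (\<bar>y\<bar> ^ j * norm (gauss_deriv k (n + 1) a b y))
            + norm b * (\<bar>y\<bar> ^ j * norm (gauss_deriv k n a b y))"
      by (simp add: algebra_simps)
    also have "\<dots> \<le> real n * M1 + 2 * R * M2 + R * M3"
      using M1(2)[OF ab, of y] M2(2)[OF ab, of y] M3(2)[OF ab, of y] ab R
      by (intro add_mono mult_mono) auto
    finally show ?thesis by simp
  qed
  moreover have "0 < real n * M1 + 2 * R * M2 + R * M3 + 1" using M1 M2 M3 R
      by (simp add: add_nonneg_pos)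
  ultimately show ?case by blast
qed

lemma gauss_schwartz:
  assumes "0 < Re a"
  shows "gauss_deriv 0 n a b \<in> schwartz_space" "iter_deriv k (gauss_deriv 0 n a b)
      = gauss_deriv k n a b"
proof -
  show "iter_deriv k (gauss_deriv 0 n a b) = gauss_deriv k n a b"
    by (rule iter_deriv_eqI[of "\<lambda>k. gauss_deriv k n a b"]) (rule gauss_deriv_y)
  show "gauss_deriv 0 n a b \<in> schwartz_space"
  proof (rule schwartzI[of "\<lambda>k. gauss_deriv k n a b"])
    show "(gauss_deriv k n a b has_vector_derivative gauss_deriv (Suc k) n a b x) (at x)" for k x
      by (rule gauss_deriv_y)
    fix j k
    have "0 \<le> max (norm a) (norm b)" by (simp add: le_max_iff_disj)
    from gauss_deriv_bound[OF assms this, of j k n] obtain M where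
      M: "\<forall>a' b' y. Re a \<le> Re a' \<longrightarrow> norm a' \<le> max (norm a) (norm b) \<longrightarrow>
        norm b' \<le> max (norm a) (norm b) \<longrightarrow> \<bar>y\<bar> ^ j * norm (gauss_deriv k n a' b' y) \<le> M"
      by (elim exE conjE)
    show "\<exists>B. \<forall>x. \<bar>x\<bar> ^ j * norm (gauss_deriv k n a b x) \<le> B"
      using M[rule_format, of a b] by (intro exI[of _ M]) simp
  qed
qed

section \<open>Analytic dependence on the parameters of the Gaussian\<close>

context schwartz_functional
begin

lemma T_diff: "g \<in> schwartz_space \<Longrightarrow> h \<in> schwartz_space \<Longrightarrow> T (\<lambda>x. g x - h x) = T g - T h"
  using lin[of g h 1 "-1"] by simp

lemma T_cmult: "g \<in> schwartz_space \<Longrightarrow> T (\<lambda>x. c * g x) = c * T g"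
  using lin[of g g c 0] by simp

text \<open>Finitely many pairs \<open>j\<close>, \<open>k\<close> are involved, so the sum of their
  bounds serves as a common one.\<close>

lemma uniform_seminorm_bound:
  assumes "\<And>j k. \<exists>M>0. \<forall>z\<in>X. \<bar>y z\<bar> ^ j * norm (f k z) \<le> M"
  shows "\<exists>M>0. \<forall>j\<le>N. \<forall>k\<le>N. \<forall>z\<in>X. \<bar>y z\<bar> ^ j * norm (f k z :: complex) \<le> M"
proof -
  obtain M where M: "\<And>j k. 0 < M j k" "\<And>j k z. z \<in> X \<Longrightarrow> \<bar>y z\<bar> ^ j * norm (f k z) \<le> M j k"
    using assms by metis
  define S where "S = (\<Sum>j\<le>N. \<Sum>k\<le>N. M j k)"
  have "M j k \<le> S" if "j \<le> N" "k \<le> N" for j k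
  proof -
    have "M j k \<le> (\<Sum>k\<le>N. M j k)" using that M(1) by (intro member_le_sum) (auto simp: less_imp_le)
    also have "\<dots> \<le> S" unfolding S_def
      using that M(1) by (intro member_le_sum[of j _ "\<lambda>j. \<Sum>k\<le>N. M j k"]) (auto simp: less_imp_le
          sum_nonneg)
    finally show ?thesis .
  qed
  moreover have "0 < S" using M(1)[of 0 0] calculation[of 0 0] by simp
  ultimately show ?thesis using M(2) by (meson order_trans)
qed

text \<open>The seminorm bound carries a quadratic first-order remainder of the functions over to
  the values of \<open>T\<close>, so that \<open>T\<close> commutes with the derivative in the
  parameter.\<close>

lemma T_deriv_param:
  fixes G :: "complex \<Rightarrow> real \<Rightarrow> complex"
  assumes G: "\<And>a. a \<in> ball a0 r \<Longrightarrow> G a \<in> schwartz_space" and G': "G' \<in> schwartz_space" and r: "0 < r"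
    and M: "0 < M" "\<And>j k a y. j \<le> N \<Longrightarrow> k \<le> N \<Longrightarrow> a \<in> ball a0 r \<Longrightarrow>
      \<bar>y\<bar> ^ j * norm (iter_deriv k (G a) y - iter_deriv k (G a0) y - (a - a0) * iter_deriv k G' y)
          \<le> M * (norm (a - a0))\<^sup>2"
  shows "((\<lambda>a. T (G a)) has_field_derivative T G') (at a0)"
proof -
  have est: "norm (T (G a) - T (G a0) - (a - a0) * T G') \<le> C * (M * (norm (a - a0))\<^sup>2)"
    if a: "a \<in> ball a0 r" "a \<noteq> a0" for a
  proof -
    have a0: "a0 \<in> ball a0 r" using r by simp
    have s1: "(\<lambda>x. G a x - G a0 x) \<in> schwartz_space" by (intro schwartz_diff G a a0)
    have s2: "(\<lambda>x. 1 * (G a x - G a0 x) + (- (a - a0)) * G' x) \<in> schwartz_space"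
      by (intro schwartz_lin s1 G')
    have d: "iter_deriv k (\<lambda>x. 1 * (G a x - G a0 x) + (- (a - a0)) * G' x)
        = (\<lambda>x. iter_deriv k (G a) x - iter_deriv k (G a0) x - (a - a0) * iter_deriv k G' x)" for k
      unfolding schwartz_lin(1)[OF s1 G'] schwartz_diff(1)[OF G[OF a(1)] G[OF a0]]
          by (simp add: algebra_simps)
    have "T (\<lambda>x. 1 * (G a x - G a0 x) + (- (a - a0)) * G' x) = T (G a) - T (G a0) - (a - a0) * T G'"
      by (subst lin[OF s1 G']) (simp add: T_diff[OF G[OF a(1)] G[OF a0]] algebra_simps)
    moreover have "norm (T (\<lambda>x. 1 * (G a x - G a0 x) + (- (a - a0)) * G' x))
        \<le> C * (M * (norm (a - a0))\<^sup>2)"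
    proof (rule bound[OF s2])
      show "0 < M * (norm (a - a0))\<^sup>2" using M(1) a by simp
      show "\<bar>y\<bar> ^ j * norm (iter_deriv k (\<lambda>x. 1 * (G a x - G a0 x) + (- (a - a0)) * G' x) y)
          \<le> M * (norm (a - a0))\<^sup>2"
        if "j \<le> N" "k \<le> N" for j k y
        unfolding d by (rule M(2)[OF that a(1)])
    qed
    ultimately show ?thesis by simp
  qed
  have "((\<lambda>a. (T (G a) - T (G a0)) / (a - a0) - T G') \<longlongrightarrow> 0) (at a0)"
  proof (rule Lim_null_comparison)
    have "norm ((T (G a) - T (G a0)) / (a - a0) - T G') \<le> C * M * norm (a - a0)"
      if a: "a \<in> ball a0 r" "a \<noteq> a0" for a
    proof -
      have "(T (G a) - T (G a0)) / (a - a0) - T G'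
          = (T (G a) - T (G a0) - (a - a0) * T G') / (a - a0)"
        using a by (simp add: divide_simps)
      then have "norm ((T (G a) - T (G a0)) / (a - a0) - T G')
          = norm (T (G a) - T (G a0) - (a - a0) * T G') / norm (a - a0)" by (simp add: norm_divide)
      also have "\<dots> \<le> C * (M * (norm (a - a0))\<^sup>2) / norm (a - a0)"
        by (intro divide_right_mono est a) auto
      also have "\<dots> = C * M * norm (a - a0)" using a by (simp add: power2_eq_square)
      finally show ?thesis .
    qed
    then show "\<forall>\<^sub>F a in at a0. norm ((T (G a) - T (G a0)) / (a - a0) - T G')
        \<le> C * M * norm (a - a0)"
      using eventually_at_in_open'[of "ball a0 r" a0] eventually_at_filter r
      unfolding eventually_at_topological by (intro exI[of _ "ball a0 r"]) auto
    show "((\<lambda>a. C * M * norm (a - a0)) \<longlongrightarrow> 0) (at a0)"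
      by (rule tendsto_eq_intros refl)+ simp
  qed
  then show ?thesis by (simp add: has_field_derivative_iff Lim_null[symmetric])
qed

definition E :: "nat \<Rightarrow> complex \<Rightarrow> complex \<Rightarrow> complex" where
  "E n a b = T (gauss_deriv 0 n a b)"

lemma E_deriv_b:
  assumes a: "0 < Re a"
  shows "((\<lambda>b. E n a b) has_field_derivative E (n + 1) a b) (at b)"
proof -
  define R where "R = norm a + norm b + 1"
  have "\<exists>M>0. \<forall>z\<in>ball b 1 \<times> UNIV. \<bar>snd z\<bar> ^ j * norm (gauss_deriv k (n + 2) a (fst z) (snd z))
      \<le> M" for j k
  proof -
    have "norm b' \<le> R" if "b' \<in> ball b 1" for b'
    proof -
      have "norm (b' - b) < 1" using that by (simp add: dist_norm norm_minus_commute)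
      then show ?thesis using norm_triangle_ineq2[of b' b] norm_ge_zero[of a]
          unfolding R_def by linarith
    qed
    moreover have R: "norm a \<le> R" "0 \<le> R" by (simp_all add: R_def)
    moreover obtain M where "0 < M" "\<forall>a' b' y. Re a \<le> Re a' \<longrightarrow> norm a' \<le> R \<longrightarrow> norm b' \<le> R \<longrightarrow>
        \<bar>y\<bar> ^ j * norm (gauss_deriv k (n + 2) a' b' y) \<le> M"
      using gauss_deriv_bound[OF a R(2), of j k "n + 2"] by (elim exE conjE)
    ultimately show ?thesis by (intro exI[of _ M]) auto
  qed
  from uniform_seminorm_bound[where y = snd and f
      = "\<lambda>k z. gauss_deriv k (n + 2) a (fst z) (snd z)", OF this] obtain M where M1: "0 < M"
    and M2: "\<forall>j\<le>N. \<forall>k\<le>N. \<forall>z\<in>ball b 1 \<times> UNIV. \<bar>snd z\<bar> ^ j * norm (gauss_deriv k (n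
        + 2) a (fst z) (snd z)) \<le> M"
    by (elim exE conjE)
  have M: "0 < M"
    "\<And>j k b' y. j \<le> N \<Longrightarrow> k \<le> N \<Longrightarrow> b' \<in> ball b 1 \<Longrightarrow> \<bar>y\<bar> ^ j * norm (gauss_deriv k (n + 2) a b' y) \<le> M"
  proof -
    show "0 < M" by (rule M1)
    fix j k b' y assume "j \<le> N" "k \<le> N" "b' \<in> ball b 1"
    then show "\<bar>y\<bar> ^ j * norm (gauss_deriv k (n + 2) a b' y) \<le> M"
      using M2[rule_format, of j k "(b', y)"] by simp
  qed
  show ?thesis
    unfolding E_def
  proof (rule T_deriv_param[where r = 1 and M = M])
    fix j k b' y assume jk: "j \<le> N" "k \<le> N" and b': "b' \<in> ball b 1"
    \<comment> \<open>Taylor's formula of first order in \<open>b\<close>. The weight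
      \<open>\<bar>y\<bar> ^ j\<close> is kept inside, so the bound required for the second
      derivative is the seminorm bound \<open>M\<close>.\<close>
    have "norm (of_real (\<bar>y\<bar> ^ j) * gauss_deriv k (n + 0) a b' y
        - (\<Sum>i\<le>1. of_real (\<bar>y\<bar> ^ j) * gauss_deriv k (n + i) a b y * (b' - b) ^ i / fact i))
        \<le> M * norm (b' - b) ^ Suc 1 / fact 1"
    proof (rule complex_Taylor[of "ball b 1" 1 "\<lambda>i b. of_real (\<bar>y\<bar> ^ j) * gauss_deriv k (n
        + i) a b y"])
      fix i x
      show "((\<lambda>b. of_real (\<bar>y\<bar> ^ j) * gauss_deriv k (n + i) a b y) has_field_derivative
          of_real (\<bar>y\<bar> ^ j) * gauss_deriv k (n + Suc i) a x y) (at x within ball b 1)"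
        using DERIV_cmult[OF gauss_deriv_b[of k "n + i" a y x]]
            by (auto intro: has_field_derivative_at_within)
    next
      fix x assume "x \<in> ball b 1"
      from M(2)[OF jk this] show "norm (of_real (\<bar>y\<bar> ^ j) * gauss_deriv k (n + Suc 1) a x y) \<le> M"
        by (simp add: norm_mult norm_power)
    qed (use b' in auto)
    moreover have "of_real (\<bar>y\<bar> ^ j) * gauss_deriv k (n + 0) a b' y
        - (\<Sum>i\<le>1. of_real (\<bar>y\<bar> ^ j) * gauss_deriv k (n + i) a b y * (b' - b) ^ i / fact i)
        = of_real (\<bar>y\<bar> ^ j) * (gauss_deriv k n a b' y - gauss_deriv k n a b y - (b'
            - b) * gauss_deriv k (n + 1) a b y)"
      by (simp add: algebra_simps)
    ultimately show "\<bar>y\<bar> ^ j * norm (iter_deriv k (gauss_deriv 0 n a b') y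
        - iter_deriv k (gauss_deriv 0 n a b) y
        - (b' - b) * iter_deriv k (gauss_deriv 0 (n + 1) a b) y) \<le> M * (norm (b' - b))\<^sup>2"
      by (simp add: gauss_schwartz(2)[OF a] norm_mult norm_power power2_eq_square)
  qed (rule gauss_schwartz(1)[OF a] M(1) zero_less_one)+
qed

lemma E_deriv_a:
  assumes a: "0 < Re a"
  shows "((\<lambda>a. E n a b) has_field_derivative - E (n + 2) a b) (at a)"
proof -
  define R where "R = norm a + norm b + Re a"
  \<comment> \<open>Half the distance to the imaginary axis; the real part stays at least
    \<open>r\<close> on \<open>ball a r\<close>.\<close>
  define r where "r = Re a / 2"
  have r: "0 < r" using a by (simp add: r_def)
  have re: "r \<le> Re a'" if "a' \<in> ball a r" for a'
    using that abs_Re_le_cmod[of "a - a'"] by (simp add: r_def dist_norm)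
  \<comment> \<open>Each derivative in \<open>a\<close> raises the power of \<open>y\<close> by 2,
    so the second one leads to \<open>n + 4\<close>.\<close>
  have "\<exists>M>0. \<forall>z\<in>ball a r \<times> UNIV. \<bar>snd z\<bar> ^ j * norm (gauss_deriv k (n + 4) (fst z) b (snd z))
      \<le> M" for j k
  proof -
    have "norm a' \<le> R" if "a' \<in> ball a r" for a'
    proof -
      have "norm (a' - a) < Re a / 2" using that by (simp add: r_def dist_norm norm_minus_commute)
      then show ?thesis using norm_triangle_ineq2[of a' a] norm_ge_zero[of b] a
          unfolding R_def by linarith
    qed
    moreover have R: "norm b \<le> R" "0 \<le> R" using a by (simp_all add: R_def)
    moreover obtain M where "0 < M" "\<forall>a' b' y. r \<le> Re a' \<longrightarrow> norm a' \<le> R \<longrightarrow> norm b' \<le> R \<longrightarrow>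
        \<bar>y\<bar> ^ j * norm (gauss_deriv k (n + 4) a' b' y) \<le> M"
      using gauss_deriv_bound[OF r R(2), of j k "n + 4"] by (elim exE conjE)
    ultimately show ?thesis using re by (intro exI[of _ M]) auto
  qed
  from uniform_seminorm_bound[where y = snd and f
      = "\<lambda>k z. gauss_deriv k (n + 4) (fst z) b (snd z)", OF this] obtain M where M1: "0 < M"
    and M2: "\<forall>j\<le>N. \<forall>k\<le>N. \<forall>z\<in>ball a r \<times> UNIV. \<bar>snd z\<bar> ^ j * norm (gauss_deriv k (n
        + 4) (fst z) b (snd z)) \<le> M"
    by (elim exE conjE)
  have M: "0 < M"
    "\<And>j k a' y. j \<le> N \<Longrightarrow> k \<le> N \<Longrightarrow> a' \<in> ball a r \<Longrightarrow> \<bar>y\<bar> ^ j * norm (gauss_deriv k (n + 4) a' b y) \<le> M"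
  proof -
    show "0 < M" by (rule M1)
    fix j k a' y assume "j \<le> N" "k \<le> N" "a' \<in> ball a r"
    then show "\<bar>y\<bar> ^ j * norm (gauss_deriv k (n + 4) a' b y) \<le> M"
      using M2[rule_format, of j k "(a', y)"] by simp
  qed
  define H where "H = (\<lambda>x. (- 1) * gauss_deriv 0 (n + 2) a b x + 0 * gauss_deriv 0 (n + 2) a b x)"
  have H: "H \<in> schwartz_space" "iter_deriv k H
      = (\<lambda>x. (- 1) * gauss_deriv k (n + 2) a b x + 0 * gauss_deriv k (n + 2) a b x)" for k
    unfolding H_def using schwartz_lin[OF gauss_schwartz(1)[OF a, of "n
        + 2" b] gauss_schwartz(1)[OF a, of "n + 2" b]]
    by (auto simp only: gauss_schwartz(2)[OF a])
  have TH: "T H = - E (n + 2) a b"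
    unfolding H_def E_def by (subst lin) (auto intro: gauss_schwartz a)
  have "((\<lambda>a. E n a b) has_field_derivative T H) (at a)"
    unfolding E_def
  proof (rule T_deriv_param[where r = r and M = M])
    fix j k a' y assume jk: "j \<le> N" "k \<le> N" and a': "a' \<in> ball a r"
    have a'pos: "0 < Re a'" using re[OF a'] r by simp
    have "norm (of_real (\<bar>y\<bar> ^ j) * ((- 1) ^ 0 * gauss_deriv k (n + 2 * 0) a' b y)
        - (\<Sum>i\<le>1. of_real (\<bar>y\<bar> ^ j) * ((- 1) ^ i * gauss_deriv k (n + 2 * i) a b y) * (a'
        - a) ^ i / fact i))
        \<le> M * norm (a' - a) ^ Suc 1 / fact 1"
    proof (rule complex_Taylor[of "ball a r" 1 "\<lambda>i a. of_real (\<bar>y\<bar> ^ j) * ((- 1) ^ i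
        * gauss_deriv k (n + 2 * i) a b y)"])
      fix i x
      show "((\<lambda>a. of_real (\<bar>y\<bar> ^ j) * ((- 1) ^ i * gauss_deriv k (n + 2 * i) a b y))
          has_field_derivative
          of_real (\<bar>y\<bar> ^ j) * ((- 1) ^ Suc i * gauss_deriv k (n
              + 2 * Suc i) x b y)) (at x within ball a r)"
        using DERIV_cmult[OF DERIV_cmult[OF gauss_deriv_a[of k "n
            + 2 * i" b y x]], of "of_real (\<bar>y\<bar> ^ j)" "(- 1) ^ i"]
        by (auto intro: has_field_derivative_at_within)
    next
      fix x assume "x \<in> ball a r"
      from M(2)[OF jk this] show "norm (of_real (\<bar>y\<bar> ^ j) * ((- 1) ^ Suc 1 * gauss_deriv k (n
          + 2 * Suc 1) x b y)) \<le> M"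
        by (simp add: norm_mult norm_power)
    qed (use a' r in auto)
    moreover have "of_real (\<bar>y\<bar> ^ j) * ((- 1) ^ 0 * gauss_deriv k (n + 2 * 0) a' b y)
        - (\<Sum>i\<le>1. of_real (\<bar>y\<bar> ^ j) * ((- 1) ^ i * gauss_deriv k (n + 2 * i) a b y) * (a'
        - a) ^ i / fact i)
        = of_real (\<bar>y\<bar> ^ j) * (gauss_deriv k n a' b y - gauss_deriv k n a b y - (a'
            - a) * (- gauss_deriv k (n + 2) a b y))"
      by (simp add: algebra_simps)
    ultimately show "\<bar>y\<bar> ^ j * norm (iter_deriv k (gauss_deriv 0 n a' b) y
        - iter_deriv k (gauss_deriv 0 n a b) y
        - (a' - a) * iter_deriv k H y) \<le> M * (norm (a' - a))\<^sup>2"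
      by (simp add: gauss_schwartz(2)[OF a] gauss_schwartz(2)[OF a'pos] H(2) norm_mult norm_power
          power2_eq_square)
  next
    show "gauss_deriv 0 n a' b \<in> schwartz_space" if "a' \<in> ball a r" for a'
      using re[OF that] r by (intro gauss_schwartz) simp
  qed (rule H(1) r M(1))+
  then show ?thesis by (simp add: TH)
qed

text \<open>Vanishing for one width \<open>c\<close> and all \<open>b\<close> kills all derivatives in \<open>b\<close>, hence by the heat
    equation all
  derivatives in \<open>a\<close> at \<open>a = c\<close>.\<close>
lemma E_eq_0:
  assumes zero: "\<And>b. E 0 c b = 0" and c: "0 < Re c" and a: "0 < Re a"
  shows "E 0 a b = 0"
proof -
  have En: "E n c b = 0" for n b
  proof (induction n arbitrary: b)
    case (Suc n)
    have "((\<lambda>b. E n c b) has_field_derivative 0) (at b)" by (simp add: Suc)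
    from DERIV_unique[OF this E_deriv_b[OF c]] show ?case by simp
  qed (rule zero)
  define H where "H = {a. 0 < Re a}"
  have H: "open H" "connected H"
    unfolding H_def by (auto intro!: open_halfspace_Re_gt convex_connected convex_halfspace_Re_gt)
  have hol: "(\<lambda>a. E n a b) holomorphic_on H" for n
    unfolding holomorphic_on_open[OF H(1)] using E_deriv_a by (force simp: H_def)
  have der: "(deriv ^^ k) (\<lambda>a. E 0 a b) a = (- 1) ^ k * E (2 * k) a b" if "a \<in> H" for k a
    using that
  proof (induction k arbitrary: a)
    case (Suc k)
    have "(deriv ^^ Suc k) (\<lambda>a. E 0 a b) a = deriv ((deriv ^^ k) (\<lambda>a. E 0 a b)) a" by simp
    also have "\<dots> = deriv (\<lambda>a. (- 1) ^ k * E (2 * k) a b) a"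
      by (rule deriv_cong_ev) (use Suc H in \<open>auto intro!: eventually_mono[OF
          eventually_nhds_in_open[OF H(1)]]\<close>)
    also have "\<dots> = (- 1) ^ k * - E (2 * k + 2) a b"
      using Suc.prems by (intro DERIV_imp_deriv DERIV_cmult E_deriv_a) (simp add: H_def)
    finally show ?case by simp
  qed simp
  show ?thesis
  proof (rule holomorphic_fun_eq_0_on_connected[OF hol H])
    show "(deriv ^^ n) (\<lambda>a. E 0 a b) c = 0" for n using der[of c n] c by (simp add: H_def En)
  qed (use a c in \<open>auto simp: H_def\<close>)
qed

end

section \<open>Gaussians determine a tempered distribution\<close>

lemma norm_diff_le_deriv_bound:
  fixes f :: "real \<Rightarrow> complex"
  assumes der: "\<And>t. (f has_vector_derivative f' t) (at t)"
    and B: "\<And>t. t \<in> closed_segment x y \<Longrightarrow> norm (f' t) \<le> B"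
  shows "norm (f y - f x) \<le> B * \<bar>y - x\<bar>"
proof -
  have "norm (f y - f x) \<le> B * norm (y - x)"
  proof (rule differentiable_bound[of "closed_segment x y"])
    fix t assume t: "t \<in> closed_segment x y"
    show "(f has_derivative (\<lambda>h. h *\<^sub>R f' t)) (at t within closed_segment x y)"
      using der[of t] by (auto simp: has_vector_derivative_def intro: has_derivative_at_withinI)
    show "onorm (\<lambda>h. h *\<^sub>R f' t) \<le> B"
    proof (rule onorm_bound)
      show "0 \<le> B" using B[OF t] norm_ge_zero order_trans by blast
      show "norm (h *\<^sub>R f' t) \<le> B * norm h" for h
        using mult_left_mono[OF B[OF t], of "\<bar>h\<bar>"] by (simp add: mult.commute)
    qed
  qed auto
  then show ?thesis by simp
qed

text \<open>After subtracting the linear term, the derivative is at most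
  \<open>B * \<bar>h\<bar>\<close> on the segment. The factor 1/2 of the exact remainder is given
  up.\<close>

lemma second_order_remainder:
  fixes f :: "real \<Rightarrow> complex"
  assumes f: "\<And>t. (f has_vector_derivative f' t) (at t)" and f': "\<And>t. (f'
      has_vector_derivative f'' t) (at t)"
    and B: "\<And>t. norm (f'' t) \<le> B"
  shows "norm (f (y + h) - f y - h *\<^sub>R f' y) \<le> h\<^sup>2 * B"
proof -
  define \<phi> where "\<phi> t = f t - t *\<^sub>R f' y" for t
  have \<phi>: "(\<phi> has_vector_derivative (f' t - f' y)) (at t)" for t
    unfolding \<phi>_def
  proof (intro has_vector_derivative_diff f)
    show "((\<lambda>t. t *\<^sub>R f' y) has_vector_derivative f' y) (at t)"
      unfolding has_vector_derivative_def
      by (rule bounded_linear_imp_has_derivative[OF bounded_linear_scaleR_left])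
  qed
  have "norm (\<phi> (y + h) - \<phi> y) \<le> (B * \<bar>h\<bar>) * \<bar>y + h - y\<bar>"
  proof (rule norm_diff_le_deriv_bound[OF \<phi>])
    fix t assume t: "t \<in> closed_segment y (y + h)"
    have "norm (f' t - f' y) \<le> B * \<bar>t - y\<bar>" by (rule norm_diff_le_deriv_bound[OF f' B])
    also have "\<dots> \<le> B * \<bar>h\<bar>"
      using t order_trans[OF norm_ge_zero B[of 0]]
      by (intro mult_left_mono) (auto simp: closed_segment_eq_real_ivl split: if_splits)
    finally show "norm (f' t - f' y) \<le> B * \<bar>h\<bar>" .
  qed
  then show ?thesis by (simp add: \<phi>_def power2_eq_square algebra_simps)
qed

text \<open>Derivatives of convolutions, and of \<open>T\<close> applied to partial convolutions,
  are obtained from such a quadratic estimate, in place of a theorem on differentiation under the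
  integral.\<close>

lemma has_vector_derivative_if_quadratic:
  fixes F :: "real \<Rightarrow> complex"
  assumes \<delta>: "0 < \<delta>" and q: "\<And>h. \<bar>h\<bar> < \<delta> \<Longrightarrow> norm (F (y + h) - F y - h *\<^sub>R D) \<le> h\<^sup>2 * B"
  shows "(F has_vector_derivative D) (at y)"
  unfolding has_vector_derivative_def has_derivative_at
proof (intro conjI bounded_linear_scaleR_left)
  have "((\<lambda>h. \<bar>h\<bar> * B) \<longlongrightarrow> 0) (at 0)" by (rule tendsto_eq_intros refl)+ simp
  moreover have "\<forall>\<^sub>F h in at 0. norm (norm (F (y + h) - F y - h *\<^sub>R D) / norm h) \<le> \<bar>h\<bar> * B"
    unfolding eventually_at
  proof (intro exI[of _ \<delta>] conjI ballI impI \<delta>)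
    fix h :: real assume h: "h \<noteq> 0 \<and> dist h 0 < \<delta>"
    have "norm (F (y + h) - F y - h *\<^sub>R D) / \<bar>h\<bar> \<le> h\<^sup>2 * B / \<bar>h\<bar>" using q[of h] h
        by (intro divide_right_mono) auto
    also have "h\<^sup>2 * B / \<bar>h\<bar> = \<bar>h\<bar> * B" using h
        by (cases "0 < h") (simp_all add: power2_eq_square field_simps)
    finally show "norm (norm (F (y + h) - F y - h *\<^sub>R D) / norm h) \<le> \<bar>h\<bar> * B" by simp
  qed
  ultimately show "(\<lambda>h. norm (F (y + h) - F y - h *\<^sub>R D) / norm h) \<midarrow>0\<rightarrow> 0"
    by (rule Lim_null_comparison[rotated])
qed

section \<open>Rapid decay and convolution\<close>

lemma schwartz_continuous: "g \<in> schwartz_space \<Longrightarrow> continuous_on UNIV (iter_deriv k g)"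
  by (intro continuous_at_imp_continuous_on ballI) (rule
      has_vector_derivative_continuous[OF schwartz_deriv])

lemma schwartz_bound_1plus:
  assumes "g \<in> schwartz_space"
  obtains B where "0 < B" "\<And>x. (1 + \<bar>x\<bar>) ^ j * norm (iter_deriv k g x) \<le> B"
proof -
  obtain B0 where B0: "0 < B0" "\<And>x. \<bar>x\<bar> ^ 0 * norm (iter_deriv k g x) \<le> B0"
      using schwartz_bound[OF assms] by blast
  obtain B1 where B1: "0 < B1" "\<And>x. \<bar>x\<bar> ^ j * norm (iter_deriv k g x) \<le> B1"
      using schwartz_bound[OF assms] by blast
  have "(1 + \<bar>x\<bar>) ^ j * norm (iter_deriv k g x) \<le> 2 ^ j * (B0 + B1)" for x
  proof -
    have "(1 + \<bar>x\<bar>) ^ j \<le> (2 * max 1 \<bar>x\<bar>) ^ j" by (intro power_mono) auto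
    also have "\<dots> \<le> 2 ^ j * (1 + \<bar>x\<bar> ^ j)" by (simp add: power_mult_distrib max_def)
    finally have "(1 + \<bar>x\<bar>) ^ j * norm (iter_deriv k g x)
        \<le> 2 ^ j * (1 + \<bar>x\<bar> ^ j) * norm (iter_deriv k g x)"
      by (intro mult_right_mono) auto
    also have "\<dots> = 2 ^ j * (\<bar>x\<bar> ^ 0 * norm (iter_deriv k g x) + \<bar>x\<bar> ^ j * norm (iter_deriv k g x))"
      by (simp add: algebra_simps)
    also have "\<dots> \<le> 2 ^ j * (B0 + B1)" using B0(2)[of x] B1(2)[of x]
        by (intro mult_left_mono add_mono) auto
    finally show ?thesis .
  qed
  then show thesis using B0 B1 by (intro that[of "2 ^ j * (B0 + B1)"]) auto
qed

text \<open>A form of Peetre's inequality; it distributes a polynomial weight in \<open>y\<close>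
  over the two factors of a convolution.\<close>

lemma power_1plus_split: "\<bar>y\<bar> ^ j \<le> (1 + \<bar>x\<bar>) ^ j * (1 + \<bar>y - x\<bar>) ^ (j :: nat)" for x y :: real
proof -
  have "\<bar>y\<bar> \<le> \<bar>x\<bar> + \<bar>y - x\<bar>" by simp
  also have "\<dots> \<le> (1 + \<bar>x\<bar>) * (1 + \<bar>y - x\<bar>)" by (simp add: algebra_simps)
  finally have "\<bar>y\<bar> ^ j \<le> ((1 + \<bar>x\<bar>) * (1 + \<bar>y - x\<bar>)) ^ j" by (intro power_mono) auto
  then show ?thesis by (simp add: power_mult_distrib)
qed

definition conv :: "(real \<Rightarrow> complex) \<Rightarrow> (real \<Rightarrow> complex) \<Rightarrow> real \<Rightarrow> complex" where
  "conv w K y = (LINT x|lborel. w x * K (y - x))"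

text \<open>Wide enough to contain Schwartz functions multiplied by indicators, which need not be
  smooth. In \<open>conv w K\<close> all derivatives fall on \<open>K\<close>.\<close>

definition rapidly_integrable :: "(real \<Rightarrow> complex) \<Rightarrow> bool" where
  "rapidly_integrable w \<longleftrightarrow> w \<in> borel_measurable borel \<and>
     (\<forall>j::nat. integrable lborel (\<lambda>x. (1 + \<bar>x\<bar>) ^ j * norm (w x)))"

lemma rapidly_integrable_integrable:
  assumes "rapidly_integrable w"
  shows "integrable lborel w"
proof (rule integrable_norm_cancel)
  have "integrable lborel (\<lambda>x. (1 + \<bar>x\<bar>) ^ 0 * norm (w x))"
    using assms unfolding rapidly_integrable_def by blast
  then show "integrable lborel (\<lambda>x. norm (w x))" by simp
  show "w \<in> borel_measurable lborel" using assms by (simp add: rapidly_integrable_def)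
qed

lemma integrable_inverse_quadratic: "integrable lborel (\<lambda>x::real. inverse (1 + x\<^sup>2))"
  using integrable_inverse_1_plus_square by (simp add: set_integrable_def einterval_def)

lemma schwartz_rapidly_integrable:
  assumes g: "g \<in> schwartz_space"
  shows "rapidly_integrable g"
  unfolding rapidly_integrable_def
proof (intro conjI allI)
  show m: "g \<in> borel_measurable borel"
    using schwartz_continuous[OF g, of 0] by (simp add: iter_deriv_0
        borel_measurable_continuous_onI)
  fix j :: nat
  \<comment> \<open>Two spare powers leave the integrable majorant
    \<open>B * inverse (1 + x^2)\<close>.\<close>
  obtain B where B: "0 < B" "\<And>x. (1 + \<bar>x\<bar>) ^ (j + 2) * norm (iter_deriv 0 g x) \<le> B"
    using schwartz_bound_1plus[OF g] by blast
  show "integrable lborel (\<lambda>x. (1 + \<bar>x\<bar>) ^ j * norm (g x))"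
  proof (rule Bochner_Integration.integrable_bound)
    show "integrable lborel (\<lambda>x. B * inverse (1 + x\<^sup>2))" using integrable_inverse_quadratic by simp
    show "(\<lambda>x. (1 + \<bar>x\<bar>) ^ j * norm (g x)) \<in> borel_measurable lborel" using m by measurable
    have "(1 + \<bar>x\<bar>) ^ j * norm (g x) \<le> B * inverse (1 + x\<^sup>2)" for x
    proof -
      have p: "0 < 1 + x\<^sup>2" by (simp add: add_pos_nonneg)
      have "(1 + \<bar>x\<bar>) ^ j * norm (g x) * (1 + x\<^sup>2) \<le> (1 + \<bar>x\<bar>) ^ j * norm (g x) * (1 + \<bar>x\<bar>)\<^sup>2"
        by (intro mult_left_mono) (auto simp: power2_eq_square algebra_simps)
      also have "\<dots> \<le> B" using B(2)[of x] by (simp add: iter_deriv_0 power_add power2_eq_square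
          mult_ac)
      finally have "(1 + \<bar>x\<bar>) ^ j * norm (g x) \<le> B / (1 + x\<^sup>2)" using p
          by (simp only: pos_le_divide_eq)
      then show ?thesis by (simp add: divide_inverse)
    qed
    then show "AE x in lborel. norm ((1 + \<bar>x\<bar>) ^ j * norm (g x)) \<le> norm (B * inverse (1 + x\<^sup>2))"
      using B by (auto simp: abs_mult)
  qed
qed

lemma rapidly_integrable_indicator:
  assumes "rapidly_integrable w" and S: "S \<in> sets borel"
  shows "rapidly_integrable (\<lambda>x. indicator S x * w x)"
proof -
  have "integrable lborel (\<lambda>x. (1 + \<bar>x\<bar>) ^ j * norm (indicator S x * w x))" for j :: nat
  proof -
    have "integrable lborel (\<lambda>x. indicator S x *\<^sub>R ((1 + \<bar>x\<bar>) ^ j * norm (w x)))"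
      using assms by (intro integrable_mult_indicator) (auto simp: rapidly_integrable_def)
    also have "(\<lambda>x. indicator S x *\<^sub>R ((1 + \<bar>x\<bar>) ^ j * norm (w x)))
        = (\<lambda>x. (1 + \<bar>x\<bar>) ^ j * norm (indicator S x * w x))"
      by (auto simp: fun_eq_iff indicator_def)
    finally show ?thesis .
  qed
  moreover have "(\<lambda>x. indicator S x * w x) \<in> borel_measurable borel"
    using assms by (auto simp: rapidly_integrable_def)
  ultimately show ?thesis by (simp add: rapidly_integrable_def)
qed

lemma conv_integrable:
  assumes w: "rapidly_integrable w" and K: "K \<in> schwartz_space"
  shows "integrable lborel (\<lambda>x. w x * iter_deriv k K (y - x))"
proof -
  obtain B where B: "0 < B" "\<And>x. \<bar>x\<bar> ^ 0 * norm (iter_deriv k K x) \<le> B"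
      using schwartz_bound[OF K] by blast
  have c: "continuous_on UNIV (\<lambda>x. iter_deriv k K (y - x))"
    by (intro continuous_on_compose2[OF schwartz_continuous[OF K]] continuous_intros) auto
  have m: "(\<lambda>x. iter_deriv k K (y - x)) \<in> borel_measurable borel"
      by (rule borel_measurable_continuous_onI[OF c])
  show ?thesis
  proof (rule Bochner_Integration.integrable_bound)
    show "integrable lborel (\<lambda>x. B * norm (w x))" using rapidly_integrable_integrable[OF w] by simp
    show "(\<lambda>x. w x * iter_deriv k K (y - x)) \<in> borel_measurable lborel"
      using m w by (auto simp: rapidly_integrable_def)
    have "norm (w x) * norm (iter_deriv k K (y - x)) \<le> norm (w x) * B" for x
      using B(2)[of "y - x"] by (intro mult_left_mono) auto
    then show "AE x in lborel. norm (w x * iter_deriv k K (y - x)) \<le> norm (B * norm (w x))"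
      using B(1) by (auto simp: norm_mult mult.commute)
  qed
qed

text \<open>The second-order remainder of \<open>K\<close> is bounded uniformly in \<open>x\<close>,
  and integrating it against \<open>w\<close> gives a quadratic remainder for the
  convolution.\<close>

lemma conv_deriv:
  assumes w: "rapidly_integrable w" and K: "K \<in> schwartz_space"
  shows "(conv w (iter_deriv k K) has_vector_derivative conv w (iter_deriv (Suc k) K) y) (at y)"
proof -
  obtain B where B: "0 < B" "\<And>x. \<bar>x\<bar> ^ 0 * norm (iter_deriv (Suc (Suc k)) K x) \<le> B"
    using schwartz_bound[OF K] by blast
  have int: "integrable lborel (\<lambda>x. w x * iter_deriv k K (y - x))" for k y
      by (rule conv_integrable[OF w K])
  have "norm (conv w (iter_deriv k K) (y + h) - conv w (iter_deriv k K) y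
      - h *\<^sub>R conv w (iter_deriv (Suc k) K) y)
      \<le> h\<^sup>2 * (LINT x|lborel. norm (w x) * B)" for h
  proof -
    define d where "d x = iter_deriv k K (y - x + h) - iter_deriv k K (y - x)
        - h *\<^sub>R iter_deriv (Suc k) K (y - x)" for x
    have d: "norm (d x) \<le> h\<^sup>2 * B" for x
      unfolding d_def by (rule second_order_remainder[OF schwartz_deriv[OF K] schwartz_deriv[OF K]])
          (use B in simp)
    have eq: "w x * d x = w x * iter_deriv k K (y + h - x) - w x * iter_deriv k K (y - x)
        - h *\<^sub>R (w x * iter_deriv (Suc k) K (y - x))" for x
      by (simp add: d_def algebra_simps)
    have int_d: "integrable lborel (\<lambda>x. w x * d x)" unfolding eq using int by auto
    have "(LINT x|lborel. w x * d x) = conv w (iter_deriv k K) (y + h) - conv w (iter_deriv k K) y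
        - h *\<^sub>R conv w (iter_deriv (Suc k) K) y"
      unfolding eq conv_def using int by simp
    then have "norm (conv w (iter_deriv k K) (y + h) - conv w (iter_deriv k K) y
        - h *\<^sub>R conv w (iter_deriv (Suc k) K) y)
        \<le> (LINT x|lborel. norm (w x * d x))" by (metis integral_norm_bound)
    also have "\<dots> \<le> (LINT x|lborel. h\<^sup>2 * (norm (w x) * B))"
    proof (intro integral_mono)
      show "integrable lborel (\<lambda>x. norm (w x * d x))" by (rule integrable_norm[OF int_d])
      show "integrable lborel (\<lambda>x. h\<^sup>2 * (norm (w x) * B))"
          using rapidly_integrable_integrable[OF w] by simp
      show "norm (w x * d x) \<le> h\<^sup>2 * (norm (w x) * B)" for x
        using mult_left_mono[OF d[of x], of "norm (w x)"] by (simp add: norm_mult mult_ac)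
    qed
    finally show ?thesis by simp
  qed
  then show ?thesis by (intro has_vector_derivative_if_quadratic[of 1]) auto
qed

lemma conv_bound:
  assumes w: "rapidly_integrable w" and B: "\<And>x. (1 + \<bar>x\<bar>) ^ j * norm (K x) \<le> B"
    and int: "integrable lborel (\<lambda>x. w x * K (y - x))"
  shows "\<bar>y\<bar> ^ j * norm (conv w K y) \<le> B * (LINT x|lborel. (1 + \<bar>x\<bar>) ^ j * norm (w x))"
proof -
  have "\<bar>y\<bar> ^ j * norm (conv w K y) \<le> \<bar>y\<bar> ^ j * (LINT x|lborel. norm (w x * K (y - x)))"
    unfolding conv_def by (intro mult_left_mono integral_norm_bound) auto
  also have "\<dots> = (LINT x|lborel. \<bar>y\<bar> ^ j * norm (w x * K (y - x)))" using int by simp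
  also have "\<dots> \<le> (LINT x|lborel. B * ((1 + \<bar>x\<bar>) ^ j * norm (w x)))"
  proof (intro integral_mono)
    show "integrable lborel (\<lambda>x. \<bar>y\<bar> ^ j * norm (w x * K (y - x)))" using int by auto
    show "integrable lborel (\<lambda>x. B * ((1 + \<bar>x\<bar>) ^ j * norm (w x)))" using w
        by (auto simp: rapidly_integrable_def)
    fix x
    have "\<bar>y\<bar> ^ j * norm (w x * K (y - x)) \<le> ((1 + \<bar>x\<bar>) ^ j * (1 + \<bar>y - x\<bar>) ^ j) * norm (w x * K (y
        - x))"
      by (intro mult_right_mono power_1plus_split) auto
    also have "\<dots> = ((1 + \<bar>x\<bar>) ^ j * norm (w x)) * ((1 + \<bar>y - x\<bar>) ^ j * norm (K (y - x)))"
      by (simp add: norm_mult)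
    also have "\<dots> \<le> ((1 + \<bar>x\<bar>) ^ j * norm (w x)) * B" by (intro mult_left_mono B) auto
    finally show "\<bar>y\<bar> ^ j * norm (w x * K (y - x)) \<le> B * ((1 + \<bar>x\<bar>) ^ j * norm (w x))"
        by (simp add: mult.commute)
  qed
  finally show ?thesis by simp
qed

lemma conv_schwartz:
  assumes w: "rapidly_integrable w" and K: "K \<in> schwartz_space"
  shows "conv w K \<in> schwartz_space" "iter_deriv k (conv w K) = conv w (iter_deriv k K)"
proof -
  define D where "D k = conv w (iter_deriv k K)" for k
  have D0: "D 0 = conv w K" by (simp add: D_def iter_deriv_0)
  have der: "(D k has_vector_derivative D (Suc k) x) (at x)" for k x
    unfolding D_def by (rule conv_deriv[OF w K])
  show "iter_deriv k (conv w K) = conv w (iter_deriv k K)"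
    using iter_deriv_eqI[of D k, OF der] unfolding D0 by (simp add: D_def)
  have "D 0 \<in> schwartz_space"
  proof (rule schwartzI[of D, OF der])
    fix j k
    obtain B where "\<And>x. (1 + \<bar>x\<bar>) ^ j * norm (iter_deriv k K x) \<le> B"
        using schwartz_bound_1plus[OF K] by blast
    from conv_bound[OF w this conv_integrable[OF w K]]
    show "\<exists>B. \<forall>x. \<bar>x\<bar> ^ j * norm (D k x) \<le> B" unfolding D_def by blast
  qed
  then show "conv w K \<in> schwartz_space" by (simp add: D0)
qed

lemma conv_commute: "conv f g y = conv g f y"
proof -
  have "(LINT x|lborel. f x * g (y - x)) = \<bar>-1\<bar> *\<^sub>R (LINT x|lborel. f (y + (-1) * x) * g (y - (y
      + (-1) * x)))"
    by (rule lborel_integral_real_affine) simp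
  then show ?thesis by (simp add: conv_def mult.commute)
qed

lemma schwartz_shift:
  assumes K: "K \<in> schwartz_space"
  shows "(\<lambda>y. K (y - s)) \<in> schwartz_space" "iter_deriv k (\<lambda>y. K (y - s))
      = (\<lambda>y. iter_deriv k K (y - s))"
proof -
  define D where "D k y = iter_deriv k K (y - s)" for k y
  have D0: "D 0 = (\<lambda>y. K (y - s))" by (simp add: D_def iter_deriv_0 fun_eq_iff)
  have der: "(D k has_vector_derivative D (Suc k) x) (at x)" for k x
  proof -
    have "((\<lambda>y. y - s) has_vector_derivative 1) (at x)"
      by (auto intro!: derivative_eq_intros simp:
          has_real_derivative_iff_has_vector_derivative[symmetric])
    from vector_diff_chain_at[OF this schwartz_deriv[OF K]] show ?thesis
      unfolding D_def by (simp add: o_def)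
  qed
  show "iter_deriv k (\<lambda>y. K (y - s)) = (\<lambda>y. iter_deriv k K (y - s))"
    using iter_deriv_eqI[of D k, OF der] unfolding D0 by (simp add: D_def[abs_def])
  have "D 0 \<in> schwartz_space"
  proof (rule schwartzI[of D, OF der])
    fix j k
    obtain B where B: "\<And>x. (1 + \<bar>x\<bar>) ^ j * norm (iter_deriv k K x) \<le> B"
        using schwartz_bound_1plus[OF K] by blast
    have "\<bar>y\<bar> ^ j * norm (D k y) \<le> (1 + \<bar>s\<bar>) ^ j * B" for y
    proof -
      have "\<bar>y\<bar> ^ j * norm (D k y) \<le> ((1 + \<bar>s\<bar>) ^ j * (1 + \<bar>y - s\<bar>) ^ j) * norm (D k y)"
        by (intro mult_right_mono power_1plus_split) auto
      also have "\<dots> = (1 + \<bar>s\<bar>) ^ j * ((1 + \<bar>y - s\<bar>) ^ j * norm (iter_deriv k K (y - s)))"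
          by (simp add: D_def)
      also have "\<dots> \<le> (1 + \<bar>s\<bar>) ^ j * B" by (intro mult_left_mono B) auto
      finally show ?thesis .
    qed
    then show "\<exists>B. \<forall>x. \<bar>x\<bar> ^ j * norm (D k x) \<le> B" by blast
  qed
  then show "(\<lambda>y. K (y - s)) \<in> schwartz_space" by (simp add: D0)
qed

text \<open>The mean value inequality between \<open>y - s\<close> and \<open>y - x\<close>. Moving
  the weight from \<open>y\<close> to an intermediate \<open>t\<close> costs
  \<open>(1 + L) ^ j\<close>, since \<open>y - t\<close> lies between \<open>s\<close> and
  \<open>x\<close>.\<close>

lemma schwartz_increment_bound:
  assumes K: "K \<in> schwartz_space" and B: "\<And>x. (1 + \<bar>x\<bar>) ^ j * norm (iter_deriv (Suc k) K x) \<le> B"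
    and L: "\<bar>x\<bar> \<le> L" "\<bar>s\<bar> \<le> L"
  shows "\<bar>y\<bar> ^ j * norm (iter_deriv k K (y - x) - iter_deriv k K (y - s))
      \<le> (1 + L) ^ j * B * \<bar>x - s\<bar>"
proof -
  have "norm (of_real (\<bar>y\<bar> ^ j) * iter_deriv k K (y - x) - of_real (\<bar>y\<bar> ^ j) * iter_deriv k K (y
      - s))
      \<le> ((1 + L) ^ j * B) * \<bar>(y - x) - (y - s)\<bar>"
  proof (rule norm_diff_le_deriv_bound)
    show "((\<lambda>t. of_real (\<bar>y\<bar> ^ j) * iter_deriv k K t)
        has_vector_derivative of_real (\<bar>y\<bar> ^ j) * iter_deriv (Suc k) K t) (at t)" for t
      by (intro has_vector_derivative_mult_right schwartz_deriv K)
    fix t assume "t \<in> closed_segment (y - s) (y - x)"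
    then have t: "\<bar>y - t\<bar> \<le> L" using L by (auto simp: closed_segment_eq_real_ivl split: if_splits)
    have "norm (of_real (\<bar>y\<bar> ^ j) * iter_deriv (Suc k) K t)
        = \<bar>y\<bar> ^ j * norm (iter_deriv (Suc k) K t)"
      by (simp add: norm_mult norm_power)
    also have "\<dots> \<le> ((1 + \<bar>y - t\<bar>) ^ j * (1 + \<bar>t\<bar>) ^ j) * norm (iter_deriv (Suc k) K t)"
      using power_1plus_split[of y j "y - t"] by (intro mult_right_mono) auto
    also have "\<dots> = (1 + \<bar>y - t\<bar>) ^ j * ((1 + \<bar>t\<bar>) ^ j * norm (iter_deriv (Suc k) K t))" by simp
    also have "\<dots> \<le> (1 + L) ^ j * B"
      using t by (intro mult_mono power_mono B) auto
    finally show "norm (of_real (\<bar>y\<bar> ^ j) * iter_deriv (Suc k) K t) \<le> (1 + L) ^ j * B" .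
  qed
  moreover have "norm (of_real (\<bar>y\<bar> ^ j) * iter_deriv k K (y - x)
      - of_real (\<bar>y\<bar> ^ j) * iter_deriv k K (y - s))
      = \<bar>y\<bar> ^ j * norm (iter_deriv k K (y - x) - iter_deriv k K (y - s))"
    by (simp add: right_diff_distrib[symmetric] norm_mult norm_power)
  ultimately show ?thesis by (simp add: abs_minus_commute)
qed

lemma gaussian_line_integral_pos:
  assumes "0 < a" and int: "integrable lborel (\<lambda>x::real. exp (- a * x\<^sup>2) :: real)"
  shows "0 < (LINT x|lborel. exp (- a * x\<^sup>2) :: real)"
proof -
  have "(LINT x|lborel. indicator {0..1::real} x * exp (- a)) \<le> (LINT x|lborel. exp (- a * x\<^sup>2))"
  proof (intro integral_mono int)
    show "integrable lborel (\<lambda>x::real. indicator {0..1} x * exp (- a) :: real)"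
      by (intro integrable_mult_left) (simp add: integrable_indicator_iff)
    show "indicator {0..1} x * exp (- a) \<le> exp (- a * x\<^sup>2)" for x :: real
      using assms(1) by (auto simp: indicator_def abs_square_le_1 mult_left_le)
  qed
  then have "exp (- a) \<le> (LINT x|lborel. exp (- a * x\<^sup>2) :: real)" by simp
  then show ?thesis using exp_gt_zero[of "- a"] by linarith
qed

section \<open>Distributions applied to convolutions\<close>

context schwartz_functional
begin

text \<open>\<open>bound\<close> asks for \<open>B > 0\<close>. The bounds that arise below are
  integrals that may vanish, and the case \<open>B = 0\<close> is reached by a limit.\<close>

lemma bound_nonneg:
  assumes h: "h \<in> schwartz_space" and B: "0 \<le> B"
    and bnd: "\<And>j k x. j \<le> N \<Longrightarrow> k \<le> N \<Longrightarrow> \<bar>x\<bar> ^ j * norm (iter_deriv k h x) \<le> B"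
  shows "norm (T h) \<le> C * B"
proof (rule field_le_epsilon)
  fix e :: real assume e: "0 < e"
  have "norm (T h) \<le> C * (B + e / (C + 1))"
  proof (rule bound[OF h])
    have "0 < e / (C + 1)" using e C by simp
    then show "0 < B + e / (C + 1)" using B by simp
    show "\<bar>x\<bar> ^ j * norm (iter_deriv k h x) \<le> B + e / (C + 1)" if "j \<le> N" "k \<le> N" for j k x
      using bnd[OF that, of x] \<open>0 < e / (C + 1)\<close> by simp
  qed
  also have "\<dots> \<le> C * B + e"
    using e C by (simp add: distrib_left divide_le_eq)
  finally show "norm (T h) \<le> C * B + e" .
qed

text \<open>One derivative beyond \<open>N\<close> is included because increments of the
  \<open>N\<close>-th derivative are estimated by the next one. The base
  \<open>1 + \<bar>x\<bar>\<close> makes the weight with exponent \<open>N\<close> dominate the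
  smaller ones.\<close>

lemma uniform_1plus_bound:
  assumes K: "K \<in> schwartz_space"
  obtains M where "0 < M" "\<And>j k x. j \<le> N \<Longrightarrow> k \<le> Suc N \<Longrightarrow> (1 + \<bar>x\<bar>) ^ j * norm (iter_deriv k K x) \<le> M"
proof -
  have "\<forall>k. \<exists>B>0. \<forall>x. (1 + \<bar>x\<bar>) ^ N * norm (iter_deriv k K x) \<le> B"
    using schwartz_bound_1plus[OF K] by metis
  then obtain B where B: "\<And>k. 0 < B k" "\<And>k x. (1 + \<bar>x\<bar>) ^ N * norm (iter_deriv k K x)
      \<le> B k" by metis
  define M where "M = (\<Sum>k\<le>Suc N. B k)"
  have BM: "B k \<le> M" if "k \<le> Suc N" for k
    unfolding M_def using that B(1) by (intro member_le_sum) (auto simp: less_imp_le)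
  have "(1 + \<bar>x\<bar>) ^ j * norm (iter_deriv k K x) \<le> M" if "j \<le> N" "k \<le> Suc N" for j k x
  proof -
    have "(1 + \<bar>x\<bar>) ^ j * norm (iter_deriv k K x) \<le> (1 + \<bar>x\<bar>) ^ N * norm (iter_deriv k K x)"
      using that by (intro mult_right_mono power_increasing) auto
    then show ?thesis using B(2)[of x k] BM[OF that(2)] by linarith
  qed
  moreover have "0 < M" using B(1)[of 0] BM[of 0] by simp
  ultimately show thesis using that by blast
qed

text \<open>Interchanges \<open>T\<close> with the convolution integral: the image under \<open>T\<close> of the integral
  over \<open>x \<le> s\<close> has derivative \<open>g s\<close> times \<open>T\<close> of the translate of \<open>K\<close> by \<open>s\<close>, which is \<open>0\<close>.\<close>
lemma T_conv_eq_0: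
  assumes g: "g \<in> schwartz_space" and K: "K \<in> schwartz_space" and zero: "\<And>x. T (\<lambda>y. K (y - x)) = 0"
  shows "T (conv g K) = 0"
proof -
  obtain M where M: "0 < M" "\<And>j k x. j \<le> N \<Longrightarrow> k \<le> Suc N
      \<Longrightarrow> (1 + \<bar>x\<bar>) ^ j * norm (iter_deriv k K x) \<le> M"
    using uniform_1plus_bound[OF K] by blast
  have rg: "rapidly_integrable g" by (rule schwartz_rapidly_integrable[OF g])
  define q where "q x = (1 + \<bar>x\<bar>) ^ N * norm (g x)" for x
  have int_q: "integrable lborel q" using rg by (simp add: q_def[abs_def] rapidly_integrable_def)
  define w where "w S x = indicator S x * g x" for S x
  have w: "rapidly_integrable (w S)" if "S \<in> sets borel" for S
    unfolding w_def by (rule rapidly_integrable_indicator[OF rg that])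
  have convS: "conv (w S) K \<in> schwartz_space" if "S \<in> sets borel" for S
    by (rule conv_schwartz(1)[OF w[OF that] K])
  have T_conv_le: "norm (T (conv (w S) K)) \<le> C * (M * (LINT x|lborel. indicator S x
      * q x))" if S: "S \<in> sets borel" for S
  proof (rule bound_nonneg[OF convS[OF S]])
    have int_wq: "integrable lborel (\<lambda>x. indicator S x * q x)"
      using integrable_mult_indicator[of S lborel q] S int_q by simp
    show "0 \<le> M * (LINT x|lborel. indicator S x * q x)"
      using M(1) by (intro mult_nonneg_nonneg integral_nonneg_AE) (auto simp: q_def)
    fix j k x assume jk: "j \<le> N" "k \<le> N"
    have "\<bar>x\<bar> ^ j * norm (iter_deriv k (conv (w S) K) x)
        \<le> M * (LINT x|lborel. (1 + \<bar>x\<bar>) ^ j * norm (w S x))"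
      unfolding conv_schwartz(2)[OF w[OF S] K]
      by (rule conv_bound[OF w[OF S] M(2) conv_integrable[OF w[OF S] K]]) (use jk in auto)
    also have "\<dots> \<le> M * (LINT x|lborel. indicator S x * q x)"
    proof (intro mult_left_mono integral_mono int_wq)
      show "integrable lborel (\<lambda>x. (1 + \<bar>x\<bar>) ^ j * norm (w S x))" using w[OF S]
          by (simp add: rapidly_integrable_def)
      show "(1 + \<bar>x\<bar>) ^ j * norm (w S x) \<le> indicator S x * q x" for x
        unfolding w_def q_def using jk
        by (cases "x \<in> S") (auto simp: intro!: mult_right_mono power_increasing)
    qed (use M in auto)
    finally show "\<bar>x\<bar> ^ j * norm (iter_deriv k (conv (w S) K) x)
        \<le> M * (LINT x|lborel. indicator S x * q x)" .
  qed
  have conv_diff: "T (conv (w A) K) - T (conv (w B) K) = T (conv (w (A - B)) K)"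
    if "B \<subseteq> A" "A \<in> sets borel" "B \<in> sets borel" for A B
  proof -
    have "conv (w (A - B)) K = (\<lambda>y. conv (w A) K y - conv (w B) K y)"
    proof
      fix y
      have "w (A - B) x * K (y - x) = w A x * K (y - x) - w B x * K (y - x)" for x
        using that(1) by (auto simp: w_def indicator_def)
      then show "conv (w (A - B)) K y = conv (w A) K y - conv (w B) K y"
        unfolding conv_def using conv_integrable[OF w[OF that(2)] K, of 0 y] conv_integrable[OF w[OF
            that(3)] K, of 0 y]
        by (simp add: iter_deriv_0)
    qed
    then show ?thesis using T_diff[OF convS[OF that(2)] convS[OF that(3)]] by simp
  qed
  define \<Psi> where "\<Psi> s = T (conv (w {..s}) K)" for s
  obtain G where G: "0 < G" "\<And>x. \<bar>x\<bar> ^ 0 * norm (iter_deriv 0 g x) \<le> G"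
      using schwartz_bound[OF g] by blast
  have incr: "norm (\<Psi> s' - \<Psi> s) \<le> C * ((1 + L) ^ N * M * G) * (s' - s)\<^sup>2"
    if s: "s \<le> s'" "\<bar>s\<bar> \<le> L" "\<bar>s'\<bar> \<le> L" for s s' L
  proof -
    define S where "S = {s<..s'}"
    have S: "S \<in> sets borel" by (simp add: S_def)
    have Sdiff: "{..s'} - {..s} = S" by (auto simp: S_def)
    define c where "c = (LINT x|lborel. w S x)"
    \<comment> \<open>\<open>T\<close> kills the translate of \<open>K\<close> by \<open>s\<close>,
      so subtracting it with the mass \<open>c\<close> leaves the value of \<open>T\<close>
      unchanged. The difference is small of second order: one factor comes from the length of
      \<open>S\<close>, the other from the increment of \<open>K\<close>.\<close>
    define h where "h = (\<lambda>y. conv (w S) K y - c * K (y - s))"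
    have Ks: "(\<lambda>y. c * K (y - s)) \<in> schwartz_space" "iter_deriv k (\<lambda>y. c * K (y - s))
        = (\<lambda>y. c * iter_deriv k K (y - s))" for k
      using schwartz_lin(1)[OF schwartz_shift(1)[OF K, of s] schwartz_shift(1)[OF K, of s], of k c
          0]
        schwartz_lin(2)[OF schwartz_shift(1)[OF K, of s] schwartz_shift(1)[OF K, of s], of c 0]
      by (simp_all add: schwartz_shift(2)[OF K])
    have h: "h \<in> schwartz_space" "iter_deriv k h
        = (\<lambda>y. conv (w S) (iter_deriv k K) y - c * iter_deriv k K (y - s))" for k
      unfolding h_def using schwartz_diff[OF convS[OF S] Ks(1)]
          by (auto simp: conv_schwartz(2)[OF w[OF S] K] Ks(2))
    have "T h = T (conv (w S) K)"
      unfolding h_def using T_diff[OF convS[OF S] Ks(1)] T_cmult[OF schwartz_shift(1)[OF K], of c s]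
          by (simp add: zero)
    have "norm (T h) \<le> C * ((1 + L) ^ N * M * G * (s' - s)\<^sup>2)"
    proof (rule bound_nonneg[OF h(1)])
      have L: "0 \<le> L" using s by simp
      show "0 \<le> (1 + L) ^ N * M * G * (s' - s)\<^sup>2" using L M G by simp
      fix j k y assume jk: "j \<le> N" "k \<le> N"
      have i1: "integrable lborel (\<lambda>x. w S x * iter_deriv k K (y - x))"
          by (rule conv_integrable[OF w[OF S] K])
      have i2: "integrable lborel (w S)" by (rule rapidly_integrable_integrable[OF w[OF S]])
      have i3: "integrable lborel (\<lambda>x. w S x * (iter_deriv k K (y - x) - iter_deriv k K (y - s)))"
        unfolding right_diff_distrib using i1 i2 by auto
      have "iter_deriv k h y = (LINT x|lborel. w S x * (iter_deriv k K (y - x) - iter_deriv k K (y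
          - s)))"
        unfolding h(2) conv_def c_def right_diff_distrib using i1 i2 by simp
      then have "\<bar>y\<bar> ^ j * norm (iter_deriv k h y)
          \<le> \<bar>y\<bar> ^ j * (LINT x|lborel. norm (w S x * (iter_deriv k K (y - x) - iter_deriv k K (y
              - s))))"
        by (intro mult_left_mono) auto
      also have "\<dots> = (LINT x|lborel. \<bar>y\<bar> ^ j * norm (w S x * (iter_deriv k K (y - x)
          - iter_deriv k K (y - s))))"
        by (simp only: integral_mult_right_zero)
      also have "\<dots> \<le> (LINT x|lborel. indicator S x * ((1 + L) ^ N * M * G * (s' - s)))"
      proof (intro integral_mono)
        show "integrable lborel (\<lambda>x. \<bar>y\<bar> ^ j * norm (w S x * (iter_deriv k K (y - x)
            - iter_deriv k K (y - s))))"
          using integrable_norm[OF i3] by auto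
        show "integrable lborel (\<lambda>x. indicator S x * ((1 + L) ^ N * M * G * (s' - s)))"
          using s by (intro integrable_mult_left) (simp add: S_def integrable_indicator_iff)
        fix x
        show "\<bar>y\<bar> ^ j * norm (w S x * (iter_deriv k K (y - x) - iter_deriv k K (y - s)))
            \<le> indicator S x * ((1 + L) ^ N * M * G * (s' - s))"
        proof (cases "x \<in> S")
          case True
          then have x: "\<bar>x\<bar> \<le> L" "\<bar>x - s\<bar> \<le> s' - s" using s by (auto simp: S_def)
          have "\<bar>y\<bar> ^ j * norm (iter_deriv k K (y - x) - iter_deriv k K (y - s))
              \<le> (1 + L) ^ j * M * \<bar>x - s\<bar>"
            by (rule schwartz_increment_bound[OF K M(2) x(1) s(2)]) (use jk in auto)
          also have "\<dots> \<le> (1 + L) ^ N * M * (s' - s)"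
            using x L M jk by (intro mult_mono power_increasing) auto
          finally have fin: "\<bar>y\<bar> ^ j * norm (iter_deriv k K (y - x) - iter_deriv k K (y - s))
              \<le> (1 + L) ^ N * M * (s' - s)" .
          have "norm (g x) * (\<bar>y\<bar> ^ j * norm (iter_deriv k K (y - x) - iter_deriv k K (y - s)))
              \<le> G * ((1 + L) ^ N * M * (s' - s))"
            by (rule mult_mono[OF _ fin]) (use G(2)[of x] G(1) in \<open>auto simp: iter_deriv_0\<close>)
          then show ?thesis using True by (simp add: w_def norm_mult mult_ac)
        qed (simp add: w_def)
      qed
      also have "\<dots> = (1 + L) ^ N * M * G * (s' - s)\<^sup>2"
        using s by (simp add: S_def power2_eq_square)
      finally show "\<bar>y\<bar> ^ j * norm (iter_deriv k h y) \<le> (1 + L) ^ N * M * G * (s' - s)\<^sup>2" .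
    qed
    moreover have "\<Psi> s' - \<Psi> s = T (conv (w S) K)"
      unfolding \<Psi>_def Sdiff[symmetric] using s by (intro conv_diff) auto
    ultimately show ?thesis using \<open>T h = T (conv (w S) K)\<close> by (simp add: mult_ac)
  qed
  have "(\<Psi> has_vector_derivative 0) (at s)" for s
  proof (rule has_vector_derivative_if_quadratic[of 1])
    fix h :: real assume h: "\<bar>h\<bar> < 1"
    show "norm (\<Psi> (s + h) - \<Psi> s - h *\<^sub>R 0) \<le> h\<^sup>2 * (C * ((1 + (\<bar>s\<bar> + 1)) ^ N * M * G))"
      using incr[of s "s + h" "\<bar>s\<bar> + 1"] incr[of "s + h" s "\<bar>s\<bar> + 1"] h
      by (cases "0 \<le> h") (auto simp: norm_minus_commute mult.commute)
  qed simp
  then have "(\<Psi> has_derivative (\<lambda>h. 0)) (at s)" for s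
    by (simp add: has_vector_derivative_def)
  then obtain \<kappa> where \<kappa>: "\<Psi> s = \<kappa>" for s
    using has_derivative_zero_constant[of UNIV \<Psi>] by auto
  have lim0: "(\<lambda>n. LINT x|lborel. indicator (S n) x * q x) \<longlonglongrightarrow> 0"
    if S: "\<And>n. S n \<in> sets borel" and ev: "\<And>x. \<forall>\<^sub>F n in sequentially. x \<notin> S n" for S :: "nat \<Rightarrow> real
        set"
  proof -
    have "(\<lambda>n. LINT x|lborel. indicator (S n) x * q x) \<longlonglongrightarrow> (LINT x|(lborel :: real measure). 0)"
    proof (rule integral_dominated_convergence[where w = q])
      show "AE x in lborel. (\<lambda>n. indicator (S n) x * q x) \<longlonglongrightarrow> 0"
      proof (intro AE_I2 tendsto_eventually)
        fix x show "\<forall>\<^sub>F n in sequentially. indicator (S n) x * q x = 0"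
          using ev[of x] by eventually_elim simp
      qed
      show "AE x in lborel. norm (indicator (S n) x * q x) \<le> q x" for n
        by (auto simp: indicator_def q_def)
      show "(\<lambda>x. indicator (S n) x * q x) \<in> borel_measurable lborel" for n
        using S int_q by (intro borel_measurable_times borel_measurable_indicator) auto
    qed (use int_q in auto)
    then show ?thesis by simp
  qed
  \<comment> \<open>The constant is 0 by the limit at minus infinity. The integral over all of the
    line then differs from 0 only by tails at plus infinity, which vanish in the same way.\<close>
  have "norm \<kappa> \<le> 0"
  proof (rule tendsto_lowerbound)
    show "(\<lambda>n. C * (M * (LINT x|lborel. indicator {..- real n} x * q x))) \<longlonglongrightarrow> 0"
    proof (intro tendsto_mult_right_zero lim0)
      fix x :: real
      obtain n0 :: nat where "- x < real n0" using reals_Archimedean2 by blast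
      then show "\<forall>\<^sub>F n in sequentially. x \<notin> {..- real n}"
        by (intro eventually_sequentiallyI[of n0]) auto
    qed auto
    show "\<forall>\<^sub>F n in sequentially. norm \<kappa> \<le> C * (M * (LINT x|lborel. indicator {..- real n} x * q x))"
      using T_conv_le[of "{..- real n}" for n] \<kappa> by (auto simp: \<Psi>_def)
  qed simp
  then have "\<kappa> = 0" by simp
  have "norm (T (conv (w UNIV) K)) \<le> 0"
  proof (rule tendsto_lowerbound)
    show "(\<lambda>n. C * (M * (LINT x|lborel. indicator {real n<..} x * q x))) \<longlonglongrightarrow> 0"
    proof (intro tendsto_mult_right_zero lim0)
      fix x :: real
      obtain n0 :: nat where "x < real n0" using reals_Archimedean2 by blast
      then show "\<forall>\<^sub>F n in sequentially. x \<notin> {real n<..}"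
        by (intro eventually_sequentiallyI[of n0]) auto
    qed auto
    have "T (conv (w UNIV) K) = T (conv (w {real n<..}) K)" for n
      using conv_diff[of "{..real n}" UNIV] \<kappa>[of "real n"] \<open>\<kappa> = 0\<close>
      by (simp add: \<Psi>_def Compl_eq_Diff_UNIV[symmetric] Compl_atMost)
    then show "\<forall>\<^sub>F n in sequentially. norm (T (conv (w UNIV) K))
        \<le> C * (M * (LINT x|lborel. indicator {real n<..} x * q x))"
      using T_conv_le[of "{real n<..}" for n] by auto
  qed simp
  moreover have "w UNIV = g" by (simp add: w_def fun_eq_iff)
  ultimately show ?thesis by simp
qed

text \<open>\<open>E_eq_0\<close> passes from one width to all, and \<open>T_conv_eq_0\<close> then
  shows that \<open>T\<close> kills the convolutions of \<open>g\<close> with Gaussians. Divided by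
  the mass of the Gaussian, these tend to \<open>g\<close>, as the width shrinks, in the seminorms
  that control \<open>T\<close>.\<close>

theorem eq_0_if_gaussians:
  assumes zero: "\<And>b. T (gauss_deriv 0 0 (of_real pi) b) = 0" and g: "g \<in> schwartz_space"
  shows "T g = 0"
proof -
  \<comment> \<open>The width is of order \<open>1 / a\<close>. The kernel is not normalised, and
    its mass is \<open>c / a\<close>.\<close>
  define K where "K a = gauss_deriv 0 0 (of_real (a\<^sup>2)) 0" for a :: real
  have K_eq: "K a y = of_real (exp (- (a * y)\<^sup>2))" for a y
    by (simp add: K_def exp_of_real[symmetric] power_mult_distrib)
  have K: "K a \<in> schwartz_space" if "0 < a" for a
    unfolding K_def using that by (intro gauss_schwartz) simp
  have K_shift: "T (\<lambda>y. K a (y - x)) = 0" if a: "0 < a" for a x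
  proof -
    \<comment> \<open>Translating a Gaussian changes only the linear coefficient of the exponent and
      a constant factor.\<close>
    define b where "b = complex_of_real (2 * a\<^sup>2 * x)"
    have eq: "K a (y - x) = exp (of_real (- (a * x)\<^sup>2)) * gauss_deriv 0 0 (of_real (a\<^sup>2)) b y" for y
      by (simp add: K_def b_def exp_add[symmetric] power2_eq_square algebra_simps)
    have "T (gauss_deriv 0 0 (of_real (a\<^sup>2)) b) = 0"
      using E_eq_0[of "of_real pi" "of_real (a\<^sup>2)" b] zero a by (simp add: E_def)
    then show ?thesis
      unfolding eq using a by (subst T_cmult) (auto intro!: gauss_schwartz)
  qed
  obtain M where M: "0 < M" "\<And>j k x. j \<le> N \<Longrightarrow> k \<le> Suc N
      \<Longrightarrow> (1 + \<bar>x\<bar>) ^ j * norm (iter_deriv k g x) \<le> M"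
    using uniform_1plus_bound[OF g] by blast
  \<comment> \<open>The factor \<open>\<bar>x\<bar>\<close> stems from the increment of
    \<open>g\<close>. Under scaling it yields \<open>1 / a\<close> beyond the mass of the kernel,
    and the limit rests on this gain.\<close>
  define J where "J x = (1 + \<bar>x\<bar>) ^ N * \<bar>x\<bar> * exp (- x\<^sup>2)" for x :: real
  have int_J1: "integrable lborel (\<lambda>x::real. (1 + \<bar>x\<bar>) ^ Suc N * exp (- x\<^sup>2))"
  proof -
    have "integrable lborel (\<lambda>x. (1 + \<bar>x\<bar>) ^ Suc N * norm (K 1 x))"
      using schwartz_rapidly_integrable[OF K[OF zero_less_one]]
          unfolding rapidly_integrable_def by blast
    then show ?thesis by (simp add: K_eq)
  qed
  have int_J: "integrable lborel J"
  proof (rule Bochner_Integration.integrable_bound[OF int_J1])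
    show "J \<in> borel_measurable lborel" unfolding J_def[abs_def] by measurable
    show "AE x in lborel. norm (J x) \<le> norm ((1 + \<bar>x\<bar>) ^ Suc N * exp (- x\<^sup>2))"
      by (auto simp: J_def abs_mult intro!: mult_right_mono)
  qed
  have scaled: "(LINT x|lborel. f (a * x)) = (LINT x|lborel. f x) / a" if "0 < a" for f :: "real \<Rightarrow>
      real" and a
    using lborel_integral_real_affine[of a f 0] that by (simp add: field_simps)
  define c where "c = (LINT x|lborel. exp (- x\<^sup>2) :: real)"
  have int_e: "integrable lborel (\<lambda>x::real. exp (- x\<^sup>2))"
    by (rule Bochner_Integration.integrable_bound[OF int_J1]) (auto intro!: mult_right_mono simp:
        mult_ge1_I)
  have c: "0 < c" unfolding c_def using gaussian_line_integral_pos[of 1] int_e by simp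
  have est: "c * norm (T g) \<le> C * M * (LINT x|lborel. J x) / a" if a: "1 \<le> a" for a
  proof -
    have a0: "0 < a" using a by simp
    have rK: "rapidly_integrable (K a)" by (rule schwartz_rapidly_integrable[OF K[OF a0]])
    define cc where "cc = (LINT x|lborel. K a x)"
    have cc: "cc = of_real (c / a)"
      unfolding cc_def K_eq using scaled[OF a0, of "\<lambda>x. exp (- x\<^sup>2)"] by (simp add: c_def)
    have "conv g (K a) = conv (K a) g" by (simp add: fun_eq_iff conv_commute)
    then have T0: "T (conv (K a) g) = 0" using T_conv_eq_0[OF g K[OF a0] K_shift[OF a0]] by simp
    have gS: "(\<lambda>y. cc * g y) \<in> schwartz_space" "iter_deriv k (\<lambda>y. cc * g y)
        = (\<lambda>y. cc * iter_deriv k g y)" for k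
      using schwartz_lin(1)[OF g g, of k cc 0] schwartz_lin(2)[OF g g, of cc 0] by simp_all
    define h where "h = (\<lambda>y. conv (K a) g y - cc * g y)"
    have h: "h \<in> schwartz_space" "iter_deriv k h
        = (\<lambda>y. conv (K a) (iter_deriv k g) y - cc * iter_deriv k g y)" for k
      unfolding h_def using schwartz_diff[OF conv_schwartz(1)[OF rK g] gS(1)]
      by (auto simp: conv_schwartz(2)[OF rK g] gS(2))
    have Th: "T h = - cc * T g"
      unfolding h_def using T_diff[OF conv_schwartz(1)[OF rK g] gS(1)] T_cmult[OF g, of cc] T0 by
          simp
    have "norm (T h) \<le> C * (M * (LINT x|lborel. J x) / a\<^sup>2)"
    proof (rule bound_nonneg[OF h(1)])
      show "0 \<le> M * (LINT x|lborel. J x) / a\<^sup>2"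
        using M by (intro divide_nonneg_nonneg mult_nonneg_nonneg integral_nonneg_AE) (auto simp:
            J_def)
      fix j k y assume jk: "j \<le> N" "k \<le> N"
      have i1: "integrable lborel (\<lambda>x. K a x * iter_deriv k g (y - x))"
          by (rule conv_integrable[OF rK g])
      have i2: "integrable lborel (K a)" by (rule rapidly_integrable_integrable[OF rK])
      have i3: "integrable lborel (\<lambda>x. K a x * (iter_deriv k g (y - x) - iter_deriv k g (y - 0)))"
        unfolding right_diff_distrib using i1 i2 by auto
      have "iter_deriv k h y = (LINT x|lborel. K a x * (iter_deriv k g (y - x) - iter_deriv k g (y
          - 0)))"
        unfolding h(2) conv_def cc_def right_diff_distrib using i1 i2 by simp
      then have "\<bar>y\<bar> ^ j * norm (iter_deriv k h y)
          \<le> \<bar>y\<bar> ^ j * (LINT x|lborel. norm (K a x * (iter_deriv k g (y - x) - iter_deriv k g (y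
              - 0))))"
        by (intro mult_left_mono) auto
      also have "\<dots> = (LINT x|lborel. \<bar>y\<bar> ^ j * norm (K a x * (iter_deriv k g (y - x)
          - iter_deriv k g (y - 0))))"
        by (simp only: integral_mult_right_zero)
      also have "\<dots> \<le> (LINT x|lborel. M / a * J (a * x))"
      proof (intro integral_mono)
        show "integrable lborel (\<lambda>x. \<bar>y\<bar> ^ j * norm (K a x * (iter_deriv k g (y - x)
            - iter_deriv k g (y - 0))))"
          using integrable_norm[OF i3] by auto
        show "integrable lborel (\<lambda>x. M / a * J (a * x))"
          using lborel_integrable_real_affine[OF int_J, of a 0] a0 by simp
        fix x
        have "\<bar>y\<bar> ^ j * norm (iter_deriv k g (y - x) - iter_deriv k g (y - 0))
            \<le> (1 + \<bar>x\<bar>) ^ j * M * \<bar>x - 0\<bar>"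
          by (rule schwartz_increment_bound[OF g M(2)]) (use jk in auto)
        also have "\<dots> \<le> (1 + \<bar>a * x\<bar>) ^ N * M * \<bar>x\<bar>"
        proof -
          have "\<bar>x\<bar> \<le> \<bar>a * x\<bar>" using a mult_right_mono[of 1 a "\<bar>x\<bar>"] by (simp add: abs_mult)
          then have "(1 + \<bar>x\<bar>) ^ j \<le> (1 + \<bar>a * x\<bar>) ^ j" by (intro power_mono) auto
          also have "\<dots> \<le> (1 + \<bar>a * x\<bar>) ^ N" using jk by (intro power_increasing) auto
          finally show ?thesis using M by (simp add: mult_right_mono)
        qed
        finally have "norm (K a x) * (\<bar>y\<bar> ^ j * norm (iter_deriv k g (y - x) - iter_deriv k g (y
            - 0)))
            \<le> norm (K a x) * ((1 + \<bar>a * x\<bar>) ^ N * M * \<bar>x\<bar>)" by (intro mult_left_mono) auto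
        also have "\<dots> = M / a * J (a * x)"
          using a0 by (simp add: K_eq J_def abs_mult)
        finally show "\<bar>y\<bar> ^ j * norm (K a x * (iter_deriv k g (y - x) - iter_deriv k g (y - 0)))
            \<le> M / a * J (a * x)"
          by (simp add: norm_mult mult_ac)
      qed
      also have "\<dots> = M * (LINT x|lborel. J x) / a\<^sup>2"
        using scaled[OF a0, of J] by (simp add: power2_eq_square)
      finally show "\<bar>y\<bar> ^ j * norm (iter_deriv k h y) \<le> M * (LINT x|lborel. J x) / a\<^sup>2" .
    qed
    then have "c / a * norm (T g) \<le> C * (M * (LINT x|lborel. J x) / a\<^sup>2)"
      using c a0 by (simp add: Th cc norm_mult norm_divide)
    then have "a * (c / a * norm (T g)) \<le> a * (C * (M * (LINT x|lborel. J x) / a\<^sup>2))"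
      using a0 by (intro mult_left_mono) auto
    then show ?thesis using a0 by (simp add: power2_eq_square)
  qed
  have "c * norm (T g) \<le> 0"
  proof (rule tendsto_lowerbound)
    show "(\<lambda>n. C * M * (LINT x|lborel. J x) / real n) \<longlonglongrightarrow> 0" by (rule lim_const_over_n)
    show "\<forall>\<^sub>F n in sequentially. c * norm (T g) \<le> C * M * (LINT x|lborel. J x) / real n"
      by (intro eventually_sequentiallyI[of 1] est) simp
  qed simp
  then show ?thesis using c by (simp add: mult_le_0_iff)
qed

end

section \<open>The short-time Fourier transform\<close>

context schwartz_functional
begin

text \<open>Expanding the square in the window: modulation and window combine to a Gaussian with
  quadratic coefficient \<open>pi\<close>, whose linear coefficient is \<open>2 * pi\<close> times
  the conjugate of \<open>cplx (x, \<omega>)\<close>.\<close>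

lemma stft_eq:
  "stft T (x, \<omega>) = of_real (2 powr (1/4) * exp (- pi * x\<^sup>2))
     * E 0 (of_real pi) (of_real (2 * pi) * (of_real x - \<i> * of_real \<omega>))"
proof -
  define b where "b = of_real (2 * pi) * (complex_of_real x - \<i> * of_real \<omega>)"
  have "exp (- 2 * of_real pi * \<i> * of_real y * of_real \<omega>) * gauss_window (x - y)
      = of_real (2 powr (1/4) * exp (- pi * x\<^sup>2)) * gauss_deriv 0 0 (of_real pi) b y" for y
  proof -
    have "- 2 * of_real pi * \<i> * of_real y * of_real \<omega> + complex_of_real (- pi * (x - y)\<^sup>2)
        = of_real (- pi * x\<^sup>2) + (- of_real pi * of_real (y\<^sup>2) + b * of_real y)"
      by (simp add: b_def power2_eq_square algebra_simps)
    then have "exp (- 2 * of_real pi * \<i> * of_real y * of_real \<omega>) * complex_of_real (exp (- pi * (x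
        - y)\<^sup>2))
        = of_real (exp (- pi * x\<^sup>2)) * exp (- of_real pi * of_real (y\<^sup>2) + b * of_real y)"
      by (simp only: exp_of_real[symmetric] exp_add[symmetric])
    then show ?thesis by (simp add: gauss_window_def mult.left_commute mult.assoc)
  qed
  then show ?thesis
    by (simp only: stft_def prod.case b_def[symmetric] E_def) (subst T_cmult, auto intro:
        gauss_schwartz)
qed

lemma E_holomorphic: "0 < Re a \<Longrightarrow> (\<lambda>b. E n a b) holomorphic_on UNIV"
  unfolding holomorphic_on_open[OF open_UNIV] using E_deriv_b by blast

text \<open>The STFT is analytic in \<open>x - \<i> \<omega>\<close>; the conjugations make \<open>bargmann\<close> entire in \<open>x + \<i> \<omega>\<close>.\<close>
definition bargmann :: "complex \<Rightarrow> complex" where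
  "bargmann \<zeta> = of_real (2 powr (1/4)) * cnj (E 0 (of_real pi) (of_real (2 * pi) * cnj \<zeta>))
      * exp (- of_real (pi / 2) * \<zeta>\<^sup>2)"

lemma bargmann_holomorphic: "bargmann holomorphic_on UNIV"
proof -
  have "(\<lambda>b. E 0 (of_real pi) (of_real (2 * pi) * b)) holomorphic_on UNIV"
    by (rule holomorphic_on_compose_gen[of "\<lambda>b. of_real (2 * pi)
        * b" UNIV "\<lambda>b. E 0 (of_real pi) b" UNIV, unfolded o_def])
       (auto intro!: holomorphic_intros E_holomorphic)
  then have "(cnj \<circ> (\<lambda>b. E 0 (of_real pi) (of_real (2 * pi) * b)) \<circ> cnj) holomorphic_on UNIV"
    by (intro holomorphic_on_compose_cnj_cnj) (auto intro: holomorphic_on_subset)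
  then have "(\<lambda>\<zeta>. cnj (E 0 (of_real pi) (of_real (2 * pi) * cnj \<zeta>))) holomorphic_on UNIV"
    by (simp only: o_def)
  then show ?thesis unfolding bargmann_def[abs_def] by (intro holomorphic_intros)
qed

text \<open>The square of \<open>cplx z\<close> has real part \<open>x^2 - \<omega>^2\<close>, so
  the extra exponential in \<open>bargmann\<close> turns the weight \<open>exp (- pi * x^2)\<close>
  into a rotation invariant one.\<close>

lemma norm_stft: "norm (stft T z) = norm (bargmann (cplx z)) * exp (- (pi / 2) * (norm z)\<^sup>2)"
proof -
  obtain x \<omega> where z: "z = (x, \<omega>)" by (cases z)
  have c: "cnj (cplx z) = of_real x - \<i> * of_real \<omega>" by (simp add: z cplx_def complex_eq_iff)
  have r: "Re (- of_real (pi / 2) * (cplx z)\<^sup>2) = - (pi / 2) * (x\<^sup>2 - \<omega>\<^sup>2)"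
    by (simp add: z cplx_def power2_eq_square)
  have n: "(norm z)\<^sup>2 = x\<^sup>2 + \<omega>\<^sup>2" by (simp add: z norm_prod_def)
  have e: "exp (- (pi / 2) * (x\<^sup>2 - \<omega>\<^sup>2)) * exp (- (pi / 2) * (x\<^sup>2 + \<omega>\<^sup>2)) = exp (- pi * x\<^sup>2)"
    unfolding exp_add[symmetric] by (simp add: field_simps)
  have "norm (bargmann (cplx z)) = 2 powr (1/4) * norm (E 0 (of_real pi) (of_real (2 * pi)
      * (of_real x - \<i> * of_real \<omega>)))
      * exp (- (pi / 2) * (x\<^sup>2 - \<omega>\<^sup>2))"
    unfolding bargmann_def c norm_mult norm_exp_eq_Re r complex_mod_cnj norm_of_real by simp
  then have "norm (bargmann (cplx z)) * exp (- (pi / 2) * (norm z)\<^sup>2)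
     = 2 powr (1/4) * norm (E 0 (of_real pi) (of_real (2 * pi) * (of_real x
         - \<i> * of_real \<omega>))) * exp (- pi * x\<^sup>2)"
    unfolding n by (simp only: mult.assoc e)
  then show ?thesis unfolding z stft_eq norm_mult norm_of_real by simp
qed

lemma norm_stft_powr:
  assumes "0 < p"
  shows "norm (stft T z) powr p = norm (bargmann (cplx z)) powr p * gaussian 1 (p * pi / 2) 0 z"
  using assms by (simp add: norm_stft powr_mult exp_powr_real gaussian_def algebra_simps)

text \<open>If the transform is 0, then \<open>T\<close> vanishes on all Gaussians with quadratic
  coefficient \<open>pi\<close>, since \<open>b\<close> ranges over the whole plane along with
  \<zeta>.\<close>

lemma bargmann_nonzero:
  assumes "\<not> distr_eq T (\<lambda>_. 0)"
  shows "\<exists>\<zeta>. bargmann \<zeta> \<noteq> 0"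
proof (rule ccontr)
  assume "\<not> ?thesis"
  then have z: "bargmann \<zeta> = 0" for \<zeta> by blast
  have "T (gauss_deriv 0 0 (of_real pi) b) = 0" for b
    using z[of "cnj (b / of_real (2 * pi))"] by (simp add: bargmann_def E_def)
  then have "T g = 0" if "g \<in> schwartz_space" for g using eq_0_if_gaussians that by blast
  then show False using assms by (simp add: distr_eq_def)
qed

end

section \<open>Integrable functions as functionals, and uniqueness\<close>

lemma distr_of_fun_functional:
  assumes w: "integrable lborel w"
  shows "schwartz_functional (distr_of_fun w) 0 (LINT x|lborel. norm (w x))"
proof
  have int: "integrable lborel (\<lambda>y. w y * g y)" if g: "g \<in> schwartz_space" for g
  proof -
    obtain B where B: "0 < B" "\<And>x. \<bar>x\<bar> ^ 0 * norm (iter_deriv 0 g x) \<le> B"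
        using schwartz_bound[OF g] by blast
    have m: "g \<in> borel_measurable borel"
      using schwartz_rapidly_integrable[OF g] by (simp add: rapidly_integrable_def)
    show ?thesis
    proof (rule Bochner_Integration.integrable_bound)
      show "integrable lborel (\<lambda>y. B * norm (w y))" using w by simp
      show "(\<lambda>y. w y * g y) \<in> borel_measurable lborel" using w m
          by (intro borel_measurable_times) auto
      have "norm (w y) * norm (g y) \<le> norm (w y) * B" for y
        using B(2)[of y] by (intro mult_left_mono) (auto simp: iter_deriv_0)
      then show "AE y in lborel. norm (w y * g y) \<le> norm (B * norm (w y))"
        using B(1) by (auto simp: norm_mult mult.commute)
    qed
  qed
  show "distr_of_fun w (\<lambda>x. a * g x + b * h x) = a * distr_of_fun w g + b * distr_of_fun w h"
    if g: "g \<in> schwartz_space" and h: "h \<in> schwartz_space" for g h a b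
  proof -
    have "(LINT y|lborel. w y * (a * g y + b * h y))
        = (LINT y|lborel. a * (w y * g y) + b * (w y * h y))"
      by (intro Bochner_Integration.integral_cong) (auto simp: algebra_simps)
    then show ?thesis using int[OF g] int[OF h] by (simp add: distr_of_fun_def)
  qed
  show "0 \<le> (LINT x|lborel. norm (w x))" by (intro integral_nonneg_AE) auto
  fix h B assume h: "h \<in> schwartz_space" and B: "0 < B"
    and bnd: "\<And>j k x. j \<le> 0 \<Longrightarrow> k \<le> 0 \<Longrightarrow> \<bar>x\<bar> ^ j * norm (iter_deriv k h x) \<le> B"
  have hB: "norm (h x) \<le> B" for x using bnd[of 0 0 x] by (simp add: iter_deriv_0)
  have "norm (distr_of_fun w h) \<le> (LINT y|lborel. norm (w y * h y))"
    unfolding distr_of_fun_def by (rule integral_norm_bound)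
  also have "\<dots> \<le> (LINT y|lborel. norm (w y) * B)"
    using integrable_norm[OF int[OF h]] w hB by (intro integral_mono) (auto simp: norm_mult
        mult_left_mono)
  also have "\<dots> = (LINT x|lborel. norm (w x)) * B" by simp
  finally show "norm (distr_of_fun w h) \<le> (LINT x|lborel. norm (w x)) * B" .
qed

text \<open>Closure under differences is what turns the vanishing criterion
  \<open>eq_0_if_gaussians\<close> into a criterion for \<open>distr_eq\<close>.\<close>

lemma schwartz_functional_diff:
  assumes "schwartz_functional S N1 C1" "schwartz_functional T N2 C2"
  shows "schwartz_functional (\<lambda>g. S g - T g) (max N1 N2) (C1 + C2)"
proof -
  interpret S: schwartz_functional S N1 C1 by fact
  interpret T: schwartz_functional T N2 C2 by fact
  show ?thesis
  proof
    fix h B assume h: "h \<in> schwartz_space" and B: "0 < B"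
      and bnd: "\<And>j k x. j \<le> max N1 N2 \<Longrightarrow> k \<le> max N1 N2 \<Longrightarrow> \<bar>x\<bar> ^ j * norm (iter_deriv k h x) \<le> B"
    have "norm (S h) \<le> C1 * B" "norm (T h) \<le> C2 * B"
      by (rule S.bound[OF h B] T.bound[OF h B], rule bnd, auto)+
    then show "norm (S h - T h) \<le> (C1 + C2) * B"
      using norm_triangle_ineq4[of "S h" "T h"] by (simp add: distrib_right)
  qed (use S.C T.C S.lin T.lin in \<open>auto simp: algebra_simps\<close>)
qed

lemma distr_eq_if_gaussians:
  assumes "schwartz_functional S N1 C1" "schwartz_functional T N2 C2"
    and eq: "\<And>b. S (gauss_deriv 0 0 (of_real pi) b) = T (gauss_deriv 0 0 (of_real pi) b)"
  shows "distr_eq S T"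
proof -
  interpret schwartz_functional "\<lambda>g. S g - T g" "max N1 N2" "C1 + C2"
    by (rule schwartz_functional_diff[OF assms(1,2)])
  have "S g - T g = 0" if "g \<in> schwartz_space" for g
    by (rule eq_0_if_gaussians) (use eq that in auto)
  then show ?thesis by (simp add: distr_eq_def)
qed

text \<open>Integration is viewed as a functional so that \<open>E_holomorphic\<close> supplies the
  analyticity of Gaussian integrals in the linear coefficient.\<close>

lemma integral_functional:
  "schwartz_functional (\<lambda>g. LINT x|lborel. g x) 2 (2 * (LINT x::real|lborel. inverse (1 + x\<^sup>2)))"
proof
  have int: "integrable lborel g" if "g \<in> schwartz_space" for g
    by (rule rapidly_integrable_integrable[OF schwartz_rapidly_integrable[OF that]])
  show "(LINT x|lborel. a * g x + b * h x) = a * (LINT x|lborel. g x) + b * (LINT x|lborel. h x)"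
    if "g \<in> schwartz_space" "h \<in> schwartz_space" for g h a b
    using int[OF that(1)] int[OF that(2)] by simp
  show "0 \<le> 2 * (LINT x::real|lborel. inverse (1 + x\<^sup>2))"
    by (intro mult_nonneg_nonneg integral_nonneg_AE) auto
  fix h B assume h: "h \<in> schwartz_space" and B: "0 < B"
    and bnd: "\<And>j k x. j \<le> 2 \<Longrightarrow> k \<le> 2 \<Longrightarrow> \<bar>x\<bar> ^ j * norm (iter_deriv k h x) \<le> B"
  have hB: "norm (h x) \<le> 2 * B * inverse (1 + x\<^sup>2)" for x
  proof -
    have p: "0 < 1 + x\<^sup>2" by (simp add: add_pos_nonneg)
    have "norm (h x) * (1 + x\<^sup>2) \<le> 2 * B"
      using bnd[of 0 0 x] bnd[of 2 0 x] by (simp add: iter_deriv_0 algebra_simps)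
    then have "norm (h x) \<le> 2 * B / (1 + x\<^sup>2)" using p by (simp only: pos_le_divide_eq)
    then show ?thesis by (simp add: divide_inverse)
  qed
  have "norm (LINT x|lborel. h x) \<le> (LINT x|lborel. norm (h x))" by (rule integral_norm_bound)
  also have "\<dots> \<le> (LINT x|lborel. 2 * B * inverse (1 + x\<^sup>2))"
    using integrable_norm[OF int[OF h]] integrable_inverse_quadratic hB
        by (intro integral_mono) auto
  also have "\<dots> = 2 * (LINT x::real|lborel. inverse (1 + x\<^sup>2)) * B" by simp
  finally show "norm (LINT x|lborel. h x) \<le> 2 * (LINT x::real|lborel. inverse (1 + x\<^sup>2)) * B" .
qed

text \<open>For real \<open>\<beta>\<close> the formula is a translation; both sides are entire in \<open>\<beta>\<close>.\<close>
lemma gauss_line_integral: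
  fixes a :: real
  assumes a: "0 < a"
  obtains k where "k \<noteq> 0" "\<And>\<beta>. (LINT x|lborel. gauss_deriv 0 0 (of_real a) \<beta> x)
      = k * exp (\<beta>\<^sup>2 / of_real (4 * a))"
proof -
  interpret I: schwartz_functional "\<lambda>g. LINT x|lborel. g x" 2 "2 * (LINT x::real|lborel. inverse (1
      + x\<^sup>2))"
    by (rule integral_functional)
  have a': "0 < Re (of_real a)" using a by simp
  have int: "integrable lborel (gauss_deriv 0 0 (of_real a) \<beta>)" for \<beta>
    by (rule rapidly_integrable_integrable[OF schwartz_rapidly_integrable[OF gauss_schwartz(1)[OF
        a']]])
  define k where "k = I.E 0 (of_real a) 0"
  \<comment> \<open>A real coefficient written as \<open>2 * a * s\<close> corresponds to the
    Gaussian translated by \<open>s\<close>.\<close>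
  have real: "I.E 0 (of_real a) (of_real (2 * a * s))
      = k * exp ((of_real (2 * a * s))\<^sup>2 / of_real (4 * a))" for s :: real
  proof -
    have "k = (LINT x|lborel. gauss_deriv 0 0 (of_real a) 0 (- s + x))"
      using lborel_integral_real_affine[of 1 "gauss_deriv 0 0 (of_real a) 0" "- s"]
          by (simp add: k_def I.E_def)
    also have "(\<lambda>x. gauss_deriv 0 0 (of_real a) 0 (- s + x))
        = (\<lambda>x. exp (- of_real (a * s\<^sup>2)) * gauss_deriv 0 0 (of_real a) (of_real (2 * a * s)) x)"
      by (simp add: fun_eq_iff exp_add[symmetric] power2_eq_square algebra_simps)
    finally have "k = exp (- of_real (a * s\<^sup>2)) * I.E 0 (of_real a) (of_real (2 * a * s))"
      using int by (simp add: I.E_def)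
    moreover have "(of_real (2 * a * s))\<^sup>2 / of_real (4 * a) = (of_real (a * s\<^sup>2) :: complex)"
      using a by (simp add: power2_eq_square field_simps)
    ultimately show ?thesis by (simp add: exp_minus field_simps)
  qed
  have "I.E 0 (of_real a) \<beta> - k * exp (\<beta>\<^sup>2 / of_real (4 * a)) = 0" for \<beta>
  proof (rule analytic_continuation[of "\<lambda>\<beta>. I.E 0 (of_real a) \<beta>
      - k * exp (\<beta>\<^sup>2 / of_real (4 * a))" UNIV \<real> 0])
    show "(\<lambda>\<beta>. I.E 0 (of_real a) \<beta> - k * exp (\<beta>\<^sup>2 / of_real (4 * a))) holomorphic_on UNIV"
      using a by (intro holomorphic_intros I.E_holomorphic) auto
    show "(0 :: complex) islimpt \<real>"
      unfolding islimpt_approachable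
    proof (intro allI impI)
      fix e :: real assume "0 < e"
      then show "\<exists>x'\<in>\<real>. x' \<noteq> (0 :: complex) \<and> dist x' 0 < e"
        by (intro bexI[of _ "of_real (e / 2)"]) (auto simp: norm_divide)
    qed
    show "I.E 0 (of_real a) z - k * exp (z\<^sup>2 / of_real (4 * a)) = 0" if z: "z \<in> \<real>" for z
    proof -
      obtain r where "z = of_real r" using z by (auto simp: Reals_def)
      then have "z = of_real (2 * a * (r / (2 * a)))" using a by simp
      then show ?thesis using real[of "r / (2 * a)"] by simp
    qed
  qed auto
  \<comment> \<open>\<open>k\<close> is the integral of a positive function. It is left unevaluated,
    since the constant of the atom can absorb it.\<close>
  moreover have "k \<noteq> 0"
  proof -
    have e: "gauss_deriv 0 0 (of_real a) 0 x = of_real (exp (- a * x\<^sup>2))" for x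
      by (simp add: exp_of_real[symmetric])
    have "integrable lborel (\<lambda>x. Re (gauss_deriv 0 0 (of_real a) 0 x))"
        by (rule integrable_Re[OF int])
    then have "integrable lborel (\<lambda>x::real. exp (- a * x\<^sup>2))" by (simp only: e Re_complex_of_real)
    from gaussian_line_integral_pos[OF a this] show ?thesis
      unfolding k_def I.E_def e integral_complex_of_real by simp
  qed
  ultimately show thesis using that by (simp add: I.E_def)
qed

section \<open>Time-frequency shifts of the window\<close>

definition gauss_atom :: "complex \<Rightarrow> real \<Rightarrow> real \<Rightarrow> real \<Rightarrow> complex" where
  "gauss_atom c x0 \<omega>0 = (\<lambda>x. c * exp (2 * of_real pi * \<i> * of_real x * of_real \<omega>0) * gauss_window (x
      - x0))"

lemma gauss_atom_eq:
  "gauss_atom c x0 \<omega>0 x = c * of_real (2 powr (1/4) * exp (- pi * x0\<^sup>2))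
     * gauss_deriv 0 0 (of_real pi) (of_real (2 * pi) * cplx (x0, \<omega>0)) x"
proof -
  have z: "cplx (x0, \<omega>0) = of_real x0 + \<i> * of_real \<omega>0" by (simp add: cplx_def complex_eq_iff)
  have "2 * of_real pi * \<i> * of_real x * of_real \<omega>0 + complex_of_real (- pi * (x - x0)\<^sup>2)
      = of_real (- pi * x0\<^sup>2) + (- of_real pi * of_real (x\<^sup>2)
          + (of_real (2 * pi) * cplx (x0, \<omega>0)) * of_real x)"
    by (simp add: z power2_eq_square algebra_simps)
  then have "exp (2 * of_real pi * \<i> * of_real x * of_real \<omega>0) * complex_of_real (exp (- pi * (x
      - x0)\<^sup>2))
      = of_real (exp (- pi * x0\<^sup>2)) * exp (- of_real pi * of_real (x\<^sup>2)
          + (of_real (2 * pi) * cplx (x0, \<omega>0)) * of_real x)"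
    by (simp only: exp_of_real[symmetric] exp_add[symmetric])
  then show ?thesis by (simp add: gauss_atom_def gauss_window_def mult.left_commute mult.assoc)
qed

lemma gauss_atom_integrable: "integrable lborel (gauss_atom c x0 \<omega>0)"
proof -
  have "integrable lborel (gauss_deriv 0 0 (of_real pi) b)" for b
    by (rule rapidly_integrable_integrable[OF schwartz_rapidly_integrable[OF gauss_schwartz(1)]])
        simp
  then show ?thesis unfolding gauss_atom_eq[abs_def] by (intro integrable_mult_right)
qed

text \<open>The product of two Gaussians with quadratic coefficient \<open>pi\<close> has
  coefficient \<open>2 * pi\<close>, hence the denominator \<open>8 * pi = 4 * (2 * pi)\<close>. The
  factor \<open>k\<close> is the same for all \<open>c\<close> and \<open>b\<close>, so a prescribed
  multiple can be matched by the choice of \<open>c\<close>.\<close>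

lemma gauss_atom_distr:
  obtains k where "k \<noteq> 0" "\<And>c b. distr_of_fun (gauss_atom c x0 \<omega>0) (gauss_deriv 0 0 (of_real pi) b)
    = c * k * exp (cplx (x0, \<omega>0) * b / 2 + b\<^sup>2 / of_real (8 * pi))"
proof -
  define \<zeta> where "\<zeta> = cplx (x0, \<omega>0)"
  define K where "K = complex_of_real (2 powr (1/4) * exp (- pi * x0\<^sup>2))"
  obtain k where k: "k \<noteq> 0" "\<And>\<beta>. (LINT x|lborel. gauss_deriv 0 0 (of_real (2 * pi)) \<beta> x)
      = k * exp (\<beta>\<^sup>2 / of_real (4 * (2 * pi)))"
    using gauss_line_integral[of "2 * pi"] by auto
  have "distr_of_fun (gauss_atom c x0 \<omega>0) (gauss_deriv 0 0 (of_real pi) b)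
      = c * (K * k * exp (of_real (pi / 2) * \<zeta>\<^sup>2)) * exp (\<zeta> * b / 2
          + b\<^sup>2 / of_real (8 * pi))" for c b
  proof -
    have prod: "gauss_atom c x0 \<omega>0 y * gauss_deriv 0 0 (of_real pi) b y
        = c * K * gauss_deriv 0 0 (of_real (2 * pi)) (of_real (2 * pi) * \<zeta> + b) y" for y
      unfolding gauss_atom_eq K_def[symmetric] \<zeta>_def[symmetric]
      by (simp add: exp_add[symmetric] algebra_simps)
    have e: "(of_real (2 * pi) * \<zeta> + b)\<^sup>2 / of_real (4 * (2 * pi))
        = of_real (pi / 2) * \<zeta>\<^sup>2 + (\<zeta> * b / 2 + b\<^sup>2 / of_real (8 * pi))"
      by (simp add: power2_eq_square field_simps)
    show ?thesis
      unfolding distr_of_fun_def prod by (simp only: integral_mult_right_zero k(2) e exp_add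
          mult.assoc)
  qed
  moreover have "K * k * exp (of_real (pi / 2) * \<zeta>\<^sup>2) \<noteq> 0" using k(1) by (simp add: K_def)
  ultimately show thesis using that \<zeta>_def by blast
qed

section \<open>Concentration in modulation spaces\<close>

locale modulation = schwartz_functional T N C
  for T :: "(real \<Rightarrow> complex) \<Rightarrow> complex" and N :: nat and C p :: real +
  assumes p: "1 \<le> p" and mod: "T \<in> modulation_space p" and nonzero: "\<not> distr_eq T (\<lambda>_. 0)"
begin

lemma stft_powr: "norm (stft T z) powr p = norm (bargmann (cplx z)) powr p * gaussian 1 (p
    * pi / 2) 0 z"
  using p by (intro norm_stft_powr) simp

lemma stft_powr_cont: "continuous_on UNIV (\<lambda>z. norm (stft T z) powr p)"
proof -
  have "continuous_on UNIV (\<lambda>z. bargmann (cplx z))"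
    by (intro continuous_on_compose2[OF holomorphic_on_imp_continuous_on[OF bargmann_holomorphic]]
        continuous_intros) auto
  then show ?thesis
    unfolding stft_powr using p
    by (intro continuous_on_mult continuous_on_gaussian continuous_on_powr' continuous_on_norm
        continuous_on_const) auto
qed

lemma stft_powr_integrable: "integrable lborel (\<lambda>z. norm (stft T z) powr p)"
proof (rule integrableI_nonneg)
  show m: "(\<lambda>z. norm (stft T z) powr p) \<in> borel_measurable lborel"
    using borel_measurable_continuous_onI[OF stft_powr_cont] by simp
  have "modulation_norm p T < \<infinity>" using mod by (simp add: modulation_space_def)
  then have "(\<integral>\<^sup>+ z. ennreal (norm (stft T z) powr p) \<partial>lebesgue) \<noteq> \<infinity>"
    by (auto simp: modulation_norm_def Lp_norm_def Let_def)
  then show "(\<integral>\<^sup>+ z. ennreal (norm (stft T z) powr p) \<partial>lborel) < \<infinity>"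
    using m by (simp add: nn_integral_completion less_top)
qed simp

sublocale fock bargmann p "p * pi / 2"
proof
  show "bargmann holomorphic_on UNIV" by (rule bargmann_holomorphic)
  show "0 < p * pi / 2" using p by simp
  show "\<exists>\<zeta>. bargmann \<zeta> \<noteq> 0" by (rule bargmann_nonzero[OF nonzero])
  show "integrable lborel (\<lambda>z. norm (bargmann (cplx z)) powr p * gaussian 1 (p * pi / 2) 0 z)"
    using stft_powr_integrable by (simp only: stft_powr)
qed (rule p)

lemma u_stft: "norm (stft T z) powr p = u z"
  unfolding u_def by (rule stft_powr)

lemma concentration_eq_quotient:
  "stft_concentration p \<Omega> T = (LINT z:\<Omega>|lebesgue. u z) / (LINT z|lborel. u z)"
proof -
  have "(LINT z|lebesgue. u z) = (LINT z|lborel. u z)"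
    using borel_measurable_continuous_onI[OF u_cont] by (intro integral_completion) simp
  then show ?thesis by (simp only: stft_concentration_def u_stft)
qed

lemma exponent: "- measure lebesgue \<Omega> / (pi / (p * pi / 2)) = - p * measure lebesgue \<Omega> / 2"
  using p by (simp add: field_simps)

lemma stft_concentration_le:
  assumes Om: "\<Omega> \<in> lmeasurable"
  shows "stft_concentration p \<Omega> T \<le> 1 - exp (- p * measure lebesgue \<Omega> / 2)"
proof (cases "measure lebesgue \<Omega> = 0")
  \<comment> \<open>\<open>concentration_le\<close> concerns sets of positive measure; on a null set
    both sides are 0.\<close>
  case True
  then have "emeasure lebesgue \<Omega> = 0" using emeasure_eq_measure2[OF Om] by simp
  then have "\<Omega> \<in> null_sets lebesgue" using fmeasurableD[OF Om] by (rule null_setsI)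
  then have "AE z in lebesgue. indicator \<Omega> z *\<^sub>R u z = 0"
    using AE_not_in by (force elim: eventually_mono)
  then have "(LINT z:\<Omega>|lebesgue. u z) = 0"
    unfolding set_lebesgue_integral_def by (rule integral_eq_zero_AE)
  then show ?thesis by (simp add: concentration_eq_quotient True)
next
  case False
  then have "0 < measure lebesgue \<Omega>" by (simp add: zero_less_measure_iff)
  from concentration_le[OF Om this] show ?thesis
    unfolding exponent concentration_eq_quotient using u_integral_pos
        by (simp add: pos_divide_le_eq)
qed

lemma stft_concentration_eqD:
  assumes Om: "\<Omega> \<in> lmeasurable" "0 < measure lebesgue \<Omega>"
    and eq: "stft_concentration p \<Omega> T = 1 - exp (- p * measure lebesgue \<Omega> / 2)"
  shows "\<exists>x0 \<omega>0. (\<exists>r>0. sym_diff \<Omega> (ball (x0, \<omega>0) r) \<in> null_sets lebesgue) \<and>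
    (\<exists>c. c \<noteq> 0 \<and> distr_eq T (distr_of_fun (gauss_atom c x0 \<omega>0)))"
proof -
  have "(LINT z:\<Omega>|lebesgue. u z) = (1 - exp (- p * measure lebesgue \<Omega> / 2)) * (LINT z|lborel. u z)"
    using eq u_integral_pos unfolding concentration_eq_quotient by (simp add: nonzero_divide_eq_eq)
  then obtain z0 r where r: "0 < r" "sym_diff \<Omega> (ball z0 r) \<in> null_sets lebesgue"
    and ne: "bargmann (cplx z0) \<noteq> 0"
    and B: "\<And>w. bargmann (cplx z0 + w) = bargmann (cplx z0) * exp (of_real (2 * (p * pi / 2) / p)
        * cnj (cplx z0) * w)"
    using concentration_eq[OF Om] unfolding exponent by blast
  obtain x0 \<omega>0 where z0: "z0 = (x0, \<omega>0)" by (cases z0)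
  define \<zeta>0 where "\<zeta>0 = cplx z0"
  have pp: "2 * (p * pi / 2) / p = pi" using p by simp
  \<comment> \<open>The constant that appears when the exponential is expanded around 0 instead of
    \<open>\<zeta>0\<close>.\<close>
  define A where "A = bargmann \<zeta>0 * exp (- of_real pi * cnj \<zeta>0 * \<zeta>0)"
  have A: "A \<noteq> 0" using ne by (simp add: A_def \<zeta>0_def)
  have B': "bargmann \<zeta> = A * exp (of_real pi * cnj \<zeta>0 * \<zeta>)" for \<zeta>
  proof -
    have "bargmann \<zeta> = bargmann \<zeta>0 * exp (of_real pi * cnj \<zeta>0 * (\<zeta> - \<zeta>0))"
      using B[of "\<zeta> - \<zeta>0"] unfolding pp \<zeta>0_def by simp
    also have "of_real pi * cnj \<zeta>0 * (\<zeta> - \<zeta>0)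
        = - of_real pi * cnj \<zeta>0 * \<zeta>0 + of_real pi * cnj \<zeta>0 * \<zeta>"
      by (simp add: algebra_simps)
    finally show ?thesis by (simp only: A_def exp_add mult.assoc)
  qed
  define s where "s = complex_of_real (2 powr (1/4))"
  have s: "s \<noteq> 0" by (simp add: s_def)
  \<comment> \<open>Undoing the conjugations in \<open>bargmann\<close> gives the values of
    \<open>T\<close> on all Gaussians with quadratic coefficient \<open>pi\<close>, in the same form
    as in \<open>gauss_atom_distr\<close>.\<close>
  have E: "T (gauss_deriv 0 0 (of_real pi) b)
      = cnj A / s * exp (\<zeta>0 * b / 2 + b\<^sup>2 / of_real (8 * pi))" for b
  proof -
    define \<eta> where "\<eta> = b / of_real (2 * pi)"
    have b: "b = of_real (2 * pi) * \<eta>" by (simp add: \<eta>_def)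
    have "cnj (bargmann (cnj \<eta>)) = s * E 0 (of_real pi) b * exp (- of_real (pi / 2) * \<eta>\<^sup>2)"
      by (simp add: bargmann_def s_def b exp_cnj)
    moreover have "cnj (bargmann (cnj \<eta>)) = cnj A * exp (of_real pi * \<zeta>0 * \<eta>)"
      by (simp add: B' exp_cnj)
    ultimately have "s * E 0 (of_real pi) b * exp (- of_real (pi / 2) * \<eta>\<^sup>2) * exp (of_real (pi / 2)
        * \<eta>\<^sup>2)
        = cnj A * exp (of_real pi * \<zeta>0 * \<eta>) * exp (of_real (pi / 2) * \<eta>\<^sup>2)" by simp
    then have "s * E 0 (of_real pi) b = cnj A * exp (of_real pi * \<zeta>0 * \<eta> + of_real (pi / 2) * \<eta>\<^sup>2)"
      by (simp add: mult.assoc exp_add[symmetric])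
    moreover have "of_real pi * \<zeta>0 * \<eta> + of_real (pi / 2) * \<eta>\<^sup>2
        = \<zeta>0 * b / 2 + b\<^sup>2 / of_real (8 * pi)"
      by (simp add: b power2_eq_square field_simps)
    ultimately have "s * T (gauss_deriv 0 0 (of_real pi) b)
        = cnj A * exp (\<zeta>0 * b / 2 + b\<^sup>2 / of_real (8 * pi))"
      by (simp only: E_def)
    moreover have "T (gauss_deriv 0 0 (of_real pi) b) = s * T (gauss_deriv 0 0 (of_real pi) b) / s"
      using s by simp
    ultimately show ?thesis by simp
  qed
  obtain k where k: "k \<noteq> 0" "\<And>c b. distr_of_fun (gauss_atom c x0 \<omega>0) (gauss_deriv 0 0 (of_real pi)
      b)
      = c * k * exp (cplx (x0, \<omega>0) * b / 2 + b\<^sup>2 / of_real (8 * pi))"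
    using gauss_atom_distr by blast
  \<comment> \<open>The choice that makes the atom agree with \<open>T\<close> on these Gaussians;
    \<open>distr_eq_if_gaussians\<close> extends the agreement to all Schwartz functions.\<close>
  define c where "c = cnj A / s / k"
  have c: "c \<noteq> 0" using A s k by (simp add: c_def)
  have "distr_eq T (distr_of_fun (gauss_atom c x0 \<omega>0))"
  proof (rule distr_eq_if_gaussians[OF schwartz_functional_axioms distr_of_fun_functional[OF
      gauss_atom_integrable]])
    show "T (gauss_deriv 0 0 (of_real pi) b) = distr_of_fun (gauss_atom c x0 \<omega>0) (gauss_deriv 0 0
        (of_real pi) b)" for b
      unfolding E k(2) using k(1) by (simp add: c_def \<zeta>0_def z0)
  qed
  then show ?thesis using r c z0 by blast
qed

lemma stft_concentration_eqI:
  assumes Om: "\<Omega> \<in> lmeasurable" and r: "0 < r" "sym_diff \<Omega> (ball (x0, \<omega>0) r) \<in> null_sets lebesgue"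
    and c: "c \<noteq> 0" and eq: "distr_eq T (distr_of_fun (gauss_atom c x0 \<omega>0))"
  shows "stft_concentration p \<Omega> T = 1 - exp (- p * measure lebesgue \<Omega> / 2)"
proof -
  obtain k where k: "k \<noteq> 0" "\<And>c b. distr_of_fun (gauss_atom c x0 \<omega>0) (gauss_deriv 0 0 (of_real pi)
      b)
      = c * k * exp (cplx (x0, \<omega>0) * b / 2 + b\<^sup>2 / of_real (8 * pi))"
    using gauss_atom_distr by blast
  have E: "E 0 (of_real pi) b = c * k * exp (cplx (x0, \<omega>0) * b / 2 + b\<^sup>2 / of_real (8 * pi))" for b
  proof -
    have "gauss_deriv 0 0 (of_real pi) b \<in> schwartz_space" by (intro gauss_schwartz) simp
    then have "T (gauss_deriv 0 0 (of_real pi) b)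
        = distr_of_fun (gauss_atom c x0 \<omega>0) (gauss_deriv 0 0 (of_real pi) b)"
      using eq unfolding distr_eq_def by blast
    then show ?thesis unfolding E_def k(2) .
  qed
  \<comment> \<open>The maximum of the modulus of the STFT, found by completing the square around
    \<open>(x0, \<omega>0)\<close>.\<close>
  define t where "t = 2 powr (1/4) * norm (c * k) * exp (pi / 2 * (x0\<^sup>2 + \<omega>0\<^sup>2))"
  have t: "0 < t" using c k(1) by (simp add: t_def)
  have stft_gauss: "norm (stft T (x, \<omega>)) = t * exp (- (pi / 2) * ((x - x0)\<^sup>2 + (\<omega> - \<omega>0)\<^sup>2))" for x \<omega>
  proof -
    define b where "b = of_real (2 * pi) * (complex_of_real x - \<i> * of_real \<omega>)"
    have "Re (cplx (x0, \<omega>0) * b / 2) = pi * (x0 * x + \<omega>0 * \<omega>)"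
      by (simp add: b_def cplx_def algebra_simps)
    moreover have "b\<^sup>2 / of_real (8 * pi) = of_real (pi / 2) * (complex_of_real x
        - \<i> * of_real \<omega>)\<^sup>2"
      by (simp add: b_def power2_eq_square field_simps)
    then have "Re (b\<^sup>2 / of_real (8 * pi)) = pi / 2 * Re ((complex_of_real x - \<i> * of_real \<omega>)\<^sup>2)"
      by (simp only: times_complex.sel Re_complex_of_real Im_complex_of_real mult_zero_left
          diff_zero)
    then have "Re (b\<^sup>2 / of_real (8 * pi)) = pi / 2 * (x\<^sup>2 - \<omega>\<^sup>2)"
      by (simp add: power2_eq_square)
    ultimately have n: "norm (E 0 (of_real pi) b)
        = norm (c * k) * exp (pi * (x0 * x + \<omega>0 * \<omega>) + pi / 2 * (x\<^sup>2 - \<omega>\<^sup>2))"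
      by (simp only: E norm_mult norm_exp_eq_Re plus_complex.sel)
    have e: "exp (- pi * x\<^sup>2) * exp (pi * (x0 * x + \<omega>0 * \<omega>) + pi / 2 * (x\<^sup>2 - \<omega>\<^sup>2))
        = exp (pi / 2 * (x0\<^sup>2 + \<omega>0\<^sup>2)) * exp (- (pi / 2) * ((x - x0)\<^sup>2 + (\<omega> - \<omega>0)\<^sup>2))"
      unfolding exp_add[symmetric] by (simp add: power2_eq_square field_simps)
    have "norm (stft T (x, \<omega>)) = 2 powr (1/4) * norm (c * k)
        * (exp (- pi * x\<^sup>2) * exp (pi * (x0 * x + \<omega>0 * \<omega>) + pi / 2 * (x\<^sup>2 - \<omega>\<^sup>2)))"
      unfolding stft_eq b_def[symmetric] norm_mult[of "of_real _"] n norm_of_real by simp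
    then show ?thesis unfolding e t_def by (simp only: mult.assoc)
  qed
  have u_eq: "u z = gaussian (t powr p) (p * pi / 2) (x0, \<omega>0) z" for z
  proof (cases z)
    case (Pair x \<omega>)
    have "(norm (z - (x0, \<omega>0)))\<^sup>2 = (x - x0)\<^sup>2 + (\<omega> - \<omega>0)\<^sup>2" by (simp add: Pair norm_prod_def)
    moreover have "u z = (t * exp (- (pi / 2) * ((x - x0)\<^sup>2 + (\<omega> - \<omega>0)\<^sup>2))) powr p"
      by (simp only: u_stft[symmetric] Pair stft_gauss)
    then have "u z = t powr p * exp (- (pi / 2) * ((x - x0)\<^sup>2 + (\<omega> - \<omega>0)\<^sup>2) * p)"
      using t by (simp add: powr_mult exp_powr_real)
    ultimately show ?thesis by (simp add: gaussian_def mult_ac)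
  qed
  have "(LINT z:\<Omega>|lebesgue. u z) = (1 - exp (- p * measure lebesgue \<Omega> / 2)) * (LINT z|lborel. u z)"
    unfolding u_eq exponent[symmetric] using p t r Om
        by (intro gaussian_concentration[of _ _ r]) auto
  then show ?thesis unfolding concentration_eq_quotient using u_integral_pos by simp
qed

end

theorem theorem5p3:
  fixes p :: real
  assumes "1 \<le> p"
  shows
    "(\<forall>(\<Omega> :: (real \<times> real) set) f.
        \<Omega> \<in> lmeasurable \<and> f \<in> modulation_space p \<and> \<not> distr_eq f (\<lambda>_. 0) \<longrightarrow>
        stft_concentration p \<Omega> f \<le> 1 - exp (- p * measure lebesgue \<Omega> / 2)) \<and>
     (\<forall>(\<Omega> :: (real \<times> real) set) f.
        \<Omega> \<in> lmeasurable \<and> 0 < measure lebesgue \<Omega> \<and>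
        f \<in> modulation_space p \<and> \<not> distr_eq f (\<lambda>_. 0) \<longrightarrow>
        (stft_concentration p \<Omega> f = 1 - exp (- p * measure lebesgue \<Omega> / 2) \<longleftrightarrow>
         (\<exists>x\<^sub>0 \<omega>\<^sub>0.
            (\<exists>r>0. sym_diff \<Omega> (ball (x\<^sub>0, \<omega>\<^sub>0) r) \<in> null_sets lebesgue) \<and>
            (\<exists>c. c \<noteq> 0 \<and>
               distr_eq f (distr_of_fun
                 (\<lambda>x. c * exp (2 * of_real pi * \<i> * of_real x * of_real \<omega>\<^sub>0) * gauss_window (x - x\<^sub>0)))))))"
proof -
  \<comment> \<open>The order \<open>N\<close> and the constant \<open>C\<close> depend on
    \<open>f\<close>, so each distribution enters the locale with its own pair.\<close>
  have "\<exists>N C. modulation f N C p" if f: "f \<in> modulation_space p" "\<not> distr_eq f (\<lambda>_. 0)" for f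
  proof -
    obtain N C where "schwartz_functional f N C"
      using tempered_schwartz_functional f by (auto simp: modulation_space_def)
    then show ?thesis using f assms by (auto simp: modulation_def modulation_axioms_def)
  qed
  then show ?thesis
    unfolding gauss_atom_def[symmetric]
    using modulation.stft_concentration_le modulation.stft_concentration_eqD modulation.stft_concentration_eqI
    by (meson)
qed

end
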